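(* Let $\mathcal{C}$ be a clutter with vertex set $\{x_1,\ldots,x_n\}$, let $R=K[x_1,\ldots,x_n]$ be a polynomial ring over a field $K$, and let $J=I(\mathcal{C})^\vee\subset R$ be the ideal of covers of $\mathcal{C}$. If $\mathcal{C}$ is uniform and its set covering polyhedron is integral, then (a) $\operatorname{depth}(R/J^{(k)})\geq\operatorname{depth}(R/J^{(k+1)})$ for all $k\geq 1$, and (b) $\operatorname{reg}(R/J^{(k)})\leq\operatorname{reg}(R/J^{(k+1)})$ for all $k\geq 1$.
   Context: A clutter $\mathcal{C}$ with vertex set $X=\{x_1,\ldots,x_n\}$ is a family of subsets of $X$, called edges, none of which is included in another; clutters are taken to have at least one edge, and all edges to be nonempty. $\mathcal{C}$ is uniform if all its edges have the same cardinality. A vertex cover of $\mathcal{C}$ is a subset of $X$ meeting every edge. The ideal of covers $I(\mathcal{C})^\vee$ is the ideal generated by the monomials $\prod_{x_i\in C}x_i$, with $C$ a minimal vertex cover of $\mathcal{C}$; equivalently $I(\mathcal{C})^\vee=\bigcap_{e}(e)$, where $e$ runs over the edges of $\mathcal{C}$ and $(e)$ is the ideal generated by the variables in $e$. The incidence matrix $A$ of $\mathcal{C}$ is the 0-1 matrix whose columns are the characteristic vectors of the edges. The set covering polyhedron of $\mathcal{C}$ is $\mathcal{Q}(A)=\{x\in\mathbb{R}^n\mid x\geq 0,\ xA\geq\mathbf{1}\}$ with $\mathbf{1}=(1,\ldots,1)$; it is integral if it has only integral vertices. For a squarefree monomial ideal $J$ with associated primes $\mathfrak{p}_1,\ldots,\mathfrak{p}_s$,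 the $k$-th symbolic power is $J^{(k)}=\mathfrak{p}_1^k\cap\cdots\cap\mathfrak{p}_s^k$. $\operatorname{reg}$ is Castelnuovo--Mumford regularity, and depth is with respect to the graded maximal ideal. *)

theory Defs
  imports
    "HOL-Analysis.Polytope"
    "HOL-Library.Poly_Mapping"
    "HOL-Library.Extended_Nat"
    "HOL-Library.Extended_Real"
    "Jordan_Normal_Form.Matrix_Kernel"
begin

section \<open>Clutters and the set covering polyhedron\<close>

text \<open>The vertices are the elements of a finite type \<open>'n\<close>; a clutter on them is given by its
  set of edges. Vertices lying on no edge are allowed.\<close>

definition clutter :: "'n::finite set set \<Rightarrow> bool" where
  "clutter E \<longleftrightarrow> E \<noteq> {} \<and> {} \<notin> E \<and> (\<forall>e\<in>E. \<forall>e'\<in>E. e \<subseteq> e' \<longrightarrow> e = e')"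

definition uniform_clutter :: "'n::finite set set \<Rightarrow> bool" where
  "uniform_clutter E \<longleftrightarrow> (\<exists>d. \<forall>e\<in>E. card e = d)"

definition vertex_cover :: "'n::finite set set \<Rightarrow> 'n set \<Rightarrow> bool" where
  "vertex_cover E C \<longleftrightarrow> (\<forall>e\<in>E. C \<inter> e \<noteq> {})"

definition minimal_vertex_cover :: "'n::finite set set \<Rightarrow> 'n set \<Rightarrow> bool" where
  "minimal_vertex_cover E C \<longleftrightarrow> vertex_cover E C \<and> (\<forall>C'. C' \<subset> C \<longrightarrow> \<not> vertex_cover E C')"

text \<open>Rows are indexed by the vertices and columns by the edges themselves, so that no
  enumeration of the edges has to be chosen.\<close>

definition incidence_matrix :: "'n::finite \<Rightarrow> 'n set \<Rightarrow> real" where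
  "incidence_matrix i e = (if i \<in> e then 1 else 0)"

definition set_covering_polyhedron :: "'n::finite set set \<Rightarrow> (real ^ 'n) set" where
  "set_covering_polyhedron E =
     {x. (\<forall>i. 0 \<le> vec_nth x i) \<and> (\<forall>e\<in>E. 1 \<le> (\<Sum>i\<in>UNIV. vec_nth x i * incidence_matrix i e))}"

definition integral_polyhedron :: "(real ^ 'n::finite) set \<Rightarrow> bool" where
  "integral_polyhedron Q \<longleftrightarrow> (\<forall>v. v extreme_point_of Q \<longrightarrow> (\<forall>i. vec_nth v i \<in> \<int>))"

section \<open>Polynomials and ideals\<close>

text \<open>The polynomial ring over \<open>'k\<close> with one variable for each element of \<open>'n\<close>: a polynomial
  maps each exponent vector to its coefficient.\<close>

type_synonym ('n, 'k) mpolynomial = "('n \<Rightarrow>\<^sub>0 nat) \<Rightarrow>\<^sub>0 'k"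

definition variable :: "'n \<Rightarrow> ('n, 'k::field) mpolynomial" where
  "variable i = Poly_Mapping.single (Poly_Mapping.single i 1) 1"

definition total_degree :: "('n::finite \<Rightarrow>\<^sub>0 nat) \<Rightarrow> nat" where
  "total_degree m = (\<Sum>i\<in>UNIV. Poly_Mapping.lookup m i)"

text \<open>Zero is homogeneous of every degree, and is the only homogeneous polynomial of a given
  negative degree.\<close>

definition homogeneous :: "int \<Rightarrow> ('n::finite, 'k::field) mpolynomial \<Rightarrow> bool" where
  "homogeneous d p \<longleftrightarrow> (\<forall>m\<in>Poly_Mapping.keys p. int (total_degree m) = d)"

text \<open>An ideal of a commutative ring is a submodule of the ring over itself.\<close>

abbreviation is_ideal :: "'a::comm_ring_1 set \<Rightarrow> bool" where
  "is_ideal \<equiv> Modules.module.subspace (*)"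

abbreviation ideal_span :: "'a::comm_ring_1 set \<Rightarrow> 'a set" where
  "ideal_span \<equiv> Modules.module.span (*)"

primrec ideal_power :: "'a::comm_ring_1 set \<Rightarrow> nat \<Rightarrow> 'a set" where
  "ideal_power I 0 = UNIV"
| "ideal_power I (Suc k) = ideal_span {a * b | a b. a \<in> I \<and> b \<in> ideal_power I k}"

definition is_prime_ideal :: "'a::comm_ring_1 set \<Rightarrow> bool" where
  "is_prime_ideal P \<longleftrightarrow>
     is_ideal P \<and> P \<noteq> UNIV \<and> (\<forall>a b. a * b \<in> P \<longrightarrow> a \<in> P \<or> b \<in> P)"

text \<open>The associated primes of an ideal \<open>J\<close> of a ring \<open>R\<close> are those of the module \<open>R/J\<close>, that is,
  the prime ideals that are annihilators of an element of \<open>R/J\<close>.\<close>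

definition associated_primes :: "'a::comm_ring_1 set \<Rightarrow> 'a set set" where
  "associated_primes J = {P. is_prime_ideal P \<and> (\<exists>f. P = {g. g * f \<in> J})}"

text \<open>This is the usual symbolic power only for ideals, such as squarefree monomial ideals, that
  are intersections of prime ideals.\<close>

definition symbolic_power :: "'a::comm_ring_1 set \<Rightarrow> nat \<Rightarrow> 'a set" where
  "symbolic_power J k = (\<Inter>P\<in>associated_primes J. ideal_power P k)"

definition ideal_of_covers :: "'n::finite set set \<Rightarrow> ('n, 'k::field) mpolynomial set" where
  "ideal_of_covers E = ideal_span {\<Prod>i\<in>C. variable i | C. minimal_vertex_cover E C}"

definition graded_maximal_ideal :: "('n::finite, 'k::field) mpolynomial set" where
  "graded_maximal_ideal = ideal_span (range variable)"

section \<open>Depth and regularity of \<open>R/I\<close>\<close>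

text \<open>\<open>fs\<close> is a regular sequence on \<open>R/I\<close>: each \<open>fs ! t\<close> is a nonzerodivisor on the quotient of
  \<open>R\<close> by \<open>I\<close> and the preceding elements, and the quotient by \<open>I\<close> and all of \<open>fs\<close> is nonzero.\<close>

definition regular_sequence_on_quotient :: "'a::comm_ring_1 set \<Rightarrow> 'a list \<Rightarrow> bool" where
  "regular_sequence_on_quotient I fs \<longleftrightarrow>
     (\<forall>t<length fs. \<forall>g. fs ! t * g \<in> ideal_span (I \<union> set (take t fs))
                          \<longrightarrow> g \<in> ideal_span (I \<union> set (take t fs))) \<and>
     ideal_span (I \<union> set fs) \<noteq> UNIV"

definition depth_quotient :: "('n::finite, 'k::field) mpolynomial set \<Rightarrow> enat" where
  "depth_quotient I =
     (SUP fs\<in>{fs. set fs \<subseteq> graded_maximal_ideal \<and> regular_sequence_on_quotient I fs}.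
        enat (length fs))"

text \<open>A minimal graded free resolution of \<open>R/I\<close>,
  \<open>\<dots> \<rightarrow> F\<^sub>2 \<rightarrow> F\<^sub>1 \<rightarrow> F\<^sub>0 = R \<rightarrow> R/I \<rightarrow> 0\<close>. The list \<open>ds i\<close> holds the shifts of
  \<open>F\<^sub>i = \<Oplus>\<^sub>t R(- ds i ! t)\<close>, and the matrix \<open>\<phi> i\<close> describes the map \<open>F\<^bsub>i+1\<^esub> \<rightarrow> F\<^sub>i\<close>. The entry
  conditions say that the maps preserve degrees and that the image of \<open>F\<^bsub>i+1\<^esub>\<close> lies in \<open>\<mm> F\<^sub>i\<close>, where
  \<open>\<mm>\<close> is the graded maximal ideal; the last two conditions are exactness at \<open>F\<^sub>0\<close> and at \<open>F\<^bsub>i+1\<^esub>\<close>.\<close>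

definition minimal_graded_free_resolution ::
  "('n::finite, 'k::field) mpolynomial set \<Rightarrow> (nat \<Rightarrow> int list) \<Rightarrow>
    (nat \<Rightarrow> ('n, 'k) mpolynomial mat) \<Rightarrow> bool" where
  "minimal_graded_free_resolution I ds \<phi> \<longleftrightarrow>
     ds 0 = [0] \<and>
     (\<forall>i. \<phi> i \<in> carrier_mat (length (ds i)) (length (ds (Suc i)))) \<and>
     (\<forall>i. \<forall>s<length (ds i). \<forall>t<length (ds (Suc i)).
        homogeneous (ds (Suc i) ! t - ds i ! s) (\<phi> i $$ (s, t)) \<and>
        \<phi> i $$ (s, t) \<in> graded_maximal_ideal) \<and>
     {\<phi> 0 *\<^sub>v v | v. v \<in> carrier_vec (length (ds 1))}
       = {w \<in> carrier_vec 1. vec_index w 0 \<in> I} \<and>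
     (\<forall>i. {\<phi> (Suc i) *\<^sub>v v | v. v \<in> carrier_vec (length (ds (Suc (Suc i))))}
            = mat_kernel (\<phi> i))"

text \<open>The regularity of \<open>R/I\<close> is the maximum of \<open>j - i\<close> over all \<open>i\<close> and \<open>j\<close> such that \<open>R(-j)\<close> is a
  summand of \<open>F\<^sub>i\<close>. Minimal graded free resolutions are unique up to isomorphism, so that ranging
  over all of them yields the same set of pairs as any one of them. By Hilbert's syzygy theorem
  the set is finite for homogeneous \<open>I\<close>; for \<open>I = R\<close> it is empty and the supremum is \<open>-\<infinity>\<close>.\<close>

definition regularity_quotient :: "('n::finite, 'k::field) mpolynomial set \<Rightarrow> ereal" where
  "regularity_quotient I =
     (SUP (i, j)\<in>{(i, j). \<exists>ds \<phi>. minimal_graded_free_resolution I ds \<phi> \<and> j \<in> set (ds i)}.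
        ereal (real_of_int (j - int i)))"

end

theory Submission
  imports Defs "HOL-Library.Function_Algebras"
begin

text \<open>
  Why the theorem is true. Suppose that all edges have \<open>d\<close> elements. The face of the set covering
  polyhedron on which all covering inequalities are tight and the coordinates of vertices on no edge
  vanish is nonempty: it contains the vector with entries \<open>1/d\<close> at the other vertices. So it has an
  extreme point, which is integral by hypothesis, and is the characteristic vector of a set \<open>C\<close> that
  meets every edge in exactly one vertex (\<open>exact_cover_exists\<close>). The \<open>k\<close>-th symbolic power is spanned
  by the monomials \<open>x\<^sup>a\<close> with \<open>k \<le> (\<Sum>i\<in>e. a i)\<close> for all edges \<open>e\<close>
  (\<open>symbolic_power_ideal_of_covers\<close>), so that multiplication of \<open>x\<^sup>a\<close> by the monomial
  \<open>f = (\<Prod>i\<in>C. x\<^sub>i)\<close> raises each of these sums by one. Hence the colon ideal of \<open>J\<^sup>(\<^sup>k\<^sup>+\<^sup>1\<^sup>)\<close> by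
  \<open>f\<close> is \<open>J\<^sup>(\<^sup>k\<^sup>)\<close>, and everything follows from two facts on a monomial ideal \<open>I\<close> and a squarefree
  monomial \<open>f\<close>: the depth of \<open>R/(I : f)\<close> is at least that of \<open>R/I\<close>, and its regularity is at most
  that of \<open>R/I\<close>.

  Depth. A regular sequence of length \<open>r\<close> in the graded maximal ideal makes the Koszul homology of the
  variables on \<open>R/I\<close> vanish in all degrees above \<open>n - r\<close> (\<open>koszul_exact_of_regular_sequence\<close>), and
  conversely (\<open>regular_sequence_of_koszul_exact\<close>). The converse needs a nonzerodivisor in an ideal
  that annihilates no nonzero element of the quotient at hand; it is found by prime avoidance, for
  which ascending chains of ideals must become stationary (\<open>no_strictly_increasing_ideals\<close>).
  Vanishing of Koszul homology in a
  given degree passes from \<open>I\<close> to \<open>I : x\<close> for each variable \<open>x\<close> (\<open>koszul_exact_colon_variable\<close>).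

  Regularity. A multigraded free resolution is a list of multidegrees and a matrix of scalars in each
  step, and its exactness can be tested in each multidegree \<open>b\<close> separately, where only the generators
  of degree at most \<open>b\<close> matter. Replacing every multidegree \<open>c\<close> of a minimal resolution of \<open>R/I\<close> by
  the truncated difference \<open>c - deg f\<close> and keeping the scalars gives a resolution of \<open>R/(I : f)\<close>,
  since \<open>c - deg f\<close> is at most \<open>b\<close> if and only if \<open>c\<close> is at most \<open>b + deg f\<close>. It need not be minimal,
  but all shifts of a minimal resolution occur in any other graded free resolution
  (\<open>minimal_shifts_subset\<close>), and truncated subtraction does not increase degrees. As the regularity is
  a supremum over existing minimal resolutions, such a resolution of \<open>R/I\<close> has to be constructed
  (\<open>multigraded_minimal_resolution_exists\<close>).
\<close>

section \<open>Monomial ideals\<close>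

abbreviation lookup where "lookup \<equiv> Poly_Mapping.lookup"
abbreviation keys where "keys \<equiv> Poly_Mapping.keys"
abbreviation single where "single \<equiv> Poly_Mapping.single"

interpretation ring_ideal: Modules.module "(*) :: 'a::comm_ring_1 \<Rightarrow> 'a \<Rightarrow> 'a"
  by unfold_locales (simp_all add: algebra_simps)

(* As a rewrite rule this law undoes mult.assoc. *)
declare ring_ideal.scale_scale [simp del]

lemma ideal_mult_left: "is_ideal L \<Longrightarrow> p \<in> L \<Longrightarrow> q * p \<in> L"
  by (rule ring_ideal.subspace_scale)

lemma ideal_mult_right: "is_ideal L \<Longrightarrow> p \<in> L \<Longrightarrow> p * q \<in> L"
  by (metis ideal_mult_left mult.commute)

lemma lookup_single_mult_shift:
  fixes p :: "'a::cancel_comm_monoid_add \<Rightarrow>\<^sub>0 'k::comm_ring_1"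
  shows "lookup (single a c * p) (a + b) = c * lookup p b"
proof -
  have "lookup (single a c * p) (a + b)
      = (\<Sum>l. (c when a = l) * (\<Sum>q. lookup p q when a + b = l + q))"
    by (simp add: lookup_mult lookup_single)
  also have "\<dots> = (\<Sum>l. (c * (\<Sum>q. lookup p q when a + b = a + q)) when a = l)"
    by (intro Sum_any.cong) (auto simp: when_def)
  also have "\<dots> = c * lookup p b"
    by simp
  finally show ?thesis .
qed

lemma lookup_single_mult:
  fixes p :: "'a::cancel_comm_monoid_add \<Rightarrow>\<^sub>0 'k::comm_ring_1"
  shows "lookup (single a c * p) m
     = (if \<exists>b. m = a + b then c * lookup p (m - a) else 0)"
proof (cases "\<exists>b. m = a + b")
  case True
  then show ?thesis using lookup_single_mult_shift[of a c p "m - a"] by auto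
next
  case False
  have "m \<notin> keys (single a c * p)"
    using False keys_mult[of "single a c" p] by (auto split: if_splits)
  then show ?thesis using False by (simp add: in_keys_iff)
qed

lemma sum_of_terms:
  fixes p :: "'a \<Rightarrow>\<^sub>0 'k::comm_monoid_add"
  shows "p = (\<Sum>a\<in>keys p. single a (lookup p a))"
proof (rule poly_mapping_eqI)
  fix m
  have "lookup (\<Sum>a\<in>keys p. single a (lookup p a)) m
    = (\<Sum>a\<in>keys p. if a = m then lookup p a else 0)"
    by (simp add: lookup_sum lookup_single when_def)
  also have "\<dots> = lookup p m"
    by (simp add: in_keys_iff)
  finally show "lookup p m = lookup
     (\<Sum>a\<in>keys p. single a (lookup p a)) m" by simp
qed

definition monomial_ideal :: "('n \<Rightarrow>\<^sub>0 nat) set \<Rightarrow> ('n, 'k::field) mpolynomial set" where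
  "monomial_ideal U = {p. keys p \<subseteq> U}"

text \<open>A set of exponent vectors that is closed under divisibility: \<open>a\<close> divides \<open>c\<close> if and only if
  \<open>c = a + b\<close> for some \<open>b\<close>. For such \<open>U\<close> the monomials with exponents in \<open>U\<close> span an ideal.\<close>

definition upward_closed :: "('n \<Rightarrow>\<^sub>0 nat) set \<Rightarrow> bool" where
  "upward_closed U \<longleftrightarrow> (\<forall>a\<in>U. \<forall>b. a + b \<in> U)"

lemma keys_mult_upward_closed:
  fixes p q :: "('n, 'k::field) mpolynomial"
  assumes "upward_closed U" "keys q \<subseteq> U"
  shows "keys (p * q) \<subseteq> U"
proof
  fix m assume "m \<in> keys (p * q)"
  then obtain a b where "m = a + b" "b \<in> keys q" using keys_mult[of p q] by blast
  then have "m = b + a" "b \<in> U" using assms by (auto simp: add.commute)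
  then show "m \<in> U" using assms(1) by (auto simp: upward_closed_def)
qed

lemma monomial_ideal_is_ideal:
  assumes "upward_closed U"
  shows "is_ideal (monomial_ideal U :: ('n, 'k::field) mpolynomial set)"
  unfolding ring_ideal.subspace_def monomial_ideal_def
proof (intro conjI ballI allI)
  show "0 \<in> {p :: ('n, 'k) mpolynomial. keys p \<subseteq> U}" by simp
next
  fix p q :: "('n, 'k) mpolynomial"
  assume "p \<in> {p. keys p \<subseteq> U}" "q \<in> {p. keys p \<subseteq> U}"
  then show "p + q \<in> {p. keys p \<subseteq> U}" using keys_add[of p q] by auto
next
  fix c p :: "('n, 'k) mpolynomial"
  assume "p \<in> {p. keys p \<subseteq> U}"
  then show "c * p \<in> {p. keys p \<subseteq> U}"
    using keys_mult_upward_closed[OF assms] by blast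
qed

lemma monomial_ideal_subset_ideal:
  fixes L :: "('n, 'k::field) mpolynomial set"
  assumes "is_ideal L" "\<And>a. a \<in> U \<Longrightarrow> single a 1 \<in> L"
  shows "monomial_ideal U \<subseteq> L"
proof
  fix p :: "('n, 'k) mpolynomial" assume p: "p \<in> monomial_ideal U"
  have "(\<Sum>a\<in>keys p. single a (lookup p a)) \<in> L"
  proof (rule ring_ideal.subspace_sum[OF assms(1)])
    fix a assume "a \<in> keys p"
    then have "single a 1 \<in> L" using p assms(2) by (auto simp: monomial_ideal_def)
    then have "single 0 (lookup p a) * single a 1 \<in> L"
      by (rule ideal_mult_left[OF assms(1)])
    then show "single a (lookup p a) \<in> L" by (simp add: mult_single)
  qed
  then show "p \<in> L" using sum_of_terms[of p] by simp
qed

section \<open>A monomial order and the basis theorem\<close>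

text \<open>The lexicographic order with respect to an enumeration of the variables. For words of equal
  length the length-lexicographic order is the lexicographic one, and it is well-founded.\<close>

lemma monomial_order_exists:
  "\<exists>r :: (('n::finite \<Rightarrow>\<^sub>0 nat) \<times> ('n \<Rightarrow>\<^sub>0 nat)) set. wf r \<and> trans r
     \<and> (\<forall>a b. a \<noteq> b \<longrightarrow> (a, b) \<in> r \<or> (b, a) \<in> r) \<and> (\<forall>a b c. (a, b) \<in> r \<longrightarrow> (a + c, b + c) \<in> r)"
proof -
  obtain vs :: "'n list" where vs: "set vs = UNIV" using finite_list[OF finite_class.finite_UNIV] by blast
  define r where "r = inv_image (lenlex less_than) (\<lambda>a :: 'n \<Rightarrow>\<^sub>0 nat. map (lookup a) vs)"
  have "wf r" unfolding r_def by (intro wf_inv_image wf_lenlex wf_less_than)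
  moreover have "trans r" unfolding r_def
    by (intro trans_inv_image lenlex_transI trans_less_than)
  moreover have "(a, b) \<in> r \<or> (b, a) \<in> r" if "a \<noteq> b" for a b
  proof -
    obtain i where "lookup a i \<noteq> lookup b i"
      using \<open>a \<noteq> b\<close> poly_mapping_eqI by metis
    then have "map (lookup a) vs \<noteq> map (lookup b) vs"
      using vs by (metis UNIV_I map_eq_conv)
    moreover have "total (lenlex (less_than :: nat rel))" by (rule total_lenlex) simp
    ultimately show ?thesis unfolding r_def total_on_def by (simp only: in_inv_image) blast
  qed
  moreover have "(a + c, b + c) \<in> r" if "(a, b) \<in> r" for a b c
  proof -
    have "(map f ws, map g ws) \<in> lex less_than \<Longrightarrow>
      (map (\<lambda>i. f i + h i) ws, map (\<lambda>i. g i + h i) ws) \<in> lex less_than" for f g h and ws :: "'n list"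
      by (induction ws) auto
    moreover have "lookup (d + c) = (\<lambda>i. lookup d i + lookup c i)" for d
      by (rule ext) (rule lookup_add)
    ultimately show ?thesis using that unfolding r_def by (simp add: lenlex_def)
  qed
  ultimately show ?thesis by blast
qed

definition monomial_less :: "(('n::finite \<Rightarrow>\<^sub>0 nat) \<times> ('n \<Rightarrow>\<^sub>0 nat)) set" where
  "monomial_less = (SOME r. wf r \<and> trans r
     \<and> (\<forall>a b. a \<noteq> b \<longrightarrow> (a, b) \<in> r \<or> (b, a) \<in> r) \<and> (\<forall>a b c. (a, b) \<in> r \<longrightarrow> (a + c, b + c) \<in> r))"

lemma monomial_less_properties:
  "wf (monomial_less :: (('n::finite \<Rightarrow>\<^sub>0 nat) \<times> ('n \<Rightarrow>\<^sub>0 nat)) set) \<and>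
   trans (monomial_less :: (('n \<Rightarrow>\<^sub>0 nat) \<times> ('n \<Rightarrow>\<^sub>0 nat)) set) \<and>
   (\<forall>a b :: 'n \<Rightarrow>\<^sub>0 nat. a \<noteq> b \<longrightarrow> (a, b) \<in> monomial_less \<or> (b, a) \<in> monomial_less) \<and>
   (\<forall>a b c :: 'n \<Rightarrow>\<^sub>0 nat. (a, b) \<in> monomial_less \<longrightarrow> (a + c, b + c) \<in> monomial_less)"
  unfolding monomial_less_def by (rule someI_ex[OF monomial_order_exists])

lemmas wf_monomial_less = monomial_less_properties[THEN conjunct1]
  and trans_monomial_less = monomial_less_properties[THEN conjunct2, THEN conjunct1]
  and total_monomial_less =
    monomial_less_properties[THEN conjunct2, THEN conjunct2, THEN conjunct1, rule_format]
  and add_monomial_less =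
    monomial_less_properties[THEN conjunct2, THEN conjunct2, THEN conjunct2, rule_format]

definition leading_exponent :: "('n::finite, 'k::field) mpolynomial \<Rightarrow> ('n \<Rightarrow>\<^sub>0 nat) \<Rightarrow> bool" where
  "leading_exponent p a \<longleftrightarrow> a \<in> keys p \<and> (\<forall>b\<in>keys p. b \<noteq> a \<longrightarrow> (b, a) \<in> monomial_less)"

lemma monomial_greatest_exists:
  fixes A :: "('n::finite \<Rightarrow>\<^sub>0 nat) set"
  assumes "finite A" "A \<noteq> {}"
  shows "\<exists>a\<in>A. \<forall>b\<in>A. b \<noteq> a \<longrightarrow> (b, a) \<in> monomial_less"
  using assms
proof (induction rule: finite_ne_induct)
  case (insert x F)
  then obtain a where a: "a \<in> F" "\<forall>b\<in>F. b \<noteq> a \<longrightarrow> (b, a) \<in> monomial_less" by blast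
  have "x \<noteq> a" using insert a by blast
  then consider "(x, a) \<in> monomial_less" | "(a, x) \<in> monomial_less" using total_monomial_less by blast
  then show ?case
  proof cases
    case 1
    then show ?thesis using a by blast
  next
    case 2
    then have "\<forall>b\<in>F. (b, x) \<in> monomial_less" using a(2) trans_monomial_less by (metis transD)
    then show ?thesis by blast
  qed
qed simp

lemma leading_exponent_exists: "p \<noteq> 0 \<Longrightarrow> \<exists>a. leading_exponent p a"
  unfolding leading_exponent_def
  using monomial_greatest_exists[of "keys p"] by auto

text \<open>The hypothesis says that \<open>a + b\<close> arises in only one way as a sum of exponents of \<open>p\<close> and \<open>q\<close>, so
  that no cancellation takes place in this coefficient.\<close>

lemma lookup_mult_leading:
  fixes p q :: "('n::finite, 'k::field) mpolynomial"
  assumes "\<And>c d. c \<in> keys p \<Longrightarrow> d \<in> keys q \<Longrightarrow> c + d = a + b \<Longrightarrow> c = a \<and> d = b"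
  shows "lookup (p * q) (a + b) = lookup p a * lookup q b"
proof -
  have *: "lookup (single c (lookup p c) * q) (a + b)
      = (if c = a then lookup p a * lookup q b else 0)"
    if c: "c \<in> keys p" for c
  proof (cases "c = a")
    case True
    then show ?thesis by (simp add: lookup_single_mult_shift)
  next
    case False
    have "(a + b) \<notin> keys (single c (lookup p c) * q)"
      using keys_mult[of "single c (lookup p c)" q] assms[OF c] False
      by (fastforce split: if_splits)
    then show ?thesis using False by (simp add: in_keys_iff)
  qed
  have "p * q = (\<Sum>c\<in>keys p. single c (lookup p c) * q)"
    by (subst sum_of_terms[of p]) (simp add: sum_distrib_right)
  then have "lookup (p * q) (a + b) = (\<Sum>c\<in>keys p.
      lookup (single c (lookup p c) * q) (a + b))"
    by (simp add: lookup_sum)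
  also have "\<dots> = (\<Sum>c\<in>keys p. if c = a then lookup p a * lookup q b else 0)"
    by (intro sum.cong refl *)
  also have "\<dots> = lookup p a * lookup q b"
    by (simp add: in_keys_iff)
  finally show ?thesis .
qed

lemma nat_seq_mono_subseq:
  fixes s :: "nat \<Rightarrow> nat"
  shows "\<exists>f :: nat \<Rightarrow> nat. strict_mono f \<and> mono (\<lambda>n. s (f n))"
proof -
  obtain f where f: "strict_mono (f :: nat \<Rightarrow> nat)" "monoseq (\<lambda>n. s (f n))" using seq_monosub by blast
  show ?thesis
  proof (cases "incseq (\<lambda>n. s (f n))")
    case True
    then show ?thesis using f by blast
  next
    case False
    then have dec: "decseq (\<lambda>n. s (f n))" using f by (auto simp: monoseq_iff)
    obtain N where N: "\<And>n. s (f N) \<le> s (f n)"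
      using arg_min_nat_le[of "\<lambda>_. True" _ "\<lambda>n. s (f n)"] by blast
    have eq: "s (f (N + n)) = s (f N)" for n
      using N[of "N + n"] decseqD[OF dec, of N "N + n"] by simp
    have "strict_mono (\<lambda>n. f (N + n))" using f(1) by (simp add: strict_mono_def)
    then show ?thesis using eq by (intro exI[of _ "\<lambda>n. f (N + n)"]) (simp add: mono_def)
  qed
qed

text \<open>Dickson's lemma: monotone subsequences can be extracted one coordinate after the other.\<close>

lemma dickson:
  fixes f :: "nat \<Rightarrow> 'n::finite \<Rightarrow>\<^sub>0 nat"
  shows "\<exists>i j c. i < j \<and> f j = f i + c"
proof -
  have "\<exists>\<phi> :: nat \<Rightarrow> nat. strict_mono \<phi> \<and> (\<forall>k\<in>A. mono (\<lambda>i. lookup (f (\<phi> i)) k))" if "finite A" for A :: "'n set"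
    using that
  proof induction
    case empty
    then show ?case by (auto intro!: exI[of _ id] simp: strict_mono_def)
  next
    case (insert x F)
    then obtain \<phi> :: "nat \<Rightarrow> nat" where \<phi>: "strict_mono \<phi>" "\<forall>k\<in>F. mono (\<lambda>i. lookup (f (\<phi> i)) k)" by blast
    obtain \<psi> :: "nat \<Rightarrow> nat" where \<psi>: "strict_mono \<psi>" "mono (\<lambda>i. lookup (f (\<phi> (\<psi> i))) x)"
      using nat_seq_mono_subseq[of "\<lambda>i. lookup (f (\<phi> i)) x"] by blast
    have "mono (\<lambda>i. lookup (f (\<phi> (\<psi> i))) k)" if "k \<in> F" for k
      using \<phi>(2) \<psi>(1) that by (meson mono_def strict_mono_mono)
    then show ?case using \<phi>(1) \<psi>
      by (intro exI[of _ "\<lambda>i. \<phi> (\<psi> i)"]) (simp add: strict_mono_def)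
  qed
  from this[OF finite_class.finite_UNIV] obtain \<phi> :: "nat \<Rightarrow> nat" where \<phi>: "strict_mono \<phi>"
      "\<And>k. mono (\<lambda>i. lookup (f (\<phi> i)) k)" by auto
  have "f (\<phi> 1) = f (\<phi> 0) + (f (\<phi> 1) - f (\<phi> 0))"
    by (rule poly_mapping_eqI) (use \<phi>(2) in \<open>simp add: lookup_add lookup_minus mono_def\<close>)
  moreover have "\<phi> 0 < \<phi> 1" using \<phi>(1) by (simp add: strict_mono_def)
  ultimately show ?thesis by blast
qed

text \<open>Hilbert's basis theorem. From each step of the chain pick a new element \<open>h k\<close> whose leading
  exponent is least. By Dickson's lemma one of these exponents divides a later one; reducing the later
  element by the earlier gives a new element of the same step with a smaller leading exponent.\<close>

theorem no_strictly_increasing_ideals: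
  fixes f :: "nat \<Rightarrow> ('n::finite, 'k::field) mpolynomial set"
  assumes ideal: "\<And>k. is_ideal (f k)" and incr: "\<And>k. f k \<subset> f (Suc k)"
  shows False
proof -
  have "\<exists>h a. h \<in> f (Suc k) - f k \<and> leading_exponent h a \<and>
     (\<forall>h' a'. h' \<in> f (Suc k) - f k \<longrightarrow> leading_exponent h' a' \<longrightarrow> (a', a) \<notin> monomial_less)" for k
  proof -
    define Q where "Q = {a. \<exists>h\<in>f (Suc k) - f k. leading_exponent h a}"
    obtain h where h: "h \<in> f (Suc k) - f k" using incr by blast
    then have "h \<noteq> 0" using ideal ring_ideal.subspace_0 by blast
    then obtain a0 where "leading_exponent h a0" using leading_exponent_exists by blast
    then have "a0 \<in> Q" using h Q_def by blast
    then obtain a where "a \<in> Q" "\<And>y. (y, a) \<in> monomial_less \<Longrightarrow> y \<notin> Q"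
      using wfE_min[OF wf_monomial_less] by metis
    then show ?thesis unfolding Q_def by blast
  qed
  then obtain h a where h: "\<And>k. h k \<in> f (Suc k) - f k" and lead: "\<And>k. leading_exponent (h k) (a k)"
    and min: "\<And>k h' a'. h' \<in> f (Suc k) - f k \<Longrightarrow> leading_exponent h' a' \<Longrightarrow> (a', a k) \<notin> monomial_less"
    by metis
  obtain i j c where ij: "i < j" "a j = a i + c" using dickson by blast
  define q where "q = lookup (h j) (a j) / lookup (h i) (a i)"
  define g where "g = h j - single c q * h i"
  have mono: "f k \<subseteq> f l" if "k \<le> l" for k l
    using that by (rule lift_Suc_mono_le[rotated]) (use incr in blast)
  have hi: "h i \<in> f j" using h[of i] mono[of "Suc i" j] ij by auto
  then have hi': "single c q * h i \<in> f j" by (rule ideal_mult_left[OF ideal])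
  then have "single c q * h i \<in> f (Suc j)" using incr by blast
  then have g: "g \<in> f (Suc j)" unfolding g_def using h[of j] ring_ideal.subspace_diff[OF ideal] by blast
  have g': "g \<notin> f j"
  proof
    assume "g \<in> f j"
    then have "g + single c q * h i \<in> f j"
      using hi' ring_ideal.subspace_add[OF ideal] by blast
    then show False using h[of j] by (simp add: g_def)
  qed
  then have "g \<noteq> 0" using ideal ring_ideal.subspace_0 by blast
  then obtain b where b: "leading_exponent g b" using leading_exponent_exists by blast
  have nz: "lookup (h i) (a i) \<noteq> 0"
    using lead[of i] by (simp add: leading_exponent_def in_keys_iff)
  have "lookup g (a j) = 0"
    using nz lookup_single_mult_shift[of c q "h i" "a i"] by (simp add: g_def lookup_minus ij(2) add.commute q_def)
  then have baj: "b \<noteq> a j" using b by (auto simp: leading_exponent_def in_keys_iff)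
  have "b \<in> keys (h j) \<or> b \<in> keys (single c q * h i)"
    using b unfolding leading_exponent_def g_def by (auto simp: in_keys_iff lookup_minus)
  then have "(b, a j) \<in> monomial_less"
  proof
    assume "b \<in> keys (h j)"
    then show ?thesis using lead[of j] baj by (auto simp: leading_exponent_def)
  next
    assume "b \<in> keys (single c q * h i)"
    then obtain d where d: "b = c + d" "d \<in> keys (h i)"
      using keys_mult[of "single c q" "h i"] by (auto split: if_splits)
    then have "d \<noteq> a i" using baj ij(2) by (auto simp: add.commute)
    then have "(d, a i) \<in> monomial_less" using d(2) lead[of i] by (auto simp: leading_exponent_def)
    then show ?thesis using add_monomial_less[of d "a i" c] by (simp add: d(1) ij(2) add.commute)
  qed
  then show False using min[of g j b] g g' b by blast
qed

theorem maximal_ideal_in_family: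
  fixes F :: "('n::finite, 'k::field) mpolynomial set set"
  assumes "\<And>L. L \<in> F \<Longrightarrow> is_ideal L" "L0 \<in> F"
  shows "\<exists>M\<in>F. L0 \<subseteq> M \<and> (\<forall>L\<in>F. M \<subseteq> L \<longrightarrow> L = M)"
proof (rule ccontr)
  assume neg: "\<not> ?thesis"
  have step: "\<exists>M. (M \<in> F \<and> L0 \<subseteq> M) \<and> L \<subset> M" if "L \<in> F \<and> L0 \<subseteq> L" for L
  proof -
    have "\<exists>M\<in>F. L \<subseteq> M \<and> M \<noteq> L" using neg that by meson
    then obtain M where "M \<in> F" "L \<subseteq> M" "M \<noteq> L" by auto
    then show ?thesis using that by (intro exI[of _ M]) auto
  qed
  obtain f where f: "\<And>k. f k \<in> F \<and> L0 \<subseteq> f k" "\<And>k. f k \<subset> f (Suc k)"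
    using dependent_nat_choice[of "\<lambda>_ L. L \<in> F \<and> L0 \<subseteq> L" "\<lambda>_ L M. L \<subset> M"] step assms(2)
    by (metis order_refl)
  show False using no_strictly_increasing_ideals[of f] assms(1) f by simp
qed

section \<open>Prime avoidance for zero divisors\<close>

lemma prime_ideal_contains_factor:
  assumes P: "is_prime_ideal (P :: 'a::comm_ring_1 set)" and "finite I"
    and Q: "\<And>i. i \<in> I \<Longrightarrow> is_ideal (Q i)" and sub: "(\<Inter>i\<in>I. Q i) \<subseteq> P"
  shows "\<exists>i\<in>I. Q i \<subseteq> P"
proof (rule ccontr)
  assume "\<not> ?thesis"
  then have "\<forall>i\<in>I. \<exists>p. p \<in> Q i \<and> p \<notin> P" by blast
  then obtain p where p: "\<And>i. i \<in> I \<Longrightarrow> p i \<in> Q i \<and> p i \<notin> P" by metis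
  have "1 \<notin> P"
    using P unfolding is_prime_ideal_def
    by (metis UNIV_eq_I ideal_mult_left mult.right_neutral)
  have "prod p J \<notin> P" if "J \<subseteq> I" for J
    using finite_subset[OF that \<open>finite I\<close>] that
  proof (induction rule: finite_induct)
    case empty
    then show ?case using \<open>1 \<notin> P\<close> by simp
  next
    case (insert x F)
    then show ?case using P p[of x] unfolding is_prime_ideal_def by auto
  qed
  moreover have "prod p I \<in> Q i" if "i \<in> I" for i
    using ideal_mult_right[OF Q[OF that], of "p i" "prod p (I - {i})"] p[OF that] that \<open>finite I\<close>
    by (simp add: prod.remove)
  ultimately show False using sub by blast
qed

lemma annihilator_is_ideal:
  assumes "is_ideal (L :: 'a::comm_ring_1 set)"
  shows "is_ideal {f. f * g \<in> L}"
  unfolding ring_ideal.subspace_def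
proof (intro conjI ballI allI)
  show "0 \<in> {f. f * g \<in> L}" using ring_ideal.subspace_0[OF assms] by simp
next
  fix a b assume "a \<in> {f. f * g \<in> L}" "b \<in> {f. f * g \<in> L}"
  then show "a + b \<in> {f. f * g \<in> L}" using ring_ideal.subspace_add[OF assms] by (simp add: distrib_right)
next
  fix c a assume "a \<in> {f. f * g \<in> L}"
  then have "c * (a * g) \<in> L" using ideal_mult_left[OF assms, of "a * g" c] by simp
  then show "c * a \<in> {f. f * g \<in> L}" by (simp add: mult.assoc)
qed

text \<open>The maximal members of the family of all annihilators of nonzero elements of \<open>R/L\<close> are prime, and
  their union is the set of all zero divisors on \<open>R/L\<close>. There are only finitely many of them: for
  distinct ones \<open>P k = ann (g k)\<close>, the ideals generated by \<open>L\<close> and \<open>g 0, \<dots>, g (k - 1)\<close> would increase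
  strictly, because \<open>g k\<close> in such an ideal forces \<open>P k\<close> to contain the intersection of the earlier
  \<open>P i\<close>, hence one of them. The hypothesis on \<open>M\<close> says that no annihilator contains \<open>M\<close>, and prime
  avoidance is easy here since the finitely many primes are pairwise incomparable: a sum of elements
  \<open>f P\<close> that avoid \<open>P\<close> and lie in \<open>M\<close> and in all other primes avoids every prime.\<close>

lemma nonzerodivisor_exists:
  fixes L M :: "('n::finite, 'k::field) mpolynomial set"
  assumes L: "is_ideal L" and M: "is_ideal M"
    and sat: "\<And>g. (\<forall>f\<in>M. f * g \<in> L) \<Longrightarrow> g \<in> L"
  shows "\<exists>f\<in>M. \<forall>g. f * g \<in> L \<longrightarrow> g \<in> L"
proof -
  define ann where "ann = (\<lambda>g. {f. f * g \<in> L})"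
  define A where "A = ann ` (- L)"
  define Mx where "Mx = {P \<in> A. \<forall>Q\<in>A. P \<subseteq> Q \<longrightarrow> Q = P}"
  have ann_ideal: "is_ideal (ann g)" for g
    unfolding ann_def by (rule annihilator_is_ideal[OF L])
  have above: "\<exists>P\<in>Mx. ann g \<subseteq> P" if "g \<notin> L" for g
  proof -
    have "ann g \<in> A" using that unfolding A_def by blast
    moreover have "is_ideal P" if "P \<in> A" for P using that ann_ideal unfolding A_def by auto
    ultimately obtain P where "P \<in> A" "ann g \<subseteq> P" "\<forall>Q\<in>A. P \<subseteq> Q \<longrightarrow> Q = P"
      using maximal_ideal_in_family[of A "ann g"] by auto
    then show ?thesis unfolding Mx_def by auto
  qed
  have prime: "is_prime_ideal P" if "P \<in> Mx" for P
  proof -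
    obtain g where g: "g \<notin> L" "P = ann g" using \<open>P \<in> Mx\<close> unfolding Mx_def A_def by blast
    have "1 \<notin> P" using g by (simp add: ann_def)
    moreover have "a \<in> P" if ab: "a * b \<in> P" and b: "b \<notin> P" for a b
    proof -
      have bg: "b * g \<notin> L" using b g by (simp add: ann_def)
      have "P \<subseteq> ann (b * g)"
        using ideal_mult_left[OF L, of _ b] g(2) by (auto simp: ann_def mult.left_commute[of _ b g])
      moreover have "ann (b * g) \<in> A" using bg unfolding A_def by blast
      ultimately have "ann (b * g) = P" using \<open>P \<in> Mx\<close> unfolding Mx_def by blast
      moreover have "a \<in> ann (b * g)" using ab g(2) by (simp add: ann_def ac_simps)
      ultimately show ?thesis by simp
    qed
    ultimately show ?thesis unfolding is_prime_ideal_def using ann_ideal[of g] g(2) by blast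
  qed
  have prime_ideal: "is_ideal P" if "P \<in> Mx" for P
    using prime[OF that] by (simp add: is_prime_ideal_def)
  have incomparable: "P = Q" if "P \<in> Mx" "Q \<in> Mx" "P \<subseteq> Q" for P Q
    using that unfolding Mx_def by blast
  have "finite Mx"
  proof (rule ccontr)
    assume "infinite Mx"
    then obtain P :: "nat \<Rightarrow> _" where P: "inj P" "range P \<subseteq> Mx"
      using infinite_countable_subset by blast
    then have "\<forall>k. \<exists>g. g \<notin> L \<and> P k = ann g" unfolding Mx_def A_def by blast
    from choice[OF this] obtain g where g: "\<And>k. g k \<notin> L" "\<And>k. P k = ann (g k)" by auto
    define F where "F = (\<lambda>k. ideal_span (L \<union> g ` {..<k}))"
    have "F k \<subset> F (Suc k)" for k
    proof
      show "F k \<subseteq> F (Suc k)" unfolding F_def by (rule ring_ideal.span_mono) auto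
      have mem: "g k \<in> F (Suc k)" unfolding F_def by (rule ring_ideal.span_base) auto
      have "g k \<notin> F k"
      proof
        assume gk: "g k \<in> F k"
        have "(\<Inter>i\<in>{..<k}. P i) \<subseteq> P k"
        proof
          fix c assume c: "c \<in> (\<Inter>i\<in>{..<k}. P i)"
          have id: "is_ideal {h. h * c \<in> L}" by (rule annihilator_is_ideal[OF L])
          have "L \<union> g ` {..<k} \<subseteq> {h. h * c \<in> L}"
            using c ideal_mult_right[OF L] by (auto simp: g(2) ann_def mult.commute)
          then have "F k \<subseteq> {h. h * c \<in> L}" unfolding F_def by (rule ring_ideal.span_minimal[OF _ id])
          then show "c \<in> P k" using gk by (auto simp: g(2) ann_def mult.commute)
        qed
        moreover have "is_prime_ideal (P k)" using prime P(2) by blast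
        ultimately have "\<exists>i\<in>{..<k}. P i \<subseteq> P k"
          using ann_ideal g(2) by (intro prime_ideal_contains_factor) auto
        then obtain i where "i < k" "P i \<subseteq> P k" by blast
        then have "P i = P k" using incomparable P(2) by blast
        then show False using P(1) \<open>i < k\<close> by (simp add: inj_eq)
      qed
      then show "F k \<noteq> F (Suc k)" using mem by blast
    qed
    then show False using no_strictly_increasing_ideals[of F] unfolding F_def by auto
  qed
  have "\<forall>P\<in>Mx. \<exists>f. f \<in> M \<and> f \<notin> P \<and> (\<forall>Q\<in>Mx - {P}. f \<in> Q)"
  proof
    fix P assume P: "P \<in> Mx"
    obtain g where g: "g \<notin> L" "P = ann g" using P unfolding Mx_def A_def by blast
    have "\<not> M \<subseteq> P" using sat[of g] g by (auto simp: ann_def)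
    then obtain a where a: "a \<in> M" "a \<notin> P" by blast
    have "\<not> (\<Inter>Q\<in>Mx - {P}. Q) \<subseteq> P"
    proof
      assume "(\<Inter>Q\<in>Mx - {P}. Q) \<subseteq> P"
      then obtain Q where "Q \<in> Mx - {P}" "Q \<subseteq> P"
        using prime_ideal_contains_factor[of P "Mx - {P}" "\<lambda>Q. Q"] prime[OF P] \<open>finite Mx\<close> prime_ideal
        by auto
      then show False using incomparable P by blast
    qed
    then obtain b where b: "b \<notin> P" "\<And>Q. Q \<in> Mx - {P} \<Longrightarrow> b \<in> Q" by blast
    have "a * b \<in> M" using a(1) by (rule ideal_mult_right[OF M])
    moreover have "a * b \<notin> P" using a b prime[OF P] unfolding is_prime_ideal_def by blast
    moreover have "a * b \<in> Q" if "Q \<in> Mx - {P}" for Q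
      using b(2)[OF that] that by (auto intro: ideal_mult_left[OF prime_ideal])
    ultimately show "\<exists>f. f \<in> M \<and> f \<notin> P \<and> (\<forall>Q\<in>Mx - {P}. f \<in> Q)" by blast
  qed
  from bchoice[OF this] obtain f
    where f: "\<And>P. P \<in> Mx \<Longrightarrow> f P \<in> M \<and> f P \<notin> P \<and> (\<forall>Q\<in>Mx - {P}. f P \<in> Q)" by auto
  define F where "F = sum f Mx"
  have "F \<in> M" unfolding F_def using f by (intro ring_ideal.subspace_sum[OF M]) blast
  moreover have "F \<notin> P" if P: "P \<in> Mx" for P
  proof
    assume "F \<in> P"
    note id = prime_ideal[OF P]
    have "sum f (Mx - {P}) \<in> P"
    proof (rule ring_ideal.subspace_sum[OF id])
      fix Q assume "Q \<in> Mx - {P}"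
      then show "f Q \<in> P" using f[of Q] P by auto
    qed
    then have "F - sum f (Mx - {P}) \<in> P" using \<open>F \<in> P\<close> ring_ideal.subspace_diff[OF id] by blast
    then show False using f[OF P] P \<open>finite Mx\<close> by (simp add: F_def sum.remove)
  qed
  then have "g \<in> L" if "F * g \<in> L" for g
    using above[of g] that unfolding ann_def by blast
  ultimately show ?thesis by blast
qed

section \<open>Koszul homology\<close>

text \<open>An arbitrary numbering of the variables, which fixes the signs in the Koszul complex.\<close>

definition vertex_index :: "'n::finite \<Rightarrow> nat" where
  "vertex_index = (SOME f. inj f)"

lemma inj_vertex_index: "inj (vertex_index :: 'n::finite \<Rightarrow> nat)"
  unfolding vertex_index_def
  using finite_imp_inj_to_nat_seg[OF finite_class.finite_UNIV] by (metis someI_ex)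

definition koszul_sign :: "'n::finite \<Rightarrow> 'n set \<Rightarrow> 'a::comm_ring_1" where
  "koszul_sign j S = (- 1) ^ card {l \<in> S. vertex_index l < vertex_index j}"

lemma koszul_sign_cases:
  fixes j :: "'n::finite"
  shows "koszul_sign j S = (1 :: 'a::comm_ring_1) \<or> koszul_sign j S = (- 1 :: 'a)"
  unfolding koszul_sign_def minus_one_power_iff by simp

lemma koszul_sign_square [simp]:
  fixes j :: "'n::finite"
  shows "koszul_sign j S * koszul_sign j S = (1 :: 'a::comm_ring_1)"
  using koszul_sign_cases[of j S, where 'a = 'a] by auto

lemma koszul_sign_square_left [simp]:
  "koszul_sign j S * (koszul_sign j S * p) = (p :: 'a::comm_ring_1)"
  by (simp add: mult.assoc[symmetric])

lemma koszul_sign_swap: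
  fixes j k :: "'n::finite"
  assumes "j \<noteq> k" "j \<notin> S" "k \<notin> S"
  shows "koszul_sign j S * koszul_sign k (insert j S)
       = - (koszul_sign k S * koszul_sign j (insert k S) :: 'a::comm_ring_1)"
proof -
  have less: "koszul_sign j S * koszul_sign k (insert j S)
       = - (koszul_sign k S * koszul_sign j (insert k S) :: 'a)"
    if "vertex_index j < vertex_index k" "j \<notin> S" for j k :: 'n
  proof -
    have "{l \<in> insert j S. vertex_index l < vertex_index k}
        = insert j {l \<in> S. vertex_index l < vertex_index k}"
      "{l \<in> insert k S. vertex_index l < vertex_index j} = {l \<in> S. vertex_index l < vertex_index j}"
      using that by auto
    then show ?thesis using that by (simp add: koszul_sign_def)
  qed
  have "vertex_index j \<noteq> vertex_index k" using assms(1) by (simp add: inj_eq[OF inj_vertex_index])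
  then consider "vertex_index j < vertex_index k" | "vertex_index k < vertex_index j" by linarith
  then show ?thesis
  proof cases
    case 1
    then show ?thesis using less assms by blast
  next
    case 2
    then show ?thesis using less[of k j] assms by (simp add: minus_equation_iff)
  qed
qed

text \<open>The differential of the Koszul complex of the variables over \<open>R\<close>. A chain is a function on all
  sets of variables, with the coefficient of the exterior product over \<open>S\<close> as its value at \<open>S\<close>; the
  degree of \<open>S\<close> is its cardinality, and chains of different degrees are kept in one function.\<close>

definition koszul :: "('n::finite set \<Rightarrow> ('n, 'k::field) mpolynomial) \<Rightarrow> 'n set \<Rightarrow> ('n, 'k) mpolynomial" where
  "koszul w S = (\<Sum>j\<in>- S. koszul_sign j S * variable j * w (insert j S))"

lemma koszul_add: "koszul (\<lambda>S. v S + w S) S = koszul v S + koszul w S"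
  by (simp add: koszul_def algebra_simps sum.distrib)

lemma koszul_diff: "koszul (\<lambda>S. v S - w S) S = koszul v S - koszul w S"
  by (simp add: koszul_def algebra_simps sum_subtractf)

lemma koszul_scale: "koszul (\<lambda>S. f * w S) S = f * koszul w S"
  by (simp add: koszul_def sum_distrib_left mult_ac)

lemma koszul_in_ideal:
  assumes "is_ideal L" "\<And>j. j \<notin> S \<Longrightarrow> w (insert j S) \<in> L"
  shows "koszul w S \<in> L"
  unfolding koszul_def
  by (rule ring_ideal.subspace_sum[OF assms(1)]) (use assms in \<open>auto intro: ideal_mult_left\<close>)

lemma koszul_koszul:
  fixes w :: "'n::finite set \<Rightarrow> ('n, 'k::field) mpolynomial"
  shows "koszul (koszul w) S = 0"
proof -
  define F :: "'n \<Rightarrow> 'n \<Rightarrow> ('n, 'k) mpolynomial" where "F = (\<lambda>j k. koszul_sign j S * koszul_sign k (insert j S) * (variable j * variable k * w (insert k (insert j S))))"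
  have F: "F j k + F k j = 0" if "j \<notin> S" "k \<notin> S" "j \<noteq> k" for j k
  proof -
    have "F j k + F k j = (koszul_sign j S * koszul_sign k (insert j S)
        + koszul_sign k S * koszul_sign j (insert k S)) * (variable j * variable k * w (insert k (insert j S)))"
      by (simp add: F_def insert_commute[of j k] mult.commute[of "variable k"] distrib_right)
    then show ?thesis using koszul_sign_swap[of j k S, where 'a = "('n, 'k) mpolynomial"] that by simp
  qed
  define D where "D = {(j, k). j \<notin> S \<and> k \<notin> S \<and> vertex_index j < vertex_index k}"
  define D' where "D' = {(j, k). j \<notin> S \<and> k \<notin> S \<and> vertex_index k < vertex_index j}"
  have un: "Sigma (- S) (\<lambda>j. - insert j S) = D \<union> D'"
    unfolding D_def D'_def by (auto simp: not_less_iff_gr_or_eq inj_eq[OF inj_vertex_index])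
  have "koszul (koszul w) S = (\<Sum>j\<in>- S. \<Sum>k\<in>- insert j S. F j k)"
    unfolding koszul_def F_def by (simp add: sum_distrib_left mult_ac)
  also have "\<dots> = (\<Sum>(j, k)\<in>D \<union> D'. F j k)"
    by (simp add: sum.Sigma flip: un)
  also have "\<dots> = (\<Sum>(j, k)\<in>D. F j k) + (\<Sum>(j, k)\<in>D'. F j k)"
    by (rule sum.union_disjoint) (auto simp: D_def D'_def)
  also have "(\<Sum>(j, k)\<in>D'. F j k) = (\<Sum>(j, k)\<in>D. F k j)"
    by (rule sum.reindex_bij_witness[of _ prod.swap prod.swap]) (auto simp: D_def D'_def)
  also have "(\<Sum>(j, k)\<in>D. F j k) + (\<Sum>(j, k)\<in>D. F k j) = (\<Sum>(j, k)\<in>D. F j k + F k j)"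
    by (simp add: sum.distrib split_def)
  also have "\<dots> = 0"
    by (rule sum.neutral) (use F in \<open>auto simp: D_def\<close>)
  finally show ?thesis .
qed

text \<open>Vanishing of the \<open>i\<close>-th Koszul homology of \<open>R/L\<close>: a chain over \<open>R\<close> whose boundary vanishes modulo
  \<open>L\<close> in degree \<open>i - 1\<close> is a boundary modulo \<open>L\<close> in degree \<open>i\<close>. Only the values of \<open>w\<close> in degree \<open>i\<close> and
  of \<open>v\<close> in degree \<open>i + 1\<close> enter.\<close>

definition koszul_exact :: "('n::finite, 'k::field) mpolynomial set \<Rightarrow> nat \<Rightarrow> bool" where
  "koszul_exact L i \<longleftrightarrow> (\<forall>w. (\<forall>S. Suc (card S) = i \<longrightarrow> koszul w S \<in> L) \<longrightarrow>
     (\<exists>v. \<forall>S. card S = i \<longrightarrow> w S - koszul v S \<in> L))"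

text \<open>Exterior multiplication by the basis vector of \<open>k\<close> is a homotopy between multiplication by the
  \<open>k\<close>-th variable and zero. So the variables, and with them the graded maximal ideal, annihilate Koszul
  homology.\<close>

lemma koszul_homotopy:
  fixes w :: "'n::finite set \<Rightarrow> ('n, 'k::field) mpolynomial" and k :: 'n
  defines "h \<equiv> \<lambda>w S. if k \<in> S then koszul_sign k (S - {k}) * w (S - {k}) else 0"
  shows "koszul (h w) S + h (koszul w) S = variable k * w S"
proof (cases "k \<in> S")
  case False
  have "koszul (h w) S = (\<Sum>j\<in>{k}. koszul_sign j S * variable j * h w (insert j S))"
    unfolding koszul_def by (rule sum.mono_neutral_right) (use False in \<open>auto simp: h_def\<close>)
  then show ?thesis using False by (simp add: h_def mult_ac)
next
  case True
  define T where "T = S - {k}"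
  have S: "S = insert k T" "k \<notin> T" using True by (auto simp: T_def)
  have "- T = insert k (- S)" using S by auto
  then have "koszul w T = koszul_sign k T * variable k * w S
     + (\<Sum>j\<in>- S. koszul_sign j T * variable j * w (insert j T))"
    unfolding koszul_def using True by (simp add: S(1))
  then have 1: "h (koszul w) S = variable k * w S
     + (\<Sum>j\<in>- S. koszul_sign k T * koszul_sign j T * (variable j * w (insert j T)))"
    using True by (simp add: h_def flip: T_def) (simp add: algebra_simps sum_distrib_left)
  have 2: "koszul_sign j S * variable j * h w (insert j S)
     = - (koszul_sign k T * koszul_sign j T * (variable j * w (insert j T)))" if "j \<in> - S" for j
  proof -
    have j: "j \<noteq> k" "j \<notin> T" using that S by auto
    have del: "insert j S - {k} = insert j T" using j S by auto
    have "koszul_sign j S * koszul_sign k (insert j T)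
      = koszul_sign k T * (koszul_sign k T * koszul_sign j (insert k T)) * koszul_sign k (insert j T)"
      by (simp add: S(1))
    also have "\<dots> = - (koszul_sign k T * koszul_sign j T :: ('n, 'k) mpolynomial)"
      using koszul_sign_swap[of k j T, where 'a = "('n, 'k) mpolynomial"] j S(2)
      by (simp add: mult.assoc)
    finally have "koszul_sign j S * koszul_sign k (insert j T) = - (koszul_sign k T * koszul_sign j T :: ('n, 'k) mpolynomial)" .
    then have "koszul_sign j S * koszul_sign k (insert j T) * (variable j * w (insert j T))
       = - (koszul_sign k T * koszul_sign j T) * (variable j * w (insert j T))" by simp
    then show ?thesis using True by (simp add: h_def del mult_ac)
  qed
  have "koszul (h w) S = - (\<Sum>j\<in>- S. koszul_sign k T * koszul_sign j T * (variable j * w (insert j T)))"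
    unfolding koszul_def by (subst sum.cong[OF refl 2]) (simp_all add: sum_negf)
  then show ?thesis using 1 by simp
qed

lemma maximal_ideal_annihilates_koszul_homology:
  fixes L :: "('n::finite, 'k::field) mpolynomial set"
  assumes L: "is_ideal L" and f: "f \<in> graded_maximal_ideal"
    and w: "\<And>S. Suc (card S) = i \<Longrightarrow> koszul w S \<in> L"
  shows "\<exists>v. \<forall>S. card S = i \<longrightarrow> f * w S - koszul v S \<in> L"
proof -
  define A where "A = {f. \<exists>v. \<forall>S. card S = i \<longrightarrow> f * w S - koszul v S \<in> L}"
  have "is_ideal A"
    unfolding ring_ideal.subspace_def
  proof (intro conjI ballI allI)
    show "0 \<in> A" unfolding A_def
      using ring_ideal.subspace_0[OF L] by (auto intro!: exI[of _ "\<lambda>_. 0"] simp: koszul_def)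
  next
    fix f g assume "f \<in> A" "g \<in> A"
    then obtain u v where "\<forall>S. card S = i \<longrightarrow> f * w S - koszul u S \<in> L"
      "\<forall>S. card S = i \<longrightarrow> g * w S - koszul v S \<in> L" unfolding A_def by blast
    then have "\<forall>S. card S = i \<longrightarrow> (f * w S - koszul u S) + (g * w S - koszul v S) \<in> L"
      using ring_ideal.subspace_add[OF L] by blast
    then show "f + g \<in> A" unfolding A_def
      by (intro CollectI exI[of _ "\<lambda>S. u S + v S"]) (simp add: koszul_add algebra_simps)
  next
    fix c f assume "f \<in> A"
    then obtain u where "\<forall>S. card S = i \<longrightarrow> f * w S - koszul u S \<in> L" unfolding A_def by blast
    then have "\<forall>S. card S = i \<longrightarrow> c * (f * w S - koszul u S) \<in> L"
      using ideal_mult_left[OF L] by blast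
    then show "c * f \<in> A" unfolding A_def
      by (intro CollectI exI[of _ "\<lambda>S. c * u S"]) (simp add: koszul_scale algebra_simps)
  qed
  moreover have "range variable \<subseteq> A"
  proof (clarify)
    fix k :: 'n
    define h where "h = (\<lambda>w S. if k \<in> S then koszul_sign k (S - {k}) * w (S - {k}) else (0 :: ('n, 'k) mpolynomial))"
    have "variable k * w S - koszul (h w) S \<in> L" if "card S = i" for S
    proof -
      have "variable k * w S - koszul (h w) S = h (koszul w) S"
        using koszul_homotopy[of k w S] unfolding h_def by (simp add: algebra_simps)
      moreover have "h (koszul w) S \<in> L"
      proof (cases "k \<in> S")
        case True
        then have "Suc (card (S - {k})) = i" using that by (metis card_Suc_Diff1 finite)
        then show ?thesis using w True ideal_mult_left[OF L] by (simp add: h_def)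
      next
        case False
        then show ?thesis using ring_ideal.subspace_0[OF L] by (simp add: h_def)
      qed
      ultimately show ?thesis by simp
    qed
    then show "variable k \<in> A" unfolding A_def by blast
  qed
  ultimately have "graded_maximal_ideal \<subseteq> A"
    unfolding graded_maximal_ideal_def by (intro ring_ideal.span_minimal)
  then show ?thesis using f unfolding A_def by blast
qed

lemma ideal_span_insert_iff:
  assumes "is_ideal (L :: 'a::comm_ring_1 set)"
  shows "g \<in> ideal_span (L \<union> {f}) \<longleftrightarrow> (\<exists>c. g - c * f \<in> L)"
proof -
  have sp: "ideal_span L = L" using assms ring_ideal.span_eq_iff by blast
  show ?thesis by (simp add: ring_ideal.span_insert sp)
qed

text \<open>For a nonzerodivisor \<open>f\<close> in the graded maximal ideal the long exact homology sequence of
  multiplication by \<open>f\<close> splits into short ones, so that the \<open>i\<close>-th homology of \<open>R/L\<close> is a quotient of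
  the \<open>(i + 1)\<close>-st of \<open>R/(L + f)\<close>. A cycle \<open>w\<close> modulo \<open>L\<close> is lifted along this connecting map to a
  chain \<open>v\<close> whose boundary is \<open>f * w\<close> modulo \<open>L\<close>.\<close>

lemma koszul_exact_of_quotient:
  fixes L :: "('n::finite, 'k::field) mpolynomial set"
  assumes L: "is_ideal L" and f: "f \<in> graded_maximal_ideal" and nzd: "\<And>g. f * g \<in> L \<Longrightarrow> g \<in> L"
    and ex: "koszul_exact (ideal_span (L \<union> {f})) (Suc i)"
  shows "koszul_exact L i"
  unfolding koszul_exact_def
proof (intro allI impI)
  fix w :: "'n set \<Rightarrow> ('n, 'k) mpolynomial"
  assume "\<forall>S. Suc (card S) = i \<longrightarrow> koszul w S \<in> L"
  then obtain v where v: "\<And>S. card S = i \<Longrightarrow> f * w S - koszul v S \<in> L"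
    using maximal_ideal_annihilates_koszul_homology[OF L f] by blast
  have "koszul v S \<in> ideal_span (L \<union> {f})" if "card S = i" for S
    unfolding ideal_span_insert_iff[OF L]
    using ring_ideal.subspace_neg[OF L v[OF that]] by (auto intro!: exI[of _ "w S"] simp: algebra_simps)
  then have "\<forall>S. Suc (card S) = Suc i \<longrightarrow> koszul v S \<in> ideal_span (L \<union> {f})" by blast
  from ex[unfolded koszul_exact_def, THEN spec, THEN mp, OF this]
  obtain u where "\<And>S. card S = Suc i \<Longrightarrow> v S - koszul u S \<in> ideal_span (L \<union> {f})" by auto
  then have "\<forall>S. \<exists>c. card S = Suc i \<longrightarrow> v S - koszul u S - c * f \<in> L"
    unfolding ideal_span_insert_iff[OF L] by blast
  then obtain c where c: "\<And>S. card S = Suc i \<Longrightarrow> v S - koszul u S - c S * f \<in> L" by metis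
  have "w S - koszul c S \<in> L" if S: "card S = i" for S
  proof -
    have "koszul (\<lambda>S. v S - koszul u S - c S * f) S \<in> L"
      using c S by (intro koszul_in_ideal[OF L]) simp
    also have "koszul (\<lambda>S. v S - koszul u S - c S * f) S = koszul v S - f * koszul c S"
      using koszul_diff[of "\<lambda>S. v S - koszul u S" "\<lambda>S. f * c S"] koszul_diff[of v "koszul u"]
      by (simp add: koszul_koszul koszul_scale mult.commute)
    finally have "(koszul v S - f * koszul c S) + (f * w S - koszul v S) \<in> L"
      using v[OF S] by (rule ring_ideal.subspace_add[OF L])
    then have "f * (w S - koszul c S) \<in> L" by (simp add: algebra_simps)
    then show ?thesis by (rule nzd)
  qed
  then show "\<exists>v. \<forall>S. card S = i \<longrightarrow> w S - koszul v S \<in> L" by blast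
qed

text \<open>The other part of the same long exact sequence: the \<open>i\<close>-th homology of \<open>R/(L + f)\<close> lies between
  the \<open>i\<close>-th and the \<open>(i - 1)\<close>-st homology of \<open>R/L\<close>.\<close>

lemma koszul_exact_quotient:
  fixes L :: "('n::finite, 'k::field) mpolynomial set"
  assumes L: "is_ideal L" and nzd: "\<And>g. f * g \<in> L \<Longrightarrow> g \<in> L"
    and ex: "koszul_exact L i" and ex': "\<And>j. i = Suc j \<Longrightarrow> koszul_exact L j"
  shows "koszul_exact (ideal_span (L \<union> {f})) i"
  unfolding koszul_exact_def
proof (intro allI impI)
  fix v :: "'n set \<Rightarrow> ('n, 'k) mpolynomial"
  assume v: "\<forall>S. Suc (card S) = i \<longrightarrow> koszul v S \<in> ideal_span (L \<union> {f})"
  show "\<exists>y. \<forall>S. card S = i \<longrightarrow> v S - koszul y S \<in> ideal_span (L \<union> {f})"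
  proof (cases i)
    case 0
    then obtain y where "\<forall>S. card S = i \<longrightarrow> v S - koszul y S \<in> L"
      using ex unfolding koszul_exact_def by blast
    then show ?thesis by (meson UnI1 ring_ideal.span_base)
  next
    case (Suc j)
    then have "\<forall>S. \<exists>c. card S = j \<longrightarrow> koszul v S - c * f \<in> L"
      using v unfolding ideal_span_insert_iff[OF L] by blast
    then obtain w where w: "\<And>S. card S = j \<Longrightarrow> koszul v S - w S * f \<in> L" by metis
    have "koszul w S \<in> L" if "Suc (card S) = j" for S
    proof -
      have "koszul (\<lambda>S. koszul v S - f * w S) S \<in> L"
        using w that by (intro koszul_in_ideal[OF L]) (simp add: mult.commute)
      then have "- (f * koszul w S) \<in> L"
        by (simp add: koszul_diff koszul_koszul koszul_scale)
      then have "f * koszul w S \<in> L" using ring_ideal.subspace_neg[OF L] by fastforce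
      then show ?thesis by (rule nzd)
    qed
    then obtain u where u: "\<And>S. card S = j \<Longrightarrow> w S - koszul u S \<in> L"
      using ex'[OF Suc] unfolding koszul_exact_def by blast
    have "koszul (\<lambda>S. v S - f * u S) S \<in> L" if S: "card S = j" for S
    proof -
      have "(koszul v S - w S * f) + f * (w S - koszul u S) \<in> L"
        using w[OF S] ideal_mult_left[OF L u[OF S]] by (rule ring_ideal.subspace_add[OF L])
      then show ?thesis by (simp add: koszul_diff koszul_scale algebra_simps)
    qed
    then have "\<forall>S. Suc (card S) = i \<longrightarrow> koszul (\<lambda>S. v S - f * u S) S \<in> L"
      using Suc by simp
    from ex[unfolded koszul_exact_def, THEN spec, THEN mp, OF this]
    obtain y where y: "\<And>S. card S = i \<Longrightarrow> v S - f * u S - koszul y S \<in> L" by auto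
    have "v S - koszul y S \<in> ideal_span (L \<union> {f})" if "card S = i" for S
      unfolding ideal_span_insert_iff[OF L]
      using y[OF that] by (auto intro!: exI[of _ "u S"] simp: algebra_simps)
    then show ?thesis by blast
  qed
qed

section \<open>Depth\<close>

lemma regular_sequence_Cons:
  assumes L: "is_ideal (L :: 'a::comm_ring_1 set)"
  shows "regular_sequence_on_quotient L (f # fs) \<longleftrightarrow>
    (\<forall>g. f * g \<in> L \<longrightarrow> g \<in> L) \<and> regular_sequence_on_quotient (ideal_span (L \<union> {f})) fs"
proof -
  have sp: "ideal_span L = L" using L by (simp add: ring_ideal.span_eq_iff)
  have absorb: "ideal_span (ideal_span (insert f L) \<union> B) = ideal_span (insert f (L \<union> B))" for B
  proof
    show "ideal_span (ideal_span (insert f L) \<union> B) \<subseteq> ideal_span (insert f (L \<union> B))"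
      by (intro ring_ideal.span_minimal Un_least ring_ideal.subspace_span)
        (auto intro: ring_ideal.span_base ring_ideal.span_mono[THEN subsetD, rotated])
    have "insert f L \<subseteq> ideal_span (insert f L)" by (rule ring_ideal.span_superset)
    then show "ideal_span (insert f (L \<union> B)) \<subseteq> ideal_span (ideal_span (insert f L) \<union> B)"
      by (intro ring_ideal.span_mono) auto
  qed
  show ?thesis
    unfolding regular_sequence_on_quotient_def
    by (simp add: All_less_Suc2 absorb sp conj_assoc)
qed

lemma graded_maximal_ideal_is_ideal: "is_ideal graded_maximal_ideal"
  unfolding graded_maximal_ideal_def by (rule ring_ideal.subspace_span)

lemma exponent_eq_0_iff: "a = 0 \<longleftrightarrow> (\<forall>i. lookup a i = 0)"
  by (simp add: poly_mapping_eq_iff fun_eq_iff)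

lemma graded_maximal_ideal_eq:
  "(graded_maximal_ideal :: ('n::finite, 'k::field) mpolynomial set) = monomial_ideal {a. a \<noteq> 0}"
proof
  have up: "upward_closed {a :: 'n \<Rightarrow>\<^sub>0 nat. a \<noteq> 0}"
    by (auto simp: upward_closed_def exponent_eq_0_iff lookup_add)
  show "(graded_maximal_ideal :: ('n, 'k) mpolynomial set) \<subseteq> monomial_ideal {a. a \<noteq> 0}"
    unfolding graded_maximal_ideal_def
    by (rule ring_ideal.span_minimal[OF _ monomial_ideal_is_ideal[OF up]])
      (auto simp: monomial_ideal_def variable_def exponent_eq_0_iff lookup_single when_def)
  show "monomial_ideal {a. a \<noteq> 0} \<subseteq> (graded_maximal_ideal :: ('n, 'k) mpolynomial set)"
  proof (rule monomial_ideal_subset_ideal[OF graded_maximal_ideal_is_ideal])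
    fix a :: "'n \<Rightarrow>\<^sub>0 nat" assume "a \<in> {a. a \<noteq> 0}"
    then obtain i where i: "lookup a i \<noteq> 0" by (auto simp: exponent_eq_0_iff)
    have "a = (a - single i 1) + single i 1"
      by (rule poly_mapping_eqI) (use i in \<open>auto simp: lookup_add lookup_minus lookup_single when_def\<close>)
    then have "single a 1 = single (a - single i 1) 1 * (variable i :: ('n, 'k) mpolynomial)"
      by (simp add: variable_def mult_single)
    moreover have "(variable i :: ('n, 'k) mpolynomial) \<in> graded_maximal_ideal"
      unfolding graded_maximal_ideal_def by (rule ring_ideal.span_base) simp
    ultimately show "single a 1 \<in> (graded_maximal_ideal :: ('n, 'k) mpolynomial set)"
      using ideal_mult_left[OF graded_maximal_ideal_is_ideal] by simp
  qed
qed

lemma one_notin_graded_maximal_ideal: "1 \<notin> graded_maximal_ideal"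
  by (simp add: graded_maximal_ideal_eq monomial_ideal_def)

text \<open>Each member of the sequence raises by one the degree in which vanishing must be known; after the
  whole sequence that degree exceeds the number of variables, where the Koszul complex is zero.\<close>

lemma koszul_exact_of_regular_sequence:
  fixes L :: "('n::finite, 'k::field) mpolynomial set"
  assumes "is_ideal L" "set fs \<subseteq> graded_maximal_ideal" "regular_sequence_on_quotient L fs"
    and "i + length fs > CARD('n)"
  shows "koszul_exact L i"
  using assms
proof (induction fs arbitrary: L i)
  case Nil
  have "card S \<noteq> i" for S :: "'n set"
    using Nil.prems(4) card_mono[of UNIV S] by auto
  then show ?case by (simp add: koszul_exact_def)
next
  case (Cons f fs)
  then have "koszul_exact (ideal_span (L \<union> {f})) (Suc i)"
    by (intro Cons.IH ring_ideal.subspace_span) (auto simp: regular_sequence_Cons)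
  then show ?case
    using koszul_exact_of_quotient[of L f i] Cons.prems by (auto simp: regular_sequence_Cons)
qed

text \<open>Top Koszul homology is the socle of \<open>R/L\<close>, the set of elements annihilated by all variables.\<close>

lemma saturated_of_koszul_exact:
  fixes L :: "('n::finite, 'k::field) mpolynomial set"
  assumes L: "is_ideal L" and ex: "koszul_exact L (CARD('n))"
    and g: "\<forall>f\<in>graded_maximal_ideal. f * g \<in> L"
  shows "g \<in> L"
proof -
  have "koszul (\<lambda>_. g) S \<in> L" for S
    unfolding koszul_def
  proof (rule ring_ideal.subspace_sum[OF L])
    fix j
    have "variable j \<in> (graded_maximal_ideal :: ('n, 'k) mpolynomial set)"
      unfolding graded_maximal_ideal_def by (rule ring_ideal.span_base) simp
    then have "variable j * g \<in> L" using g by blast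
    then have "koszul_sign j S * (variable j * g) \<in> L" by (rule ideal_mult_left[OF L])
    then show "koszul_sign j S * variable j * g \<in> L" by (simp add: mult.assoc)
  qed
  then obtain v where "\<forall>S :: 'n set. card S = CARD('n) \<longrightarrow> g - koszul v S \<in> L"
    using ex unfolding koszul_exact_def by blast
  then have "g - koszul v UNIV \<in> L" by blast
  then show ?thesis by (simp add: koszul_def)
qed

text \<open>While \<open>r\<close> is positive, top homology vanishes, so no nonzero element of \<open>R/L\<close> is annihilated by the
  graded maximal ideal, and this ideal contains a nonzerodivisor. Dividing by it costs one degree of
  vanishing. The hypothesis that \<open>L\<close> lies in the graded maximal ideal keeps the quotients nonzero.\<close>

lemma regular_sequence_of_koszul_exact:
  fixes L :: "('n::finite, 'k::field) mpolynomial set"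
  assumes "is_ideal L" "L \<subseteq> graded_maximal_ideal" "\<And>i. i + r > CARD('n) \<Longrightarrow> koszul_exact L i"
  shows "\<exists>fs. length fs = r \<and> set fs \<subseteq> graded_maximal_ideal \<and> regular_sequence_on_quotient L fs"
  using assms
proof (induction r arbitrary: L)
  case 0
  then have sp: "ideal_span L = L" using ring_ideal.span_eq_iff by blast
  have "L \<noteq> UNIV" using 0 one_notin_graded_maximal_ideal by blast
  then have "regular_sequence_on_quotient L []"
    by (simp add: regular_sequence_on_quotient_def sp)
  then show ?case by simp
next
  case (Suc r)
  have "koszul_exact L (CARD('n))" by (rule Suc.prems(3)) simp
  from nonzerodivisor_exists[OF Suc.prems(1) graded_maximal_ideal_is_ideal
      saturated_of_koszul_exact[OF Suc.prems(1) this]]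
  obtain f where f: "f \<in> graded_maximal_ideal" "\<And>g. f * g \<in> L \<Longrightarrow> g \<in> L" by blast
  have "ideal_span (L \<union> {f}) \<subseteq> graded_maximal_ideal"
    by (rule ring_ideal.span_minimal[OF _ graded_maximal_ideal_is_ideal]) (use Suc.prems(2) f in auto)
  moreover have "koszul_exact (ideal_span (L \<union> {f})) i" if "i + r > CARD('n)" for i
  proof (rule koszul_exact_quotient[OF Suc.prems(1)])
    show "koszul_exact L i" using that by (intro Suc.prems(3)) simp
    show "koszul_exact L j" if "i = Suc j" for j
      using \<open>i + r > CARD('n)\<close> that by (intro Suc.prems(3)) simp
  qed (rule f(2))
  ultimately have "\<exists>fs. length fs = r \<and> set fs \<subseteq> graded_maximal_ideal \<and>
      regular_sequence_on_quotient (ideal_span (L \<union> {f})) fs"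
    by (rule Suc.IH[OF ring_ideal.subspace_span])
  then obtain fs where "length fs = r" "set fs \<subseteq> graded_maximal_ideal"
      "regular_sequence_on_quotient (ideal_span (L \<union> {f})) fs"
    by blast
  then show ?case using f
    by (intro exI[of _ "f # fs"]) (auto simp: regular_sequence_Cons[OF Suc.prems(1)])
qed

theorem depth_quotient_mono:
  fixes L L' :: "('n::finite, 'k::field) mpolynomial set"
  assumes "is_ideal L" "is_ideal L'" "L' \<subseteq> graded_maximal_ideal"
    and "\<And>i. koszul_exact L i \<Longrightarrow> koszul_exact L' i"
  shows "depth_quotient L \<le> depth_quotient L'"
  unfolding depth_quotient_def
proof (rule SUP_least)
  fix fs :: "('n, 'k) mpolynomial list"
  assume "fs \<in> {fs. set fs \<subseteq> graded_maximal_ideal \<and> regular_sequence_on_quotient L fs}"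
  then have "koszul_exact L' i" if "i + length fs > CARD('n)" for i
    using koszul_exact_of_regular_sequence[OF assms(1)] assms(4) that by blast
  then obtain gs where gs: "length gs = length fs" "set gs \<subseteq> graded_maximal_ideal"
      "regular_sequence_on_quotient L' gs"
    using regular_sequence_of_koszul_exact[OF assms(2,3)] by blast
  then show "enat (length fs) \<le> (SUP fs\<in>{fs. set fs \<subseteq> graded_maximal_ideal \<and>
      regular_sequence_on_quotient L' fs}. enat (length fs))"
    by (intro SUP_upper2[of gs]) auto
qed

section \<open>Dividing by a variable\<close>

text \<open>Every polynomial is uniquely \<open>x\<close> times a quotient plus a part in which \<open>x\<close> does not occur. Both
  the quotient and the remaining part commute with multiplication by the other variables, which is
  what makes them compatible with the Koszul differential.\<close>

definition divide_variable :: "'n \<Rightarrow> ('n, 'k::field) mpolynomial \<Rightarrow> ('n, 'k) mpolynomial" where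
  "divide_variable x p = Poly_Mapping.map_key (\<lambda>a. a + single x 1) p"

lemma lookup_divide_variable:
  "lookup (divide_variable x p) a = lookup p (a + single x 1)"
  unfolding divide_variable_def by (subst map_key.rep_eq) (auto simp: inj_def)

lemma divide_variable_diff: "divide_variable x (p - q) = divide_variable x p - divide_variable x q"
  by (rule poly_mapping_eqI) (simp add: lookup_divide_variable lookup_minus)

lemma divide_variable_sum: "divide_variable x (sum f A) = (\<Sum>a\<in>A. divide_variable x (f a))"
  by (rule poly_mapping_eqI) (simp add: lookup_divide_variable lookup_sum)

lemma divide_variable_sign:
  "divide_variable x (koszul_sign j S * p) = koszul_sign j S * divide_variable x p"
  using koszul_sign_cases[of j S, where 'a = "('a, 'b) mpolynomial"]
  by (auto intro!: poly_mapping_eqI simp: lookup_divide_variable)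

lemma lookup_single_mult_shift_right:
  fixes p :: "'a::cancel_comm_monoid_add \<Rightarrow>\<^sub>0 'k::comm_ring_1"
  shows "lookup (single a c * p) (b + a) = c * lookup p b"
  using lookup_single_mult_shift[of a c p b] by (simp add: add.commute)

lemma divide_variable_same: "divide_variable x (variable x * p) = p"
  by (rule poly_mapping_eqI)
    (simp add: lookup_divide_variable variable_def lookup_single_mult_shift_right)

lemma divide_variable_other:
  fixes p :: "('n, 'k::field) mpolynomial"
  assumes "j \<noteq> x"
  shows "divide_variable x (variable j * p) = variable j * divide_variable x p"
proof (rule poly_mapping_eqI)
  fix a :: "'n \<Rightarrow>\<^sub>0 nat"
  let ?x = "single x (1::nat)" and ?j = "single j (1::nat)"
  show "lookup (divide_variable x (variable j * p)) a
      = lookup (variable j * divide_variable x p) a"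
  proof (cases "\<exists>b. a = ?j + b")
    case True
    then obtain b where b: "a = ?j + b" by blast
    then show ?thesis
      by (simp add: lookup_divide_variable variable_def lookup_single_mult_shift add.assoc)
  next
    case False
    have "\<nexists>b. a + ?x = ?j + b"
    proof
      assume "\<exists>b. a + ?x = ?j + b"
      then obtain b where b: "a + ?x = ?j + b" by blast
      have "lookup a j \<noteq> 0"
        using arg_cong[OF b, of "\<lambda>q. lookup q j"] assms
        by (simp add: lookup_add lookup_single)
      then have "a = ?j + (a - ?j)"
        by (intro poly_mapping_eqI) (auto simp: lookup_add lookup_minus lookup_single when_def)
      then show False using False by blast
    qed
    then show ?thesis using False
      by (simp add: lookup_divide_variable variable_def lookup_single_mult)
  qed
qed

definition free_part :: "'n \<Rightarrow> ('n, 'k::field) mpolynomial \<Rightarrow> ('n, 'k) mpolynomial" where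
  "free_part x p = p - variable x * divide_variable x p"

lemma free_part_diff: "free_part x (p - q) = free_part x p - free_part x q"
  by (simp add: free_part_def divide_variable_diff algebra_simps)

lemma free_part_sum: "free_part x (sum f A) = (\<Sum>a\<in>A. free_part x (f a))"
  by (simp add: free_part_def divide_variable_sum sum_subtractf sum_distrib_left)

lemma free_part_sign: "free_part x (koszul_sign j S * p) = koszul_sign j S * free_part x p"
  by (simp add: free_part_def divide_variable_sign right_diff_distrib mult.left_commute)

lemma free_part_same: "free_part x (variable x * p) = 0"
  by (simp add: free_part_def divide_variable_same)

lemma free_part_other: "j \<noteq> x \<Longrightarrow> free_part x (variable j * p) = variable j * free_part x p"
  by (simp add: free_part_def divide_variable_other right_diff_distrib mult.left_commute)

lemma keys_free_part: "keys (free_part x p) \<subseteq> keys p"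
proof
  fix m assume m: "m \<in> keys (free_part x p)"
  have "lookup (free_part x p) m = lookup p m \<or>
      lookup (free_part x p) m = 0"
  proof (cases "\<exists>b. m = single x 1 + b")
    case True
    then obtain b where "m = b + single x 1" by (auto simp: add.commute)
    then show ?thesis
      by (simp add: free_part_def lookup_minus variable_def lookup_single_mult_shift_right lookup_divide_variable)
  next
    case False
    then show ?thesis by (simp add: free_part_def lookup_minus variable_def lookup_single_mult)
  qed
  then show "m \<in> keys p" using m by (auto simp: in_keys_iff)
qed

text \<open>Let \<open>w\<close> be a cycle modulo \<open>I : x\<close>. Then \<open>x * w\<close> is a cycle modulo \<open>I\<close>, hence the boundary of some
  \<open>v\<close> modulo \<open>I\<close>. Dividing this relation by \<open>x\<close>, one finds that \<open>w\<close> is the boundary of \<open>v\<close> divided by \<open>x\<close>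
  up to an error \<open>u\<close>, which comes from the \<open>x\<close>-free part of the values of \<open>v\<close> at sets containing \<open>x\<close>.
  The \<open>x\<close>-free part of the same relation, at the sets containing \<open>x\<close>, shows that \<open>u\<close> is itself a cycle
  modulo \<open>I\<close>, so that it is a boundary, too.\<close>

theorem koszul_exact_colon_variable:
  fixes U :: "('n::finite \<Rightarrow>\<^sub>0 nat) set"
  assumes up: "upward_closed U"
    and ex: "koszul_exact (monomial_ideal U :: ('n, 'k::field) mpolynomial set) i"
  shows "koszul_exact (monomial_ideal {a. a + single x 1 \<in> U} :: ('n, 'k) mpolynomial set) i"
  unfolding koszul_exact_def
proof (intro allI impI)
  let ?I = "monomial_ideal U :: ('n, 'k) mpolynomial set"
  let ?U' = "{a. a + single x 1 \<in> U}"
  let ?I' = "monomial_ideal ?U' :: ('n, 'k) mpolynomial set"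
  have up': "upward_closed ?U'"
    unfolding upward_closed_def
  proof (intro ballI allI CollectI)
    fix a b assume "a \<in> ?U'"
    then have "a + single x 1 + b \<in> U" using up by (simp add: upward_closed_def)
    then show "a + b + single x 1 \<in> U" by (simp only: add.assoc add.commute[of b])
  qed
  note I = monomial_ideal_is_ideal[OF up, where 'k = 'k]
  note I' = monomial_ideal_is_ideal[OF up', where 'k = 'k]
  have II': "?I \<subseteq> ?I'"
    using up by (auto simp: monomial_ideal_def upward_closed_def)
  have mult: "variable x * p \<in> ?I" if "p \<in> ?I'" for p
    using keys_mult[of "variable x" p] that
    by (fastforce simp: monomial_ideal_def variable_def add.commute split: if_splits)
  have div: "divide_variable x p \<in> ?I'" if "p \<in> ?I" for p
    using that by (auto simp: monomial_ideal_def in_keys_iff lookup_divide_variable)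
  have free: "free_part x p \<in> ?I" if "p \<in> ?I" for p
    using that keys_free_part[of x p] by (auto simp: monomial_ideal_def)
  fix w :: "'n set \<Rightarrow> ('n, 'k) mpolynomial"
  assume w: "\<forall>S. Suc (card S) = i \<longrightarrow> koszul w S \<in> ?I'"
  then have "\<forall>S. Suc (card S) = i \<longrightarrow> koszul (\<lambda>S. variable x * w S) S \<in> ?I"
    using mult by (simp add: koszul_scale)
  then obtain v where v: "\<And>S. card S = i \<Longrightarrow> variable x * w S - koszul v S \<in> ?I"
    using ex[unfolded koszul_exact_def, rule_format, of "\<lambda>S. variable x * w S"] by blast
  define u where "u = (\<lambda>S. if x \<in> S then 0 else koszul_sign x S * free_part x (v (insert x S)))"
  have div_koszul: "divide_variable x (koszul v S) = koszul (\<lambda>S. divide_variable x (v S)) S + u S" for S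
  proof -
    have summand: "divide_variable x (koszul_sign j S * variable j * v (insert j S))
      = koszul_sign j S * variable j * divide_variable x (v (insert j S)) + (if j = x then u S else 0)"
      if "j \<in> - S" for j
      using that by (cases "j = x")
        (simp_all add: mult.assoc divide_variable_sign divide_variable_other divide_variable_same
          u_def free_part_def algebra_simps)
    have "(\<Sum>j\<in>- S. if j = x then u S else 0) = u S"
      by (simp add: u_def)
    then show ?thesis
      unfolding koszul_def divide_variable_sum by (simp add: summand sum.distrib)
  qed
  have "koszul u S \<in> ?I" if S: "Suc (card S) = i" for S
  proof (cases "x \<in> S")
    case True
    then have "koszul u S = 0" by (simp add: koszul_def u_def)
    then show ?thesis using ring_ideal.subspace_0[OF I] by simp
  next
    case False
    let ?T = "insert x S"
    have T: "card ?T = i" using S False by simp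
    have summand: "koszul_sign j S * variable j * u (insert j S)
       = - koszul_sign x S * free_part x (koszul_sign j ?T * variable j * v (insert j ?T))"
      if "j \<in> - ?T" for j
    proof -
      have j: "j \<noteq> x" "j \<notin> S" using that by auto
      have "koszul_sign j S * koszul_sign x (insert j S) * (variable j * free_part x (v (insert j ?T)))
        = - (koszul_sign x S * koszul_sign j ?T) * (variable j * free_part x (v (insert j ?T)))"
        using koszul_sign_swap[of j x S, where 'a = "('n, 'k) mpolynomial"] j False by simp
      then show ?thesis using j False
        by (simp add: u_def mult.assoc free_part_sign free_part_other insert_commute)
          (simp add: mult_ac)
    qed
    have "koszul u S = (\<Sum>j\<in>- ?T. koszul_sign j S * variable j * u (insert j S))"
      unfolding koszul_def
      by (rule sum.mono_neutral_right) (auto simp: u_def)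
    also have "\<dots> = - koszul_sign x S * free_part x (koszul v ?T)"
      unfolding koszul_def free_part_sum sum_distrib_left by (rule sum.cong[OF refl summand])
    finally have eq: "koszul u S = - koszul_sign x S * free_part x (koszul v ?T)" .
    have "free_part x (variable x * w ?T - koszul v ?T) \<in> ?I" using v[OF T] by (rule free)
    then have "- free_part x (koszul v ?T) \<in> ?I" by (simp add: free_part_diff free_part_same)
    then have "koszul_sign x S * - free_part x (koszul v ?T) \<in> ?I" by (rule ideal_mult_left[OF I])
    then show ?thesis by (simp add: eq)
  qed
  then obtain y where y: "\<And>S. card S = i \<Longrightarrow> u S - koszul y S \<in> ?I"
    using ex[unfolded koszul_exact_def, rule_format, of u] by blast
  have "w S - koszul (\<lambda>S. divide_variable x (v S) + y S) S \<in> ?I'" if S: "card S = i" for S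
  proof -
    have "divide_variable x (variable x * w S - koszul v S) \<in> ?I'" using v[OF S] by (rule div)
    then have "w S - koszul (\<lambda>S. divide_variable x (v S)) S - u S \<in> ?I'"
      by (simp add: divide_variable_diff divide_variable_same div_koszul algebra_simps)
    then have "(w S - koszul (\<lambda>S. divide_variable x (v S)) S - u S) + (u S - koszul y S) \<in> ?I'"
      using y[OF S] II' by (intro ring_ideal.subspace_add[OF I']) auto
    then show ?thesis by (simp add: koszul_add algebra_simps)
  qed
  then show "\<exists>v. \<forall>S. card S = i \<longrightarrow> w S - koszul v S \<in> ?I'"
    by (intro exI[of _ "\<lambda>S. divide_variable x (v S) + y S"]) simp
qed

section \<open>Comparing graded free resolutions\<close>

text \<open>A minimal graded free resolution without the minimality condition on the matrix entries.\<close>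

definition graded_free_resolution ::
  "('n::finite, 'k::field) mpolynomial set \<Rightarrow> (nat \<Rightarrow> int list) \<Rightarrow>
    (nat \<Rightarrow> ('n, 'k) mpolynomial mat) \<Rightarrow> bool" where
  "graded_free_resolution I ds \<phi> \<longleftrightarrow>
     ds 0 = [0] \<and>
     (\<forall>i. \<phi> i \<in> carrier_mat (length (ds i)) (length (ds (Suc i)))) \<and>
     (\<forall>i. \<forall>s<length (ds i). \<forall>t<length (ds (Suc i)).
        homogeneous (ds (Suc i) ! t - ds i ! s) (\<phi> i $$ (s, t))) \<and>
     {\<phi> 0 *\<^sub>v v | v. v \<in> carrier_vec (length (ds 1))}
       = {w \<in> carrier_vec 1. vec_index w 0 \<in> I} \<and>
     (\<forall>i. {\<phi> (Suc i) *\<^sub>v v | v. v \<in> carrier_vec (length (ds (Suc (Suc i))))}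
            = mat_kernel (\<phi> i))"

lemma minimal_graded_free_resolution_iff:
  "minimal_graded_free_resolution I ds \<phi> \<longleftrightarrow> graded_free_resolution I ds \<phi> \<and>
     (\<forall>i. \<forall>s<length (ds i). \<forall>t<length (ds (Suc i)). \<phi> i $$ (s, t) \<in> graded_maximal_ideal)"
  unfolding minimal_graded_free_resolution_def graded_free_resolution_def all_conj_distrib imp_conjR
  by (rule iffI; elim conjE; intro conjI; assumption)

lemma total_degree_add: "total_degree (a + b) = total_degree a + total_degree b"
  by (simp add: total_degree_def lookup_add sum.distrib)

definition homogeneous_part :: "int \<Rightarrow> ('n::finite, 'k::field) mpolynomial \<Rightarrow> ('n, 'k) mpolynomial" where
  "homogeneous_part d p = Poly_Mapping.mapp (\<lambda>a c. if int (total_degree a) = d then c else 0) p"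

lemma lookup_homogeneous_part:
  "lookup (homogeneous_part d p) a = (if int (total_degree a) = d then lookup p a else 0)"
  by (auto simp: homogeneous_part_def lookup_mapp when_def in_keys_iff)

lemma homogeneous_homogeneous_part: "homogeneous d (homogeneous_part d p)"
  by (auto simp: homogeneous_def in_keys_iff lookup_homogeneous_part split: if_splits)

lemma homogeneous_part_self: "homogeneous d p \<Longrightarrow> homogeneous_part d p = p"
  by (rule poly_mapping_eqI) (auto simp: homogeneous_def in_keys_iff lookup_homogeneous_part)

lemma homogeneous_part_sum: "homogeneous_part d (sum f A) = (\<Sum>a\<in>A. homogeneous_part d (f a))"
  by (rule poly_mapping_eqI) (simp add: lookup_homogeneous_part lookup_sum)

lemma homogeneous_part_single_mult:
  assumes "int (total_degree a) = e"
  shows "homogeneous_part d (single a c * p) = single a c * homogeneous_part (d - e) p"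
proof (rule poly_mapping_eqI)
  fix m
  show "lookup (homogeneous_part d (single a c * p)) m
    = lookup (single a c * homogeneous_part (d - e) p) m"
  proof (cases "\<exists>b. m = a + b")
    case True
    then obtain b where m: "m = a + b" by blast
    have "int (total_degree m) = d \<longleftrightarrow> int (total_degree b) = d - e"
      using assms by (auto simp: m total_degree_add)
    then show ?thesis by (simp add: lookup_homogeneous_part m lookup_single_mult_shift)
  next
    case False
    then show ?thesis by (simp add: lookup_homogeneous_part lookup_single_mult)
  qed
qed

lemma homogeneous_part_mult:
  assumes "homogeneous e q"
  shows "homogeneous_part d (q * p) = q * homogeneous_part (d - e) p"
proof -
  have "homogeneous_part d (q * p) = (\<Sum>a\<in>keys q.
      homogeneous_part d (single a (lookup q a) * p))"
    by (subst sum_of_terms[of q]) (simp add: sum_distrib_right homogeneous_part_sum)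
  also have "\<dots> = (\<Sum>a\<in>keys q. single a (lookup q a) * homogeneous_part (d - e) p)"
    by (intro sum.cong refl homogeneous_part_single_mult) (use assms in \<open>simp add: homogeneous_def\<close>)
  also have "\<dots> = q * homogeneous_part (d - e) p"
    by (subst (2) sum_of_terms[of q]) (simp add: sum_distrib_right)
  finally show ?thesis .
qed

lemma mat_lift:
  fixes A B :: "'a::comm_ring_1 mat"
  assumes A: "A \<in> carrier_mat n m" and B: "B \<in> carrier_mat n k"
    and cols: "\<And>t. t < k \<Longrightarrow> col B t \<in> {A *\<^sub>v v | v. v \<in> carrier_vec m}"
  shows "\<exists>N \<in> carrier_mat m k. A * N = B"
proof -
  have "\<forall>t\<in>{..<k}. \<exists>v. v \<in> carrier_vec m \<and> A *\<^sub>v v = col B t"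
    using cols by fastforce
  from bchoice[OF this] obtain v where v: "\<And>t. t < k \<Longrightarrow> v t \<in> carrier_vec m \<and> A *\<^sub>v v t = col B t" by auto
  define N where "N = mat_of_cols m (map v [0..<k])"
  have N: "N \<in> carrier_mat m k" unfolding N_def by auto
  have "A * N = B"
  proof (rule mat_col_eqI)
    fix t assume "t < dim_col B"
    then have t: "t < k" using B by simp
    then have "col N t = v t" using v unfolding N_def by (subst col_mat_of_cols) auto
    then show "col (A * N) t = col B t" using col_mult2[OF A N t] v[OF t] by simp
  qed (use A B N in auto)
  then show ?thesis using N by blast
qed

lemma mat_entry_sum:
  assumes "A \<in> carrier_mat n m" "N \<in> carrier_mat m k" "s < n" "t < k"
  shows "(A * N) $$ (s, t) = (\<Sum>r<m. A $$ (s, r) * N $$ (r, t))"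
  using assms by (simp add: scalar_prod_def atLeast0LessThan)

text \<open>If a matrix of homogeneous entries factors through another one, then the homogeneous parts of
  the expected degrees of the factor still do the job.\<close>

lemma homogeneous_mat_lift:
  fixes A B :: "('n::finite, 'k::field) mpolynomial mat"
  assumes A: "A \<in> carrier_mat (length cs) (length ds)" and B: "B \<in> carrier_mat (length cs) (length es)"
    and homA: "\<And>s t. s < length cs \<Longrightarrow> t < length ds \<Longrightarrow> homogeneous (ds ! t - cs ! s) (A $$ (s, t))"
    and homB: "\<And>s t. s < length cs \<Longrightarrow> t < length es \<Longrightarrow> homogeneous (es ! t - cs ! s) (B $$ (s, t))"
    and N: "N \<in> carrier_mat (length ds) (length es)" "A * N = B"
  shows "\<exists>N' \<in> carrier_mat (length ds) (length es). A * N' = B \<and>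
    (\<forall>s<length ds. \<forall>t<length es. homogeneous (es ! t - ds ! s) (N' $$ (s, t)))"
proof -
  define N' where "N' = mat (length ds) (length es) (\<lambda>(s, t). homogeneous_part (es ! t - ds ! s) (N $$ (s, t)))"
  have N': "N' \<in> carrier_mat (length ds) (length es)" by (simp add: N'_def)
  have "(A * N') $$ (s, t) = B $$ (s, t)" if st: "s < length cs" "t < length es" for s t
  proof -
    have "(A * N') $$ (s, t) = (\<Sum>r<length ds. A $$ (s, r) * homogeneous_part (es ! t - ds ! r) (N $$ (r, t)))"
      using st by (simp add: mat_entry_sum[OF A N' st]) (simp add: N'_def)
    also have "\<dots> = (\<Sum>r<length ds. homogeneous_part (es ! t - cs ! s) (A $$ (s, r) * N $$ (r, t)))"
    proof (rule sum.cong)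
      fix r assume "r \<in> {..<length ds}"
      then show "A $$ (s, r) * homogeneous_part (es ! t - ds ! r) (N $$ (r, t))
          = homogeneous_part (es ! t - cs ! s) (A $$ (s, r) * N $$ (r, t))"
        using homogeneous_part_mult[OF homA[OF st(1)], of r "es ! t - cs ! s"] by simp
    qed simp
    also have "\<dots> = homogeneous_part (es ! t - cs ! s) ((A * N) $$ (s, t))"
      by (simp add: mat_entry_sum[OF A N(1) st] homogeneous_part_sum)
    also have "\<dots> = B $$ (s, t)" using homogeneous_part_self[OF homB[OF st]] N(2) by simp
    finally show ?thesis .
  qed
  then have "A * N' = B" using A B N' by (intro eq_matI) auto
  then show ?thesis using N'
    by (intro bexI[of _ N']) (auto simp: N'_def homogeneous_homogeneous_part)
qed

lemma homogeneous_add: "homogeneous d p \<Longrightarrow> homogeneous d q \<Longrightarrow> homogeneous d (p + q)"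
  using keys_add[of p q] by (auto simp: homogeneous_def)

lemma homogeneous_sum: "(\<And>a. a \<in> A \<Longrightarrow> homogeneous d (f a)) \<Longrightarrow> homogeneous d (sum f A)"
  by (induction A rule: infinite_finite_induct) (auto intro: homogeneous_add simp: homogeneous_def[of d 0])

lemma homogeneous_mult: "homogeneous d p \<Longrightarrow> homogeneous e q \<Longrightarrow> homogeneous (d + e) (p * q)"
  using keys_mult[of p q] by (fastforce simp: homogeneous_def total_degree_add)

lemma lookup_mult_zero:
  fixes p q :: "('n::finite, 'k::field) mpolynomial"
  shows "lookup (p * q) 0 = lookup p 0 * lookup q 0"
proof -
  have "lookup (p * q) (0 + 0) = lookup p 0 * lookup q 0"
  proof (rule lookup_mult_leading)
    fix c d :: "'n \<Rightarrow>\<^sub>0 nat"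
    assume "c + d = 0 + 0"
    then show "c = 0 \<and> d = 0"
      by (simp add: exponent_eq_0_iff lookup_add)
  qed
  then show ?thesis by simp
qed

lemma resolution_zero: "graded_free_resolution I ds \<phi> \<Longrightarrow> ds 0 = [0]"
  by (simp add: graded_free_resolution_def)

lemma resolution_carrier:
  "graded_free_resolution I ds \<phi> \<Longrightarrow> \<phi> i \<in> carrier_mat (length (ds i)) (length (ds (Suc i)))"
  by (simp add: graded_free_resolution_def)

lemma resolution_exact:
  "graded_free_resolution I ds \<phi> \<Longrightarrow>
    {\<phi> (Suc i) *\<^sub>v v | v. v \<in> carrier_vec (length (ds (Suc (Suc i))))} = mat_kernel (\<phi> i)"
  by (simp add: graded_free_resolution_def)

lemma resolution_start:
  "graded_free_resolution I ds \<phi> \<Longrightarrow>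
    {\<phi> 0 *\<^sub>v v | v. v \<in> carrier_vec (length (ds (Suc 0)))} = {w \<in> carrier_vec 1. vec_index w 0 \<in> I}"
  by (simp add: graded_free_resolution_def)

lemma mat_mult_unit_vec:
  fixes A :: "'a::comm_ring_1 mat"
  assumes "A \<in> carrier_mat n m" "t < m"
  shows "A *\<^sub>v unit_vec m t = col A t"
  using assms by (intro eq_vecI) auto

lemma kernel_lift:
  assumes res: "graded_free_resolution I ds \<phi>"
    and B: "B \<in> carrier_mat (length (ds (Suc i))) k" "\<phi> i * B = 0\<^sub>m (length (ds i)) k"
  shows "\<exists>N \<in> carrier_mat (length (ds (Suc (Suc i)))) k. \<phi> (Suc i) * N = B"
proof (rule mat_lift)
  have car: "\<phi> i \<in> carrier_mat (length (ds i)) (length (ds (Suc i)))" for i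
    using res by (simp add: graded_free_resolution_def)
  show "\<phi> (Suc i) \<in> carrier_mat (length (ds (Suc i))) (length (ds (Suc (Suc i))))" by (rule car)
  show "B \<in> carrier_mat (length (ds (Suc i))) k" by (rule B(1))
  fix t assume t: "t < k"
  have "\<phi> i *\<^sub>v col B t = col (\<phi> i * B) t" using col_mult2[OF car B(1) t] by simp
  also have "\<dots> = 0\<^sub>v (length (ds i))" using B(2) t by simp
  finally have "col B t \<in> mat_kernel (\<phi> i)"
    using car[of i] B(1) t by (intro mat_kernelI[OF car]) auto
  then show "col B t \<in> {\<phi> (Suc i) *\<^sub>v v | v. v \<in> carrier_vec (length (ds (Suc (Suc i))))}"
    by (simp only: resolution_exact[OF res])
qed

lemma resolution_complex:
  assumes res: "graded_free_resolution I ds \<phi>"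
  shows "\<phi> i * \<phi> (Suc i) = 0\<^sub>m (length (ds i)) (length (ds (Suc (Suc i))))"
proof (rule mat_col_eqI)
  have car: "\<phi> i \<in> carrier_mat (length (ds i)) (length (ds (Suc i)))" for i
    using res by (simp add: graded_free_resolution_def)
  show "dim_row (\<phi> i * \<phi> (Suc i)) = dim_row (0\<^sub>m (length (ds i)) (length (ds (Suc (Suc i)))))"
    "dim_col (\<phi> i * \<phi> (Suc i)) = dim_col (0\<^sub>m (length (ds i)) (length (ds (Suc (Suc i)))))"
    using car[of i] car[of "Suc i"] by auto
  fix t assume "t < dim_col (0\<^sub>m (length (ds i)) (length (ds (Suc (Suc i)))))"
  then have t: "t < length (ds (Suc (Suc i)))" by simp
  have "\<phi> (Suc i) *\<^sub>v unit_vec (length (ds (Suc (Suc i)))) t \<in> mat_kernel (\<phi> i)"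
    unfolding resolution_exact[OF res, symmetric]
    by (intro CollectI exI[of _ "unit_vec (length (ds (Suc (Suc i)))) t"] conjI refl unit_vec_carrier)
  also have "\<phi> (Suc i) *\<^sub>v unit_vec (length (ds (Suc (Suc i)))) t = col (\<phi> (Suc i)) t"
    by (rule mat_mult_unit_vec[OF car t])
  finally have "\<phi> i *\<^sub>v col (\<phi> (Suc i)) t = 0\<^sub>v (length (ds i))"
    using mat_kernelD[OF car] by blast
  then show "col (\<phi> i * \<phi> (Suc i)) t = col (0\<^sub>m (length (ds i)) (length (ds (Suc (Suc i))))) t"
    using col_mult2[OF car car t] t by simp
qed

lemma resolution_start_lift:
  assumes F: "graded_free_resolution I ds \<phi>" and G: "graded_free_resolution I gs \<psi>"
  shows "\<exists>N \<in> carrier_mat (length (gs (Suc 0))) (length (ds (Suc 0))). \<psi> 0 * N = \<phi> 0"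
proof (rule mat_lift)
  have start: "ds 0 = [0]" "gs 0 = [0]"
    and car: "\<phi> 0 \<in> carrier_mat (length (ds 0)) (length (ds (Suc 0)))"
      "\<psi> 0 \<in> carrier_mat (length (gs 0)) (length (gs (Suc 0)))"
    using resolution_zero[OF F] resolution_zero[OF G] resolution_carrier[OF F, of 0] resolution_carrier[OF G, of 0] by simp_all
  show "\<psi> 0 \<in> carrier_mat 1 (length (gs (Suc 0)))" "\<phi> 0 \<in> carrier_mat 1 (length (ds (Suc 0)))"
    using car start by simp_all
  fix t assume t: "t < length (ds (Suc 0))"
  have "col (\<phi> 0) t = \<phi> 0 *\<^sub>v unit_vec (length (ds (Suc 0))) t"
    by (rule mat_mult_unit_vec[OF car(1) t, symmetric])
  then have "col (\<phi> 0) t \<in> {\<phi> 0 *\<^sub>v v | v. v \<in> carrier_vec (length (ds (Suc 0)))}" by auto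
  then show "col (\<phi> 0) t \<in> {\<psi> 0 *\<^sub>v v | v. v \<in> carrier_vec (length (gs (Suc 0)))}"
    by (simp only: resolution_start[OF F] resolution_start[OF G])
qed

text \<open>Lift the identity of \<open>R/I\<close> to chain maps \<open>\<alpha>\<close> from the minimal resolution \<open>F\<close> to \<open>G\<close> and \<open>\<beta>\<close> back,
  with \<open>\<alpha>\<close> homogeneous. The composite \<open>\<beta> * \<alpha>\<close> is homotopic to the identity of \<open>F\<close>, and since the entries
  of the differential of \<open>F\<close> have no constant terms, \<open>\<beta> * \<alpha>\<close> has constant term 1 on the diagonal. So for
  each generator of \<open>F\<close> some entry of \<open>\<alpha>\<close> in its column has a nonzero constant term, and being
  homogeneous this entry joins two generators of the same degree.\<close>

theorem minimal_shifts_subset: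
  fixes \<phi> \<psi> :: "nat \<Rightarrow> ('n::finite, 'k::field) mpolynomial mat"
  assumes min: "minimal_graded_free_resolution I ds \<phi>" and G: "graded_free_resolution I gs \<psi>"
  shows "set (ds i) \<subseteq> set (gs i)"
proof -
  have F: "graded_free_resolution I ds \<phi>" and
    entries: "\<And>i s t. s < length (ds i) \<Longrightarrow> t < length (ds (Suc i)) \<Longrightarrow> \<phi> i $$ (s, t) \<in> graded_maximal_ideal"
    using min by (simp_all add: minimal_graded_free_resolution_iff)
  have const: "lookup (\<phi> i $$ (s, t)) 0 = 0"
    if "s < length (ds i)" "t < length (ds (Suc i))" for i s t
  proof -
    have "\<phi> i $$ (s, t) \<in> monomial_ideal {a. a \<noteq> 0}"
      using entries[OF that] by (simp add: graded_maximal_ideal_eq)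
    then show ?thesis by (auto simp: monomial_ideal_def in_keys_iff)
  qed
  have carF [simp]: "\<phi> i \<in> carrier_mat (length (ds i)) (length (ds (Suc i)))" for i
    using F by (simp add: graded_free_resolution_def)
  have carG [simp]: "\<psi> i \<in> carrier_mat (length (gs i)) (length (gs (Suc i)))" for i
    using G by (simp add: graded_free_resolution_def)
  have homF: "homogeneous (ds (Suc i) ! t - ds i ! s) (\<phi> i $$ (s, t))"
    if "s < length (ds i)" "t < length (ds (Suc i))" for i s t
    using F that by (simp add: graded_free_resolution_def)
  have homG: "homogeneous (gs (Suc i) ! t - gs i ! s) (\<psi> i $$ (s, t))"
    if "s < length (gs i)" "t < length (gs (Suc i))" for i s t
    using G that by (simp add: graded_free_resolution_def)
  have start: "ds 0 = [0]" "gs 0 = [0]" using F G by (simp_all add: graded_free_resolution_def)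
  (* The maps in homological degree i + 1 and the homotopy h out of degree i. The last three
     conditions are what is needed to lift once more: the images to be lifted are in the kernels. *)
  define step where "step = (\<lambda>i \<alpha> \<beta> h.
      \<alpha> \<in> carrier_mat (length (gs (Suc i))) (length (ds (Suc i))) \<and>
      \<beta> \<in> carrier_mat (length (ds (Suc i))) (length (gs (Suc i))) \<and>
      h \<in> carrier_mat (length (ds (Suc i))) (length (ds i)) \<and>
      (\<forall>s<length (gs (Suc i)). \<forall>t<length (ds (Suc i)). homogeneous (ds (Suc i) ! t - gs (Suc i) ! s) (\<alpha> $$ (s, t))) \<and>
      \<psi> i * (\<alpha> * \<phi> (Suc i)) = 0\<^sub>m (length (gs i)) (length (ds (Suc (Suc i)))) \<and>
      \<phi> i * (\<beta> * \<psi> (Suc i)) = 0\<^sub>m (length (ds i)) (length (gs (Suc (Suc i)))) \<and>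
      \<phi> i * (\<beta> * \<alpha> - 1\<^sub>m (length (ds (Suc i))) - h * \<phi> i) = 0\<^sub>m (length (ds i)) (length (ds (Suc i))))"
  have "\<exists>\<alpha> \<beta> h. step i \<alpha> \<beta> h" for i
  proof (induction i)
    case 0
    let ?n = "length (ds (Suc 0))" and ?g = "length (gs (Suc 0))"
    have carG0: "\<psi> 0 \<in> carrier_mat (length (ds 0)) ?g" using carG[of 0] start by simp
    have homG0: "homogeneous (gs (Suc 0) ! t - ds 0 ! s) (\<psi> 0 $$ (s, t))"
      if "s < length (ds 0)" "t < ?g" for s t using homG[of s 0 t] that start by simp
    obtain \<alpha>0 where "\<alpha>0 \<in> carrier_mat ?g ?n" "\<psi> 0 * \<alpha>0 = \<phi> 0"
      using resolution_start_lift[OF F G] by blast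
    from homogeneous_mat_lift[OF carG0 carF homG0 homF this]
    obtain \<alpha> where \<alpha>: "\<alpha> \<in> carrier_mat ?g ?n" "\<psi> 0 * \<alpha> = \<phi> 0"
      "\<forall>s<?g. \<forall>t<?n. homogeneous (ds (Suc 0) ! t - gs (Suc 0) ! s) (\<alpha> $$ (s, t))"
      by auto
    obtain \<beta> where \<beta>: "\<beta> \<in> carrier_mat ?n ?g" "\<phi> 0 * \<beta> = \<psi> 0"
      using resolution_start_lift[OF G F] by blast
    define h where "h = (0\<^sub>m ?n (length (ds 0)) :: ('n, 'k) mpolynomial mat)"
    have 1: "\<psi> 0 * (\<alpha> * \<phi> (Suc 0)) = 0\<^sub>m (length (gs 0)) (length (ds (Suc (Suc 0))))"
      using assoc_mult_mat[OF carG \<alpha>(1) carF] by (simp add: \<alpha>(2) resolution_complex[OF F] start)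
    have 2: "\<phi> 0 * (\<beta> * \<psi> (Suc 0)) = 0\<^sub>m (length (ds 0)) (length (gs (Suc (Suc 0))))"
      using assoc_mult_mat[OF carF \<beta>(1) carG] by (simp add: \<beta>(2) resolution_complex[OF G] start)
    have \<beta>\<alpha>: "\<beta> * \<alpha> \<in> carrier_mat ?n ?n" using \<alpha> \<beta> by auto
    have h\<phi>: "h * \<phi> 0 = 0\<^sub>m ?n ?n" unfolding h_def by (rule left_mult_zero_mat[OF carF])
    have "\<phi> 0 * (\<beta> * \<alpha>) = \<phi> 0"
      using assoc_mult_mat[OF carF \<beta>(1) \<alpha>(1)] by (simp add: \<alpha>(2) \<beta>(2))
    then have "\<phi> 0 * (\<beta> * \<alpha> - 1\<^sub>m ?n) = 0\<^sub>m (length (ds 0)) ?n"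
      using mult_minus_distrib_mat[OF carF \<beta>\<alpha> one_carrier_mat] right_mult_one_mat[OF carF]
        minus_r_inv_mat[OF carF] by simp
    moreover have "\<beta> * \<alpha> - 1\<^sub>m ?n - h * \<phi> 0 = \<beta> * \<alpha> - 1\<^sub>m ?n"
      unfolding h\<phi> using \<beta>\<alpha> by (intro eq_matI) auto
    ultimately have 3: "\<phi> 0 * (\<beta> * \<alpha> - 1\<^sub>m ?n - h * \<phi> 0) = 0\<^sub>m (length (ds 0)) ?n" by simp
    have "step 0 \<alpha> \<beta> h"
      unfolding step_def using \<alpha>(1,3) \<beta>(1) 1 2 3 by (simp add: h_def)
    then show ?case by blast
  next
    case (Suc i)
    then obtain \<alpha> \<beta> h where st: "step i \<alpha> \<beta> h" by blast
    note st' = st[unfolded step_def]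
    have \<alpha>: "\<alpha> \<in> carrier_mat (length (gs (Suc i))) (length (ds (Suc i)))"
      and \<beta>: "\<beta> \<in> carrier_mat (length (ds (Suc i))) (length (gs (Suc i)))"
      and h: "h \<in> carrier_mat (length (ds (Suc i))) (length (ds i))"
      and hom\<alpha>: "\<And>s t. s < length (gs (Suc i)) \<Longrightarrow> t < length (ds (Suc i)) \<Longrightarrow> homogeneous (ds (Suc i) ! t - gs (Suc i) ! s) (\<alpha> $$ (s, t))"
      using st' by blast+
    have \<alpha>\<phi>: "\<alpha> * \<phi> (Suc i) \<in> carrier_mat (length (gs (Suc i))) (length (ds (Suc (Suc i))))"
      using \<alpha> carF[of "Suc i"] by (rule mult_carrier_mat)
    have hom\<alpha>\<phi>: "homogeneous (ds (Suc (Suc i)) ! t - gs (Suc i) ! s) ((\<alpha> * \<phi> (Suc i)) $$ (s, t))"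
      if "s < length (gs (Suc i))" "t < length (ds (Suc (Suc i)))" for s t
      unfolding mat_entry_sum[OF \<alpha> carF that]
    proof (rule homogeneous_sum)
      fix r assume "r \<in> {..<length (ds (Suc i))}"
      then show "homogeneous (ds (Suc (Suc i)) ! t - gs (Suc i) ! s) (\<alpha> $$ (s, r) * \<phi> (Suc i) $$ (r, t))"
        using homogeneous_mult[OF hom\<alpha>[OF that(1), of r] homF[of r "Suc i" t]] that by simp
    qed
    obtain \<alpha>0 where "\<alpha>0 \<in> carrier_mat (length (gs (Suc (Suc i)))) (length (ds (Suc (Suc i))))"
        "\<psi> (Suc i) * \<alpha>0 = \<alpha> * \<phi> (Suc i)"
      using kernel_lift[OF G \<alpha>\<phi>] st' by blast
    from homogeneous_mat_lift[OF carG \<alpha>\<phi> homG hom\<alpha>\<phi> this]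
    obtain \<alpha>' where \<alpha>': "\<alpha>' \<in> carrier_mat (length (gs (Suc (Suc i)))) (length (ds (Suc (Suc i))))"
        "\<psi> (Suc i) * \<alpha>' = \<alpha> * \<phi> (Suc i)"
        "\<forall>s<length (gs (Suc (Suc i))). \<forall>t<length (ds (Suc (Suc i))). homogeneous (ds (Suc (Suc i)) ! t - gs (Suc (Suc i)) ! s) (\<alpha>' $$ (s, t))"
      by auto
    have \<beta>\<psi>: "\<beta> * \<psi> (Suc i) \<in> carrier_mat (length (ds (Suc i))) (length (gs (Suc (Suc i))))"
      using \<beta> carG[of "Suc i"] by (rule mult_carrier_mat)
    then obtain \<beta>' where \<beta>': "\<beta>' \<in> carrier_mat (length (ds (Suc (Suc i)))) (length (gs (Suc (Suc i))))"
        "\<phi> (Suc i) * \<beta>' = \<beta> * \<psi> (Suc i)"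
      using kernel_lift[OF F, of "\<beta> * \<psi> (Suc i)"] st' by blast
    define D where "D = \<beta> * \<alpha> - 1\<^sub>m (length (ds (Suc i))) - h * \<phi> i"
    have \<beta>\<alpha>: "\<beta> * \<alpha> \<in> carrier_mat (length (ds (Suc i))) (length (ds (Suc i)))" using \<alpha> \<beta> by auto
    have h\<phi>: "h * \<phi> i \<in> carrier_mat (length (ds (Suc i))) (length (ds (Suc i)))" using h carF[of i] by (rule mult_carrier_mat)
    have D: "D \<in> carrier_mat (length (ds (Suc i))) (length (ds (Suc i)))"
      unfolding D_def using h\<phi> by (rule minus_carrier_mat)
    obtain h' where h': "h' \<in> carrier_mat (length (ds (Suc (Suc i)))) (length (ds (Suc i)))" "\<phi> (Suc i) * h' = D"
      using kernel_lift[OF F D] st' unfolding D_def by blast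
    have 1: "\<psi> (Suc i) * (\<alpha>' * \<phi> (Suc (Suc i))) = 0\<^sub>m (length (gs (Suc i))) (length (ds (Suc (Suc (Suc i)))))"
    proof -
      have "\<psi> (Suc i) * (\<alpha>' * \<phi> (Suc (Suc i))) = (\<psi> (Suc i) * \<alpha>') * \<phi> (Suc (Suc i))"
        using assoc_mult_mat[OF carG \<alpha>'(1) carF] by simp
      also have "\<dots> = \<alpha> * (\<phi> (Suc i) * \<phi> (Suc (Suc i)))"
        unfolding \<alpha>'(2) by (rule assoc_mult_mat[OF \<alpha> carF carF])
      finally show ?thesis using \<alpha> by (simp add: resolution_complex[OF F])
    qed
    have 2: "\<phi> (Suc i) * (\<beta>' * \<psi> (Suc (Suc i))) = 0\<^sub>m (length (ds (Suc i))) (length (gs (Suc (Suc (Suc i)))))"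
    proof -
      have "\<phi> (Suc i) * (\<beta>' * \<psi> (Suc (Suc i))) = (\<phi> (Suc i) * \<beta>') * \<psi> (Suc (Suc i))"
        using assoc_mult_mat[OF carF \<beta>'(1) carG] by simp
      also have "\<dots> = \<beta> * (\<psi> (Suc i) * \<psi> (Suc (Suc i)))"
        unfolding \<beta>'(2) by (rule assoc_mult_mat[OF \<beta> carG carG])
      finally show ?thesis using \<beta> by (simp add: resolution_complex[OF G])
    qed
    let ?n = "length (ds (Suc i))" and ?m = "length (ds (Suc (Suc i)))"
    have \<beta>\<alpha>': "\<beta>' * \<alpha>' \<in> carrier_mat ?m ?m" using \<alpha>' \<beta>' by auto
    have h\<phi>': "h' * \<phi> (Suc i) \<in> carrier_mat ?m ?m" using h'(1) carF[of "Suc i"] by (rule mult_carrier_mat)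
    have e1: "\<phi> (Suc i) * (\<beta>' * \<alpha>') = \<beta> * \<alpha> * \<phi> (Suc i)"
    proof -
      have "\<phi> (Suc i) * (\<beta>' * \<alpha>') = (\<phi> (Suc i) * \<beta>') * \<alpha>'"
        using assoc_mult_mat[OF carF \<beta>'(1) \<alpha>'(1)] by simp
      also have "\<dots> = \<beta> * (\<psi> (Suc i) * \<alpha>')"
        unfolding \<beta>'(2) by (rule assoc_mult_mat[OF \<beta> carG \<alpha>'(1)])
      also have "\<dots> = \<beta> * \<alpha> * \<phi> (Suc i)"
        unfolding \<alpha>'(2) using assoc_mult_mat[OF \<beta> \<alpha> carF] by simp
      finally show ?thesis .
    qed
    have e2: "\<phi> (Suc i) * (h' * \<phi> (Suc i)) = D * \<phi> (Suc i)"
      using assoc_mult_mat[OF carF h'(1) carF] h'(2) by simp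
    have "h * \<phi> i * \<phi> (Suc i) = 0\<^sub>m ?n ?m"
      using assoc_mult_mat[OF h carF carF] resolution_complex[OF F, of i] h by simp
    then have e3: "D * \<phi> (Suc i) = \<beta> * \<alpha> * \<phi> (Suc i) - \<phi> (Suc i) - 0\<^sub>m ?n ?m"
      unfolding D_def
      using minus_mult_distrib_mat[OF minus_carrier_mat[OF one_carrier_mat] h\<phi> carF, of "\<beta> * \<alpha>"]
        minus_mult_distrib_mat[OF \<beta>\<alpha> one_carrier_mat carF] carF[of "Suc i"] by simp
    have "\<phi> (Suc i) * (\<beta>' * \<alpha>' - 1\<^sub>m ?m - h' * \<phi> (Suc i))
       = \<phi> (Suc i) * (\<beta>' * \<alpha>') - \<phi> (Suc i) - \<phi> (Suc i) * (h' * \<phi> (Suc i))"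
      using mult_minus_distrib_mat[OF carF minus_carrier_mat[OF one_carrier_mat] h\<phi>', of "\<beta>' * \<alpha>'"]
        mult_minus_distrib_mat[OF carF \<beta>\<alpha>' one_carrier_mat] carF[of "Suc i"] by simp
    also have "\<dots> = 0\<^sub>m ?n ?m"
      unfolding e1 e2 e3 using \<beta>\<alpha> carF[of "Suc i"] by (intro eq_matI) auto
    finally have 3: "\<phi> (Suc i) * (\<beta>' * \<alpha>' - 1\<^sub>m ?m - h' * \<phi> (Suc i)) = 0\<^sub>m ?n ?m" .
    have "step (Suc i) \<alpha>' \<beta>' h'"
      unfolding step_def using \<alpha>'(1,3) \<beta>'(1) h'(1) 1 2 3 by blast
    then show ?case by blast
  qed
  moreover have "set (ds (Suc i)) \<subseteq> set (gs (Suc i))" if "step i \<alpha> \<beta> h" for i \<alpha> \<beta> h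
  proof
    let ?n = "length (ds (Suc i))"
    have \<alpha>: "\<alpha> \<in> carrier_mat (length (gs (Suc i))) ?n"
      and \<beta>: "\<beta> \<in> carrier_mat ?n (length (gs (Suc i)))"
      and h: "h \<in> carrier_mat ?n (length (ds i))"
      and hom\<alpha>: "\<And>s t. s < length (gs (Suc i)) \<Longrightarrow> t < ?n \<Longrightarrow> homogeneous (ds (Suc i) ! t - gs (Suc i) ! s) (\<alpha> $$ (s, t))"
      and ker: "\<phi> i * (\<beta> * \<alpha> - 1\<^sub>m ?n - h * \<phi> i) = 0\<^sub>m (length (ds i)) ?n"
      using that unfolding step_def by blast+
    have h\<phi>: "h * \<phi> i \<in> carrier_mat ?n ?n" using h carF[of i] by (rule mult_carrier_mat)
    have \<beta>\<alpha>: "\<beta> * \<alpha> \<in> carrier_mat ?n ?n" using \<alpha> \<beta> by auto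
    obtain h' where h': "h' \<in> carrier_mat (length (ds (Suc (Suc i)))) ?n"
        "\<phi> (Suc i) * h' = \<beta> * \<alpha> - 1\<^sub>m ?n - h * \<phi> i"
      using kernel_lift[OF F minus_carrier_mat[OF h\<phi>] ker] by blast
    fix d assume "d \<in> set (ds (Suc i))"
    then obtain t where t: "t < ?n" "d = ds (Suc i) ! t" by (auto simp: in_set_conv_nth)
    have "(\<phi> (Suc i) * h') $$ (t, t) = (\<beta> * \<alpha>) $$ (t, t) - 1 - (h * \<phi> i) $$ (t, t)"
      unfolding h'(2) using t \<beta>\<alpha> h\<phi> by (simp del: index_mult_mat)
    then have eq: "(\<beta> * \<alpha>) $$ (t, t) = 1 + (h * \<phi> i) $$ (t, t) + (\<phi> (Suc i) * h') $$ (t, t)" by (simp add: algebra_simps)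
    have "lookup ((h * \<phi> i) $$ (t, t)) 0 = 0"
      unfolding mat_entry_sum[OF h carF t(1) t(1)] by (simp add: lookup_sum lookup_mult_zero const t)
    moreover have "lookup ((\<phi> (Suc i) * h') $$ (t, t)) 0 = 0"
      unfolding mat_entry_sum[OF carF h'(1) t(1) t(1)] by (simp add: lookup_sum lookup_mult_zero const t)
    ultimately have "lookup ((\<beta> * \<alpha>) $$ (t, t)) 0 = 1"
      by (simp add: eq lookup_add lookup_one)
    then have "(\<Sum>s<length (gs (Suc i)). lookup (\<beta> $$ (t, s)) 0 * lookup (\<alpha> $$ (s, t)) 0) = 1"
      unfolding mat_entry_sum[OF \<beta> \<alpha> t(1) t(1)] by (simp add: lookup_sum lookup_mult_zero)
    then have "(\<Sum>s<length (gs (Suc i)). lookup (\<beta> $$ (t, s)) 0 * lookup (\<alpha> $$ (s, t)) 0) \<noteq> 0" by simp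
    then obtain s where s: "s < length (gs (Suc i))" "lookup (\<alpha> $$ (s, t)) 0 \<noteq> 0"
      by (metis (no_types, lifting) lessThan_iff mult_zero_right sum.neutral)
    then have "ds (Suc i) ! t - gs (Suc i) ! s = 0"
      using hom\<alpha>[OF s(1) t(1)] by (force simp: homogeneous_def in_keys_iff total_degree_def)
    then show "d \<in> set (gs (Suc i))" using s(1) t(2) by auto
  qed
  ultimately have "set (ds (Suc i)) \<subseteq> set (gs (Suc i))" for i by blast
  then show ?thesis using start by (cases i) simp_all
qed

section \<open>Multigraded complexes of free modules\<close>

text \<open>Divisibility of monomials.\<close>

definition exponent_le :: "('n \<Rightarrow>\<^sub>0 nat) \<Rightarrow> ('n \<Rightarrow>\<^sub>0 nat) \<Rightarrow> bool" (infix "\<preceq>" 50) where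
  "a \<preceq> b \<longleftrightarrow> (\<forall>i. lookup a i \<le> lookup b i)"

lemma exponent_le_refl [simp]: "a \<preceq> a"
  by (simp add: exponent_le_def)

lemma exponent_le_trans: "a \<preceq> b \<Longrightarrow> b \<preceq> c \<Longrightarrow> a \<preceq> c"
  unfolding exponent_le_def by (meson order_trans)

lemma exponent_le_add_right [simp]: "a \<preceq> a + b"
  by (simp add: exponent_le_def lookup_add)

lemma exponent_diff_add: "a \<preceq> b \<Longrightarrow> (b - a) + a = b"
  by (rule poly_mapping_eqI) (simp add: exponent_le_def lookup_add lookup_minus)

lemma exponent_diff_diff:
  assumes "a \<preceq> b" "b \<preceq> c"
  shows "c - a = (b - a) + (c - b)"
proof (rule poly_mapping_eqI)
  fix i
  have "lookup a i \<le> lookup b i" "lookup b i \<le> lookup c i"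
    using assms by (simp_all add: exponent_le_def)
  then show "lookup (c - a) i = lookup (b - a + (c - b)) i"
    by (simp add: lookup_add lookup_minus)
qed

lemma exponent_diff_eq_addD:
  assumes "a \<preceq> b" "a \<preceq> c" "c - a = (b - a) + d"
  shows "b \<preceq> c"
  unfolding exponent_le_def
proof
  fix i
  have "lookup (c - a) i = lookup (b - a + d) i" using assms(3) by simp
  moreover have "lookup a i \<le> lookup b i" "lookup a i \<le> lookup c i"
    using assms by (simp_all add: exponent_le_def)
  ultimately show "lookup b i \<le> lookup c i"
    by (simp add: lookup_add lookup_minus)
qed

text \<open>Let \<open>c\<close> list the multidegrees of a basis of a free module. In multidegree \<open>b\<close> the basis element
  \<open>t\<close> contributes the scalar multiples of the monomial with exponent \<open>b - c ! t\<close> if \<open>c ! t\<close> divides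
  \<open>b\<close>, and nothing otherwise. So the part of degree \<open>b\<close> is a space of scalar vectors, and these spaces grow with \<open>b\<close>
  inside one fixed space.\<close>

definition supported :: "('n \<Rightarrow>\<^sub>0 nat) list \<Rightarrow> ('n \<Rightarrow>\<^sub>0 nat) \<Rightarrow> (nat \<Rightarrow> 'k::field) set" where
  "supported c b = {u. \<forall>t. u t \<noteq> 0 \<longrightarrow> t < length c \<and> c ! t \<preceq> b}"

definition scalar_apply :: "(nat \<Rightarrow> nat \<Rightarrow> 'k::field) \<Rightarrow> ('n \<Rightarrow>\<^sub>0 nat) list \<Rightarrow> (nat \<Rightarrow> 'k) \<Rightarrow> nat \<Rightarrow> 'k" where
  "scalar_apply \<Lambda> c u = (\<lambda>s. \<Sum>t<length c. \<Lambda> s t * u t)"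

definition multigraded_map :: "('n \<Rightarrow>\<^sub>0 nat) list \<Rightarrow> ('n \<Rightarrow>\<^sub>0 nat) list \<Rightarrow> (nat \<Rightarrow> nat \<Rightarrow> 'k::field) \<Rightarrow> bool" where
  "multigraded_map c c' \<Lambda> \<longleftrightarrow> (\<forall>s t. \<Lambda> s t \<noteq> 0 \<longrightarrow> s < length c \<and> t < length c' \<and> c ! s \<preceq> c' ! t)"

text \<open>The matrix over the polynomial ring of a multigraded map: its entries are scalars times the
  monomials that make up for the difference of the multidegrees.\<close>

definition monomial_matrix :: "('n \<Rightarrow>\<^sub>0 nat) list \<Rightarrow> ('n \<Rightarrow>\<^sub>0 nat) list \<Rightarrow> (nat \<Rightarrow> nat \<Rightarrow> 'k::field)
    \<Rightarrow> ('n, 'k) mpolynomial mat" where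
  "monomial_matrix c c' \<Lambda> = mat (length c) (length c') (\<lambda>(s, t). single (c' ! t - c ! s) (\<Lambda> s t))"

definition multigraded_part :: "('n \<Rightarrow>\<^sub>0 nat) list \<Rightarrow> ('n \<Rightarrow>\<^sub>0 nat) \<Rightarrow> ('n, 'k::field) mpolynomial vec \<Rightarrow> nat \<Rightarrow> 'k" where
  "multigraded_part c b w t =
     (if t < length c \<and> c ! t \<preceq> b then lookup (vec_index w t) (b - c ! t) else 0)"

lemma multigraded_part_supported: "multigraded_part c b w \<in> supported c b"
  by (auto simp: supported_def multigraded_part_def split: if_splits)

text \<open>In each multidegree the monomial matrix acts through its scalars. A term with nonzero scalar whose
  source degree \<open>c' ! t\<close> does not divide \<open>b\<close> contributes to neither side.\<close>

lemma multigraded_part_mult: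
  fixes w :: "('n::finite, 'k::field) mpolynomial vec"
  assumes \<Lambda>: "multigraded_map c c' \<Lambda>" and w: "w \<in> carrier_vec (length c')"
  shows "multigraded_part c b (monomial_matrix c c' \<Lambda> *\<^sub>v w) = scalar_apply \<Lambda> c' (multigraded_part c' b w)"
proof
  fix s
  show "multigraded_part c b (monomial_matrix c c' \<Lambda> *\<^sub>v w) s = scalar_apply \<Lambda> c' (multigraded_part c' b w) s"
  proof (cases "s < length c \<and> c ! s \<preceq> b")
    case True
    have "vec_index (monomial_matrix c c' \<Lambda> *\<^sub>v w) s
        = (\<Sum>t<length c'. single (c' ! t - c ! s) (\<Lambda> s t) * vec_index w t)"
      using True w by (simp add: monomial_matrix_def scalar_prod_def atLeast0LessThan)
    then have "multigraded_part c b (monomial_matrix c c' \<Lambda> *\<^sub>v w) s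
       = (\<Sum>t<length c'. lookup (single (c' ! t - c ! s) (\<Lambda> s t) * vec_index w t) (b - c ! s))"
      using True by (simp add: multigraded_part_def lookup_sum)
    also have "\<dots> = (\<Sum>t<length c'. \<Lambda> s t * multigraded_part c' b w t)"
    proof (rule sum.cong)
      fix t assume "t \<in> {..<length c'}"
      show "lookup (single (c' ! t - c ! s) (\<Lambda> s t) * vec_index w t) (b - c ! s)
          = \<Lambda> s t * multigraded_part c' b w t"
      proof (cases "\<Lambda> s t = 0")
        case True
        then show ?thesis by simp
      next
        case False
        then have st: "t < length c'" "c ! s \<preceq> c' ! t" using \<Lambda> by (auto simp: multigraded_map_def)
        show ?thesis
        proof (cases "c' ! t \<preceq> b")
          case True
          then show ?thesis
            using exponent_diff_diff[OF st(2) True] st(1)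
            by (simp add: lookup_single_mult_shift multigraded_part_def)
        next
          case False
          have "\<nexists>d. b - c ! s = (c' ! t - c ! s) + d"
            using exponent_diff_eq_addD[OF st(2)] \<open>s < length c \<and> c ! s \<preceq> b\<close> False by blast
          then show ?thesis using False by (simp add: lookup_single_mult multigraded_part_def)
        qed
      qed
    qed simp
    finally show ?thesis by (simp add: scalar_apply_def)
  next
    case False
    have "\<Lambda> s t * multigraded_part c' b w t = 0" for t
    proof (rule ccontr)
      assume "\<Lambda> s t * multigraded_part c' b w t \<noteq> 0"
      then have "\<Lambda> s t \<noteq> 0" "multigraded_part c' b w t \<noteq> 0" by auto
      then have "s < length c" "c ! s \<preceq> c' ! t" "c' ! t \<preceq> b"
        using \<Lambda> by (auto simp: multigraded_map_def multigraded_part_def split: if_splits)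
      then show False using False exponent_le_trans by blast
    qed
    then have "scalar_apply \<Lambda> c' (multigraded_part c' b w) s = 0"
      unfolding scalar_apply_def by (intro sum.neutral) blast
    moreover have "multigraded_part c b v s = 0" for v :: "('n, 'k) mpolynomial vec"
      using False by (auto simp: multigraded_part_def)
    ultimately show ?thesis by simp
  qed
qed

lemma multigraded_part_eqI:
  fixes w w' :: "('n, 'k::field) mpolynomial vec"
  assumes "w \<in> carrier_vec (length c)" "w' \<in> carrier_vec (length c)"
    and eq: "\<And>b. multigraded_part c b w = multigraded_part c b w'"
  shows "w = w'"
proof (rule eq_vecI)
  fix t assume "t < dim_vec w'"
  then have t: "t < length c" using assms(2) by simp
  show "vec_index w t = vec_index w' t"
  proof (rule poly_mapping_eqI)
    fix a
    have "multigraded_part c (c ! t + a) w t = multigraded_part c (c ! t + a) w' t" by (simp add: eq)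
    then show "lookup (vec_index w t) a = lookup (vec_index w' t) a"
      using t by (simp add: multigraded_part_def)
  qed
qed (use assms in simp)

lemma multigraded_part_zero: "multigraded_part c b (0\<^sub>v (length c)) = 0"
  by (rule ext) (simp add: multigraded_part_def)

lemma finite_multigraded_parts:
  assumes "w \<in> carrier_vec (length c)"
  shows "finite {b. multigraded_part c b w \<noteq> 0}"
proof (rule finite_subset)
  show "{b. multigraded_part c b w \<noteq> 0} \<subseteq> (\<Union>t<length c. (\<lambda>a. a + c ! t) ` keys (vec_index w t))"
  proof
    fix b assume "b \<in> {b. multigraded_part c b w \<noteq> 0}"
    then obtain t where "multigraded_part c b w t \<noteq> 0" by (auto simp: fun_eq_iff)
    then have "t < length c" "c ! t \<preceq> b" "b - c ! t \<in> keys (vec_index w t)"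
      by (auto simp: multigraded_part_def in_keys_iff split: if_splits)
    then show "b \<in> (\<Union>t<length c. (\<lambda>a. a + c ! t) ` keys (vec_index w t))"
      using exponent_diff_add[of "c ! t" b] by (intro UN_I[of t] image_eqI[of _ _ "b - c ! t"]) auto
  qed
qed simp

lemma multigraded_vec_exists:
  fixes u :: "('n \<Rightarrow>\<^sub>0 nat) \<Rightarrow> nat \<Rightarrow> 'k::field"
  assumes sup: "\<And>b. u b \<in> supported c b" and fin: "finite {b. u b \<noteq> 0}"
  shows "\<exists>w\<in>carrier_vec (length c). \<forall>b. multigraded_part c b w = u b"
proof -
  define B where "B = {b. u b \<noteq> 0}"
  define w where "w = vec (length c) (\<lambda>t. \<Sum>b\<in>{b \<in> B. c ! t \<preceq> b}. single (b - c ! t) (u b t))"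
  have "multigraded_part c b w t = u b t" for b t
  proof (cases "t < length c \<and> c ! t \<preceq> b")
    case True
    have eq: "b' - c ! t = b - c ! t \<longleftrightarrow> b' = b" if "c ! t \<preceq> b'" for b'
      using exponent_diff_add[OF that] exponent_diff_add[of "c ! t" b] True by metis
    have "multigraded_part c b w t = (\<Sum>b'\<in>{b \<in> B. c ! t \<preceq> b}. if b' = b then u b' t else 0)"
      using True by (auto simp: multigraded_part_def w_def lookup_sum lookup_single when_def eq intro!: sum.cong)
    also have "\<dots> = (if b \<in> B then u b t else 0)"
      using fin True by (simp add: B_def)
    also have "\<dots> = u b t" by (simp add: B_def)
    finally show ?thesis .
  next
    case False
    then have "u b t = 0" using sup[of b] by (auto simp: supported_def)
    then show ?thesis using False by (auto simp: multigraded_part_def)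
  qed
  then have "\<forall>b. multigraded_part c b w = u b" by (auto simp: fun_eq_iff)
  then show ?thesis by (intro bexI[of _ w]) (simp_all add: w_def)
qed

text \<open>A preimage can be chosen in each multidegree separately. It has to be chosen as zero wherever \<open>w\<close>
  has no component, for then only finitely many degrees are involved and the choices add up to a
  vector of polynomials.\<close>

lemma monomial_matrix_image_iff:
  fixes \<Lambda> :: "nat \<Rightarrow> nat \<Rightarrow> 'k::field" and c c' :: "('n::finite \<Rightarrow>\<^sub>0 nat) list"
  assumes \<Lambda>: "multigraded_map c c' \<Lambda>" and w: "w \<in> carrier_vec (length c)"
  shows "w \<in> {monomial_matrix c c' \<Lambda> *\<^sub>v v | v. v \<in> carrier_vec (length c')} \<longleftrightarrow>
    (\<forall>b. multigraded_part c b w \<in> scalar_apply \<Lambda> c' ` supported c' b)"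
proof
  assume "w \<in> {monomial_matrix c c' \<Lambda> *\<^sub>v v | v. v \<in> carrier_vec (length c')}"
  then obtain v where "v \<in> carrier_vec (length c')" "w = monomial_matrix c c' \<Lambda> *\<^sub>v v" by blast
  then show "\<forall>b. multigraded_part c b w \<in> scalar_apply \<Lambda> c' ` supported c' b"
    by (simp add: multigraded_part_mult[OF \<Lambda>] multigraded_part_supported)
next
  assume img: "\<forall>b. multigraded_part c b w \<in> scalar_apply \<Lambda> c' ` supported c' b"
  have "\<forall>b. \<exists>u. u \<in> supported c' b \<and> scalar_apply \<Lambda> c' u = multigraded_part c b w \<and>
      (multigraded_part c b w = 0 \<longrightarrow> u = 0)"
  proof
    fix b
    show "\<exists>u. u \<in> supported c' b \<and> scalar_apply \<Lambda> c' u = multigraded_part c b w \<and>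
      (multigraded_part c b w = 0 \<longrightarrow> u = 0)"
    proof (cases "multigraded_part c b w = 0")
      case True
      then show ?thesis
        by (intro exI[of _ 0]) (auto simp: supported_def scalar_apply_def fun_eq_iff)
    next
      case False
      then show ?thesis using img by (metis imageE)
    qed
  qed
  from choice[OF this] obtain u where u: "\<And>b. u b \<in> supported c' b"
      "\<And>b. scalar_apply \<Lambda> c' (u b) = multigraded_part c b w" "\<And>b. multigraded_part c b w = 0 \<Longrightarrow> u b = 0"
    by auto
  have "{b. u b \<noteq> 0} \<subseteq> {b. multigraded_part c b w \<noteq> 0}" using u(3) by blast
  then have "finite {b. u b \<noteq> 0}" using finite_multigraded_parts[OF w] by (rule finite_subset)
  then obtain v where v: "v \<in> carrier_vec (length c')" "\<And>b. multigraded_part c' b v = u b"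
    using multigraded_vec_exists[of u c'] u(1) by blast
  have "monomial_matrix c c' \<Lambda> *\<^sub>v v = w"
  proof (rule multigraded_part_eqI)
    show "monomial_matrix c c' \<Lambda> *\<^sub>v v \<in> carrier_vec (length c)"
      by (rule carrier_vecI) (simp add: monomial_matrix_def)
    show "multigraded_part c b (monomial_matrix c c' \<Lambda> *\<^sub>v v) = multigraded_part c b w" for b
      by (simp add: multigraded_part_mult[OF \<Lambda> v(1)] v(2) u(2))
  qed (rule w)
  then show "w \<in> {monomial_matrix c c' \<Lambda> *\<^sub>v v | v. v \<in> carrier_vec (length c')}" using v(1) by blast
qed

text \<open>The data of a multigraded free resolution of \<open>R/I\<close>, where \<open>I\<close> is spanned by the monomials with
  exponents in \<open>U\<close>, in terms of scalars: in degree \<open>b\<close> the image of the first map is everything if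
  \<open>b \<in> U\<close> and zero if not, and the further images are the kernels.\<close>

definition multigraded_resolution ::
  "('n \<Rightarrow>\<^sub>0 nat) set \<Rightarrow> (nat \<Rightarrow> ('n \<Rightarrow>\<^sub>0 nat) list) \<Rightarrow> (nat \<Rightarrow> nat \<Rightarrow> nat \<Rightarrow> 'k::field) \<Rightarrow> bool" where
  "multigraded_resolution U c \<Lambda> \<longleftrightarrow> c 0 = [0] \<and>
    (\<forall>i. multigraded_map (c i) (c (Suc i)) (\<Lambda> i)) \<and>
    (\<forall>b. scalar_apply (\<Lambda> 0) (c (Suc 0)) ` supported (c (Suc 0)) b = {v \<in> supported (c 0) b. v \<noteq> 0 \<longrightarrow> b \<in> U}) \<and>
    (\<forall>i b. scalar_apply (\<Lambda> (Suc i)) (c (Suc (Suc i))) ` supported (c (Suc (Suc i))) b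
       = {v \<in> supported (c (Suc i)) b. scalar_apply (\<Lambda> i) (c (Suc i)) v = 0})"

lemma total_degree_diff: "a \<preceq> b \<Longrightarrow> int (total_degree (b - a)) = int (total_degree b) - int (total_degree a)"
  using total_degree_add[of "b - a" a] by (simp add: exponent_diff_add)

theorem graded_free_resolution_of_multigraded:
  fixes c :: "nat \<Rightarrow> ('n::finite \<Rightarrow>\<^sub>0 nat) list" and \<Lambda> :: "nat \<Rightarrow> nat \<Rightarrow> nat \<Rightarrow> 'k::field"
  assumes res: "multigraded_resolution U c \<Lambda>"
  shows "graded_free_resolution (monomial_ideal U :: ('n, 'k) mpolynomial set)
    (\<lambda>i. map (\<lambda>a. int (total_degree a)) (c i)) (\<lambda>i. monomial_matrix (c i) (c (Suc i)) (\<Lambda> i))"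
proof -
  have c0: "c 0 = [0]" and map: "\<And>i. multigraded_map (c i) (c (Suc i)) (\<Lambda> i)"
    and ex0: "\<And>b. scalar_apply (\<Lambda> 0) (c (Suc 0)) ` supported (c (Suc 0)) b = {v \<in> supported (c 0) b. v \<noteq> 0 \<longrightarrow> b \<in> U}"
    and ex: "\<And>i b. scalar_apply (\<Lambda> (Suc i)) (c (Suc (Suc i))) ` supported (c (Suc (Suc i))) b
       = {v \<in> supported (c (Suc i)) b. scalar_apply (\<Lambda> i) (c (Suc i)) v = 0}"
    using res by (simp_all add: multigraded_resolution_def)
  let ?\<phi> = "\<lambda>i. monomial_matrix (c i) (c (Suc i)) (\<Lambda> i)"
  let ?ds = "\<lambda>i. List.map (\<lambda>a. int (total_degree a)) (c i)"
  have car: "?\<phi> i \<in> carrier_mat (length (c i)) (length (c (Suc i)))" for i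
    by (simp add: monomial_matrix_def)
  have hom: "homogeneous (?ds (Suc i) ! t - ?ds i ! s) (?\<phi> i $$ (s, t))"
    if st: "s < length (c i)" "t < length (c (Suc i))" for i s t
  proof (cases "\<Lambda> i s t = 0")
    case True
    then show ?thesis using st by (simp add: monomial_matrix_def homogeneous_def)
  next
    case False
    then have "c i ! s \<preceq> c (Suc i) ! t" using map[of i] by (auto simp: multigraded_map_def)
    then show ?thesis using st by (simp add: monomial_matrix_def homogeneous_def total_degree_diff)
  qed
  have start: "{?\<phi> 0 *\<^sub>v v | v. v \<in> carrier_vec (length (c (Suc 0)))} = {w \<in> carrier_vec 1. vec_index w 0 \<in> monomial_ideal U}"
  proof (rule Set.set_eqI)
    fix w :: "('n, 'k) mpolynomial vec"
    show "w \<in> {?\<phi> 0 *\<^sub>v v | v. v \<in> carrier_vec (length (c (Suc 0)))} \<longleftrightarrow> w \<in> {w \<in> carrier_vec 1. vec_index w 0 \<in> monomial_ideal U}"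
    proof (cases "w \<in> carrier_vec 1")
      case True
      then have w: "w \<in> carrier_vec (length (c 0))" by (simp add: c0)
      have "multigraded_part (c 0) b w = 0 \<longleftrightarrow> lookup (vec_index w 0) b = 0" for b
        by (auto simp: multigraded_part_def c0 fun_eq_iff exponent_le_def)
      then have "(\<forall>b. multigraded_part (c 0) b w \<noteq> 0 \<longrightarrow> b \<in> U) \<longleftrightarrow> vec_index w 0 \<in> monomial_ideal U"
        by (auto simp: monomial_ideal_def in_keys_iff)
      then show ?thesis
        unfolding monomial_matrix_image_iff[OF map w] ex0
        using True multigraded_part_supported[of "c 0" _ w] by simp
    next
      case False
      have "?\<phi> 0 *\<^sub>v v \<in> carrier_vec 1" for v
        by (rule carrier_vecI) (simp add: monomial_matrix_def c0)
      then show ?thesis using False by auto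
    qed
  qed
  have exact: "{?\<phi> (Suc i) *\<^sub>v v | v. v \<in> carrier_vec (length (c (Suc (Suc i))))} = mat_kernel (?\<phi> i)" for i
  proof (rule Set.set_eqI)
    fix w :: "('n, 'k) mpolynomial vec"
    show "w \<in> {?\<phi> (Suc i) *\<^sub>v v | v. v \<in> carrier_vec (length (c (Suc (Suc i))))} \<longleftrightarrow> w \<in> mat_kernel (?\<phi> i)"
    proof (cases "w \<in> carrier_vec (length (c (Suc i)))")
      case True
      have "w \<in> mat_kernel (?\<phi> i) \<longleftrightarrow> ?\<phi> i *\<^sub>v w = 0\<^sub>v (length (c i))"
        using mat_kernelI[OF car True] mat_kernelD(2)[OF car] by blast
      also have "\<dots> \<longleftrightarrow> (\<forall>b. multigraded_part (c i) b (?\<phi> i *\<^sub>v w) = 0)"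
      proof
        assume "\<forall>b. multigraded_part (c i) b (?\<phi> i *\<^sub>v w) = 0"
        then show "?\<phi> i *\<^sub>v w = 0\<^sub>v (length (c i))"
          by (intro multigraded_part_eqI[where c = "c i"])
            (simp_all add: multigraded_part_zero monomial_matrix_def carrier_vecI)
      qed (simp add: multigraded_part_zero)
      also have "\<dots> \<longleftrightarrow> (\<forall>b. scalar_apply (\<Lambda> i) (c (Suc i)) (multigraded_part (c (Suc i)) b w) = 0)"
        by (simp add: multigraded_part_mult[OF map True])
      finally show ?thesis
        unfolding monomial_matrix_image_iff[OF map True] ex
        using multigraded_part_supported[of "c (Suc i)" _ w] by simp
    next
      case False
      have "?\<phi> (Suc i) *\<^sub>v v \<in> carrier_vec (length (c (Suc i)))" for v
        by (rule carrier_vecI) (simp add: monomial_matrix_def)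
      then show ?thesis using False mat_kernelD(1)[OF car] by auto
    qed
  qed
  show ?thesis
    unfolding graded_free_resolution_def
    using car hom start exact c0 by (simp add: total_degree_def)
qed

theorem minimal_resolution_of_multigraded:
  fixes c :: "nat \<Rightarrow> ('n::finite \<Rightarrow>\<^sub>0 nat) list" and \<Lambda> :: "nat \<Rightarrow> nat \<Rightarrow> nat \<Rightarrow> 'k::field"
  assumes res: "multigraded_resolution U c \<Lambda>"
    and min: "\<And>i s t. \<Lambda> i s t \<noteq> 0 \<Longrightarrow> c i ! s \<noteq> c (Suc i) ! t"
  shows "minimal_graded_free_resolution (monomial_ideal U :: ('n, 'k) mpolynomial set)
    (\<lambda>i. map (\<lambda>a. int (total_degree a)) (c i)) (\<lambda>i. monomial_matrix (c i) (c (Suc i)) (\<Lambda> i))"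
proof -
  have "monomial_matrix (c i) (c (Suc i)) (\<Lambda> i) $$ (s, t) \<in> graded_maximal_ideal"
    if st: "s < length (c i)" "t < length (c (Suc i))" for i s t
  proof (cases "\<Lambda> i s t = 0")
    case True
    then show ?thesis using st by (simp add: monomial_matrix_def graded_maximal_ideal_eq monomial_ideal_def)
  next
    case False
    have "c i ! s \<preceq> c (Suc i) ! t" using res False by (auto simp: multigraded_resolution_def multigraded_map_def)
    then have "c (Suc i) ! t - c i ! s \<noteq> 0" using min[OF False] exponent_diff_add[of "c i ! s" "c (Suc i) ! t"] by auto
    then show ?thesis using st by (simp add: monomial_matrix_def graded_maximal_ideal_eq monomial_ideal_def)
  qed
  then show ?thesis
    using graded_free_resolution_of_multigraded[OF res] by (simp add: minimal_graded_free_resolution_iff)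
qed

section \<open>Multigraded minimal free resolutions exist\<close>

interpretation scalar_functions: Vector_Spaces.vector_space "\<lambda>(c :: 'k::field) (f :: nat \<Rightarrow> 'k) t. c * f t"
  by unfold_locales (simp_all add: fun_eq_iff algebra_simps)

declare scalar_functions.scale_scale [simp del]

lemma sum_fun_apply: "(sum f A :: 'a \<Rightarrow> 'b::comm_monoid_add) t = (\<Sum>a\<in>A. f a t)"
  by (induction A rule: infinite_finite_induct) auto

text \<open>A basis of a space of vectors of length \<open>N\<close> relative to the span of a subset \<open>W\<close>. It will be used
  with \<open>V\<close> as the part of degree \<open>b\<close> of a multigraded module and \<open>W\<close> as what comes from smaller
  degrees, so that it consists of the minimal generators of degree \<open>b\<close>.\<close>

lemma relative_basis_exists:
  fixes V W :: "(nat \<Rightarrow> 'k::field) set"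
  assumes WV: "W \<subseteq> V" and bound: "\<And>u t. u \<in> V \<Longrightarrow> u t \<noteq> 0 \<Longrightarrow> t < N"
  shows "\<exists>G. finite G \<and> G \<subseteq> V \<and> V \<subseteq> scalar_functions.span (W \<union> G) \<and>
    (\<forall>r. (\<lambda>t. \<Sum>g\<in>G. r g * g t) \<in> scalar_functions.span W \<longrightarrow> (\<forall>g\<in>G. r g = 0))"
proof -
  obtain B0 where "{} \<subseteq> B0" and B0: "B0 \<subseteq> W" "\<not> scalar_functions.dependent B0" "W \<subseteq> scalar_functions.span B0"
    by (rule scalar_functions.maximal_independent_subset_extend[OF empty_subsetI scalar_functions.independent_empty])
  have "B0 \<subseteq> V" using B0(1) WV by blast
  obtain B1 where B1: "B0 \<subseteq> B1" "B1 \<subseteq> V" "\<not> scalar_functions.dependent B1" "V \<subseteq> scalar_functions.span B1"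
    by (rule scalar_functions.maximal_independent_subset_extend[OF \<open>B0 \<subseteq> V\<close> B0(2)])
  define e where "e = (\<lambda>(i::nat) t. if t = i then 1 else (0::'k))"
  have "V \<subseteq> scalar_functions.span (e ` {..<N})"
  proof
    fix u assume u: "u \<in> V"
    have "u = (\<Sum>i<N. (\<lambda>t. u i * e i t))"
    proof
      fix t
      have "(\<Sum>i<N. u i * e i t) = (\<Sum>i<N. if t = i then u i else 0)"
        by (rule sum.cong) (simp_all add: e_def)
      then show "u t = (\<Sum>i<N. (\<lambda>t. u i * e i t)) t"
        using bound[OF u, of t] by (auto simp: sum_fun_apply)
    qed
    also have "\<dots> \<in> scalar_functions.span (e ` {..<N})"
      by (intro scalar_functions.span_sum scalar_functions.span_scale scalar_functions.span_base) simp
    finally show "u \<in> scalar_functions.span (e ` {..<N})" .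
  qed
  then have fin: "finite B1"
    using scalar_functions.independent_span_bound[of "e ` {..<N}" B1] B1 by blast
  define G where "G = B1 - B0"
  have "B1 \<subseteq> W \<union> G" using B0(1) by (auto simp: G_def)
  then have "V \<subseteq> scalar_functions.span (W \<union> G)"
    using B1(4) scalar_functions.span_mono by blast
  moreover have "r g = 0" if r: "(\<lambda>t. \<Sum>g\<in>G. r g * g t) \<in> scalar_functions.span W" and g: "g \<in> G" for r g
  proof -
    have "scalar_functions.span W \<subseteq> scalar_functions.span B0"
      by (rule scalar_functions.span_minimal[OF B0(3) scalar_functions.subspace_span])
    then have "(\<lambda>t. \<Sum>g\<in>G. r g * g t) \<in> scalar_functions.span B0" using r by blast
    moreover have fin0: "finite B0" using fin B1(1) by (rule rev_finite_subset)
    ultimately obtain q where q: "(\<lambda>t. \<Sum>g\<in>G. r g * g t) = (\<Sum>v\<in>B0. (\<lambda>t. q v * v t))"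
      unfolding scalar_functions.span_finite[OF fin0] by auto
    define z where "z = (\<lambda>v. if v \<in> G then r v else - q v)"
    have un: "B1 = G \<union> B0" "G \<inter> B0 = {}" "finite G" using B1(1) fin by (auto simp: G_def)
    have "(\<Sum>v\<in>B1. (\<lambda>t. z v * v t)) = 0"
    proof
      fix t
      have "(\<Sum>v\<in>B1. (\<lambda>t. z v * v t)) t = (\<Sum>v\<in>G. z v * v t) + (\<Sum>v\<in>B0. z v * v t)"
        by (simp add: sum_fun_apply un(1) sum.union_disjoint[OF un(3) fin0 un(2)])
      also have "(\<Sum>v\<in>G. z v * v t) = (\<Sum>v\<in>G. r v * v t)"
        by (rule sum.cong) (simp_all add: z_def)
      also have "(\<Sum>v\<in>B0. z v * v t) = (\<Sum>v\<in>B0. - (q v * v t))"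
        by (rule sum.cong) (use un(2) in \<open>auto simp: z_def\<close>)
      also have "\<dots> = - (\<Sum>g\<in>G. r g * g t)"
        using fun_cong[OF q, of t] by (simp add: sum_fun_apply sum_negf)
      finally show "(\<Sum>v\<in>B1. (\<lambda>t. z v * v t)) t = 0 t" by simp
    qed
    then have "z g = 0"
      using scalar_functions.independentD[OF B1(3) fin order_refl, of z g] g un(1) by blast
    then show ?thesis using g by (simp add: z_def)
  qed
  moreover have "finite G" "G \<subseteq> V" using fin B1(2) by (auto simp: G_def)
  ultimately show ?thesis by blast
qed

definition exponent_meet :: "('n \<Rightarrow>\<^sub>0 nat) \<Rightarrow> ('n \<Rightarrow>\<^sub>0 nat) \<Rightarrow> 'n \<Rightarrow>\<^sub>0 nat" where
  "exponent_meet a b = Poly_Mapping.mapp (\<lambda>i x. min x (lookup b i)) a"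

lemma lookup_exponent_meet:
  "lookup (exponent_meet a b) i = min (lookup a i) (lookup b i)"
  by (auto simp: exponent_meet_def lookup_mapp when_def in_keys_iff)

lemma exponent_le_meet: "a \<preceq> exponent_meet b c \<longleftrightarrow> a \<preceq> b \<and> a \<preceq> c"
  by (auto simp: exponent_le_def lookup_exponent_meet)

lemma finite_exponents_below: "finite {b :: 'n::finite \<Rightarrow>\<^sub>0 nat. b \<preceq> B}"
proof -
  have "finite (\<Pi>\<^sub>E i\<in>UNIV. {..lookup B i})"
    by (rule finite_PiE) auto
  then have "finite (lookup ` {b :: 'n \<Rightarrow>\<^sub>0 nat. b \<preceq> B})"
    by (rule rev_finite_subset) (auto simp: exponent_le_def PiE_def)
  then show ?thesis by (rule finite_imageD) (rule inj_onI, simp only: poly_mapping_eq_iff)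
qed

lemma total_degree_mono: "a \<preceq> b \<Longrightarrow> total_degree a \<le> total_degree b"
  unfolding total_degree_def exponent_le_def by (intro sum_mono) simp

lemma total_degree_strict_mono:
  assumes "a \<preceq> b" "a \<noteq> b"
  shows "total_degree a < total_degree b"
proof -
  obtain i where "lookup a i \<noteq> lookup b i" using assms(2) poly_mapping_eqI by metis
  then have "lookup a i < lookup b i" using assms(1) by (auto simp: exponent_le_def order_less_le)
  then show ?thesis
    unfolding total_degree_def using assms(1) by (intro sum_strict_mono_ex1) (auto simp: exponent_le_def)
qed

text \<open>A multigraded submodule \<open>V\<close> of a free module with basis degrees \<open>c\<close>, in the form in which it is
  met in the construction of a minimal resolution. It is contained in the graded maximal ideal times
  the free module: an element of degree \<open>b\<close> involves no basis element of the same degree. Moreover it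
  is determined by its parts in the finitely many degrees dividing \<open>B\<close>, and this replaces the appeal
  to Noetherian modules in showing that it is finitely generated.\<close>

definition syzygy_stage ::
  "('n::finite \<Rightarrow>\<^sub>0 nat) \<Rightarrow> ('n \<Rightarrow>\<^sub>0 nat) list \<Rightarrow> (('n \<Rightarrow>\<^sub>0 nat) \<Rightarrow> (nat \<Rightarrow> 'k::field) set) \<Rightarrow> bool" where
  "syzygy_stage B c V \<longleftrightarrow>
     (\<forall>b. scalar_functions.subspace (V b)) \<and> (\<forall>b. V b \<subseteq> supported c b) \<and>
     (\<forall>b u t. u \<in> V b \<longrightarrow> u t \<noteq> 0 \<longrightarrow> c ! t \<noteq> b) \<and>
     (\<forall>b b'. b \<preceq> b' \<longrightarrow> V b \<subseteq> V b') \<and> (\<forall>b. V b = V (exponent_meet b B))"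

lemma supported_subspace: "scalar_functions.subspace (supported c b :: (nat \<Rightarrow> 'k::field) set)"
proof (rule scalar_functions.subspaceI)
  fix u v :: "nat \<Rightarrow> 'k" assume uv: "u \<in> supported c b" "v \<in> supported c b"
  have "u t \<noteq> 0 \<or> v t \<noteq> 0" if "(u + v) t \<noteq> 0" for t using that by auto
  then show "u + v \<in> supported c b" using uv unfolding supported_def by blast
qed (auto simp: supported_def)

lemma supported_mono: "b \<preceq> b' \<Longrightarrow> supported c b \<subseteq> supported c b'"
  unfolding supported_def using exponent_le_trans by blast

lemma scalar_apply_add: "scalar_apply \<Lambda> c (u + v) = scalar_apply \<Lambda> c u + scalar_apply \<Lambda> c v"
  by (rule ext) (simp add: scalar_apply_def algebra_simps sum.distrib)

lemma scalar_apply_scale: "scalar_apply \<Lambda> c (\<lambda>t. r * u t) = (\<lambda>s. r * scalar_apply \<Lambda> c u s)"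
  by (rule ext) (simp add: scalar_apply_def sum_distrib_left mult.left_commute)

lemma scalar_apply_zero: "scalar_apply \<Lambda> c 0 = 0"
  by (rule ext) (simp add: scalar_apply_def)

lemma scalar_apply_image_subspace: "scalar_functions.subspace (scalar_apply \<Lambda> c ` supported c b)"
proof (rule scalar_functions.subspaceI)
  have "0 \<in> supported c b" by (simp add: supported_def)
  then show "0 \<in> scalar_apply \<Lambda> c ` supported c b"
    by (intro image_eqI[of _ _ 0]) (simp_all add: scalar_apply_zero)
next
  fix x y assume "x \<in> scalar_apply \<Lambda> c ` supported c b" "y \<in> scalar_apply \<Lambda> c ` supported c b"
  then obtain u v where "u \<in> supported c b" "v \<in> supported c b" "x = scalar_apply \<Lambda> c u" "y = scalar_apply \<Lambda> c v" by blast
  then show "x + y \<in> scalar_apply \<Lambda> c ` supported c b"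
    by (intro image_eqI[of _ _ "u + v"] scalar_functions.subspace_add[OF supported_subspace]) (simp_all add: scalar_apply_add)
next
  fix r x assume "x \<in> scalar_apply \<Lambda> c ` supported c b"
  then obtain u where "u \<in> supported c b" "x = scalar_apply \<Lambda> c u" by blast
  then show "(\<lambda>t. r * x t) \<in> scalar_apply \<Lambda> c ` supported c b"
    by (intro image_eqI[of _ _ "\<lambda>t. r * u t"] scalar_functions.subspace_scale[OF supported_subspace]) (simp_all add: scalar_apply_scale)
qed

lemma scalar_apply_kernel_subspace:
  "scalar_functions.subspace {u \<in> supported c b. scalar_apply \<Lambda> c u = 0}"
proof (rule scalar_functions.subspaceI)
  show "0 \<in> {u \<in> supported c b. scalar_apply \<Lambda> c u = 0}"
    by (simp add: scalar_apply_zero supported_def)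
next
  fix u v assume "u \<in> {u \<in> supported c b. scalar_apply \<Lambda> c u = 0}" "v \<in> {u \<in> supported c b. scalar_apply \<Lambda> c u = 0}"
  then show "u + v \<in> {u \<in> supported c b. scalar_apply \<Lambda> c u = 0}"
    by (simp add: scalar_apply_add scalar_functions.subspace_add[OF supported_subspace])
next
  fix r u assume "u \<in> {u \<in> supported c b. scalar_apply \<Lambda> c u = 0}"
  then show "(\<lambda>t. r * u t) \<in> {u \<in> supported c b. scalar_apply \<Lambda> c u = 0}"
    by (simp add: scalar_apply_scale fun_eq_iff scalar_functions.subspace_scale[OF supported_subspace])
qed

text \<open>One step of the resolution. Choose in each degree dividing \<open>B\<close> a basis \<open>G b\<close> of \<open>V b\<close> relative to the
  span \<open>W b\<close> of the parts of smaller degree. All these vectors together are the columns of the new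
  matrix. They generate \<open>V\<close> by induction on the degree. If a relation of degree \<open>b\<close> between them
  involved a generator of degree \<open>b\<close>, then the generators of that degree would be dependent modulo \<open>W b\<close>;
  so the module of relations is again of the same kind, with the same bound \<open>B\<close>.\<close>

lemma syzygy_stage_step:
  fixes V :: "('n::finite \<Rightarrow>\<^sub>0 nat) \<Rightarrow> (nat \<Rightarrow> 'k::field) set"
  assumes stage: "syzygy_stage B c V"
  shows "\<exists>c' \<Lambda>. multigraded_map c c' \<Lambda> \<and> (\<forall>s t. \<Lambda> s t \<noteq> 0 \<longrightarrow> c ! s \<noteq> c' ! t) \<and>
    (\<forall>b. scalar_apply \<Lambda> c' ` supported c' b = V b) \<and>
    syzygy_stage B c' (\<lambda>b. {u \<in> supported c' b. scalar_apply \<Lambda> c' u = 0})"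
proof -
  note st = stage[unfolded syzygy_stage_def]
  have sub: "scalar_functions.subspace (V b)" for b
    using st[THEN conjunct1] by (rule spec)
  have sup: "V b \<subseteq> supported c b" for b
    using st[THEN conjunct2, THEN conjunct1] by (rule spec)
  have ne: "c ! t \<noteq> b" if "u \<in> V b" "u t \<noteq> 0" for b u t
    using st[THEN conjunct2, THEN conjunct2, THEN conjunct1] that by blast
  have mono: "V b \<subseteq> V b'" if "b \<preceq> b'" for b b'
    using st[THEN conjunct2, THEN conjunct2, THEN conjunct2, THEN conjunct1] that by blast
  have box: "V b = V (exponent_meet b B)" for b
    using st[THEN conjunct2, THEN conjunct2, THEN conjunct2, THEN conjunct2] by (rule spec)
  define W where "W = (\<lambda>b. \<Union>b'\<in>{b'. b' \<preceq> b \<and> b' \<noteq> b}. V b')"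
  have "\<forall>b. \<exists>G. finite G \<and> G \<subseteq> V b \<and> V b \<subseteq> scalar_functions.span (W b \<union> G) \<and>
    (\<forall>r. (\<lambda>t. \<Sum>g\<in>G. r g * g t) \<in> scalar_functions.span (W b) \<longrightarrow> (\<forall>g\<in>G. r g = 0))"
  proof
    fix b
    have "W b \<subseteq> V b" unfolding W_def using mono by auto
    then show "\<exists>G. finite G \<and> G \<subseteq> V b \<and> V b \<subseteq> scalar_functions.span (W b \<union> G) \<and>
      (\<forall>r. (\<lambda>t. \<Sum>g\<in>G. r g * g t) \<in> scalar_functions.span (W b) \<longrightarrow> (\<forall>g\<in>G. r g = 0))"
      using relative_basis_exists[of "W b" "V b" "length c"] sup[of b] by (auto simp: supported_def)
  qed
  from choice[OF this] obtain G where G0: "\<forall>b. finite (G b) \<and> G b \<subseteq> V b \<and>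
    V b \<subseteq> scalar_functions.span (W b \<union> G b) \<and>
    (\<forall>r. (\<lambda>t. \<Sum>g\<in>G b. r g * g t) \<in> scalar_functions.span (W b) \<longrightarrow> (\<forall>g\<in>G b. r g = 0))" ..
  have G: "finite (G b)" "G b \<subseteq> V b" "V b \<subseteq> scalar_functions.span (W b \<union> G b)" for b
    using G0[rule_format, of b] by simp_all
  have G_indep: "r g = 0"
    if "(\<lambda>t. \<Sum>g\<in>G b. r g * g t) \<in> scalar_functions.span (W b)" "g \<in> G b" for b r g
    using G0[THEN spec, of b, THEN conjunct2, THEN conjunct2, THEN conjunct2, THEN spec, THEN mp, OF that(1)]
      that(2) by blast
  have "finite (Sigma {b. b \<preceq> B} G)" using finite_exponents_below G(1) by (rule finite_SigmaI)
  then obtain gs where gs: "set gs = Sigma {b. b \<preceq> B} G" "distinct gs" using finite_distinct_list by blast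
  define c' where "c' = map fst gs"
  define \<Lambda> where "\<Lambda> = (\<lambda>s t. if t < length gs then snd (gs ! t) s else 0)"
  have len: "length c' = length gs" by (simp add: c'_def)
  have nth: "c' ! t \<preceq> B" "snd (gs ! t) \<in> G (c' ! t)" "snd (gs ! t) \<in> V (c' ! t)" if "t < length gs" for t
  proof -
    have "gs ! t \<in> Sigma {b. b \<preceq> B} G" using nth_mem[OF that] by (simp add: gs(1))
    then show "c' ! t \<preceq> B" "snd (gs ! t) \<in> G (c' ! t)" "snd (gs ! t) \<in> V (c' ! t)"
      using subsetD[OF G(2)] that by (auto simp: c'_def)
  qed
  have apply_eq: "scalar_apply \<Lambda> c' u = (\<Sum>t<length gs. (\<lambda>s. u t * snd (gs ! t) s))" for u
    by (rule ext) (auto simp: scalar_apply_def len \<Lambda>_def sum_fun_apply mult.commute intro!: sum.cong)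
  have \<Lambda>: "t < length gs" "s < length c" "c ! s \<preceq> c' ! t" "c ! s \<noteq> c' ! t" if "\<Lambda> s t \<noteq> 0" for s t
  proof -
    show t: "t < length gs" using that by (auto simp: \<Lambda>_def split: if_splits)
    then have "snd (gs ! t) s \<noteq> 0" using that by (simp add: \<Lambda>_def)
    then show "s < length c" "c ! s \<preceq> c' ! t" "c ! s \<noteq> c' ! t"
      using nth(3)[OF t] sup[of "c' ! t"] ne[OF nth(3)[OF t]] by (auto simp: supported_def)
  qed
  have img_sub: "scalar_apply \<Lambda> c' ` supported c' b \<subseteq> V b" for b
  proof
    fix x assume "x \<in> scalar_apply \<Lambda> c' ` supported c' b"
    then obtain u where u: "u \<in> supported c' b" "x = scalar_apply \<Lambda> c' u" by blast
    show "x \<in> V b"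
      unfolding u(2) apply_eq
    proof (rule scalar_functions.subspace_sum[OF sub])
      fix t assume t: "t \<in> {..<length gs}"
      show "(\<lambda>s. u t * snd (gs ! t) s) \<in> V b"
      proof (cases "u t = 0")
        case True
        then show ?thesis using scalar_functions.subspace_0[OF sub] by (simp add: zero_fun_def)
      next
        case False
        then have "c' ! t \<preceq> b" using u(1) by (auto simp: supported_def)
        then have "snd (gs ! t) \<in> V b" using nth(3)[of t] t mono by blast
        then show ?thesis by (rule scalar_functions.subspace_scale[OF sub])
      qed
    qed
  qed
  have img_mono: "scalar_apply \<Lambda> c' ` supported c' b' \<subseteq> scalar_apply \<Lambda> c' ` supported c' b" if "b' \<preceq> b" for b b'
    using supported_mono[OF that] by (rule image_mono)
  have img_box: "V b \<subseteq> scalar_apply \<Lambda> c' ` supported c' b" if "b \<preceq> B" for b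
    using that
  proof (induction "total_degree b" arbitrary: b rule: less_induct)
    case less
    have "W b \<subseteq> scalar_apply \<Lambda> c' ` supported c' b"
    proof
      fix x assume "x \<in> W b"
      then obtain b' where b': "b' \<preceq> b" "b' \<noteq> b" "x \<in> V b'" unfolding W_def by blast
      then have "V b' \<subseteq> scalar_apply \<Lambda> c' ` supported c' b'"
        using less.hyps[OF total_degree_strict_mono[OF b'(1,2)]] exponent_le_trans less.prems by blast
      then show "x \<in> scalar_apply \<Lambda> c' ` supported c' b" using b'(3) img_mono[OF b'(1)] by blast
    qed
    moreover have "G b \<subseteq> scalar_apply \<Lambda> c' ` supported c' b"
    proof
      fix g assume g: "g \<in> G b"
      then have "(b, g) \<in> set gs" using less.prems by (simp add: gs(1))
      then obtain t where t: "t < length gs" "gs ! t = (b, g)" by (auto simp: in_set_conv_nth)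
      define u where "u = (\<lambda>r. if r = t then 1 else (0::'k))"
      have "u \<in> supported c' b" using t by (auto simp: supported_def u_def c'_def)
      moreover have "g = scalar_apply \<Lambda> c' u"
      proof
        fix s
        have "scalar_apply \<Lambda> c' u s = (\<Sum>r<length gs. if r = t then snd (gs ! r) s else 0)"
          unfolding apply_eq sum_fun_apply by (rule sum.cong) (simp_all add: u_def)
        then show "g s = scalar_apply \<Lambda> c' u s" using t by simp
      qed
      ultimately show "g \<in> scalar_apply \<Lambda> c' ` supported c' b" by blast
    qed
    ultimately have "scalar_functions.span (W b \<union> G b) \<subseteq> scalar_apply \<Lambda> c' ` supported c' b"
      by (intro scalar_functions.span_minimal scalar_apply_image_subspace) blast
    then show ?case using G(3) by blast
  qed
  have img: "scalar_apply \<Lambda> c' ` supported c' b = V b" for b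
  proof
    have "V (exponent_meet b B) \<subseteq> scalar_apply \<Lambda> c' ` supported c' (exponent_meet b B)"
      using exponent_le_meet[of "exponent_meet b B" b B] by (intro img_box) simp
    also have "\<dots> \<subseteq> scalar_apply \<Lambda> c' ` supported c' b"
      using exponent_le_meet[of "exponent_meet b B" b B] by (intro img_mono) simp
    finally show "V b \<subseteq> scalar_apply \<Lambda> c' ` supported c' b" by (simp add: box[of b])
  qed (rule img_sub)
  have minimal: "c' ! t0 \<noteq> b" if u: "u \<in> supported c' b" "scalar_apply \<Lambda> c' u = 0" "u t0 \<noteq> 0" for u b t0
  proof
    assume b: "c' ! t0 = b"
    have t0: "t0 < length gs" using u(1,3) by (auto simp: supported_def len)
    then have "b \<preceq> B" using nth(1) b by blast
    define T where "T = {t. t < length gs \<and> c' ! t = b}"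
    define f where "f = (\<lambda>t. snd (gs ! t))"
    have gsT: "gs ! t = (b, f t)" if "t \<in> T" for t
      using that by (auto simp: T_def c'_def f_def)
    have inj: "inj_on f T"
    proof (rule inj_onI)
      fix t t' assume "t \<in> T" "t' \<in> T" "f t = f t'"
      then have "gs ! t = gs ! t'" using gsT by simp
      then show "t = t'" using \<open>t \<in> T\<close> \<open>t' \<in> T\<close> nth_eq_iff_index_eq[OF gs(2)] by (simp add: T_def)
    qed
    have onto: "f ` T = G b"
    proof
      show "f ` T \<subseteq> G b" using nth(2) by (auto simp: T_def f_def)
      show "G b \<subseteq> f ` T"
      proof
        fix g assume "g \<in> G b"
        then have "(b, g) \<in> set gs" using \<open>b \<preceq> B\<close> by (simp add: gs(1))
        then obtain t where "t < length gs" "gs ! t = (b, g)" by (auto simp: in_set_conv_nth)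
        then show "g \<in> f ` T" by (intro image_eqI[of _ _ t]) (auto simp: T_def f_def c'_def)
      qed
    qed
    define r where "r = (\<lambda>g. u (the_inv_into T f g))"
    have rf: "r (f t) = u t" if "t \<in> T" for t
      using the_inv_into_f_f[OF inj that] by (simp add: r_def)
    have split: "{..<length gs} = T \<union> ({..<length gs} - T)" "T \<subseteq> {..<length gs}" by (auto simp: T_def)
    have "(\<lambda>s. \<Sum>g\<in>G b. r g * g s) = - (\<Sum>t\<in>{..<length gs} - T. (\<lambda>s. u t * f t s))"
    proof
      fix s
      have "(\<Sum>g\<in>G b. r g * g s) = (\<Sum>t\<in>T. u t * f t s)"
        unfolding onto[symmetric] by (simp add: sum.reindex[OF inj] rf)
      moreover have "(\<Sum>t<length gs. u t * f t s) = 0"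
        using fun_cong[OF u(2), of s] by (simp add: apply_eq sum_fun_apply f_def)
      moreover have "(\<Sum>t<length gs. u t * f t s) = (\<Sum>t\<in>{..<length gs} - T. u t * f t s) + (\<Sum>t\<in>T. u t * f t s)"
        by (rule sum.subset_diff[OF split(2)]) simp
      ultimately show "(\<Sum>g\<in>G b. r g * g s) = (- (\<Sum>t\<in>{..<length gs} - T. (\<lambda>s. u t * f t s))) s"
        by (simp add: sum_fun_apply eq_neg_iff_add_eq_0 add.commute)
    qed
    also have "\<dots> \<in> scalar_functions.span (W b)"
    proof (intro scalar_functions.span_neg scalar_functions.span_sum)
      fix t assume t: "t \<in> {..<length gs} - T"
      show "(\<lambda>s. u t * f t s) \<in> scalar_functions.span (W b)"
      proof (cases "u t = 0")
        case True
        then show ?thesis using scalar_functions.span_zero[of "W b"] by (simp add: zero_fun_def)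
      next
        case False
        then have "c' ! t \<preceq> b" "c' ! t \<noteq> b" using u(1) t by (auto simp: supported_def T_def)
        then have "f t \<in> W b" unfolding W_def f_def using nth(3)[of t] t by auto
        then show ?thesis by (intro scalar_functions.span_scale scalar_functions.span_base)
      qed
    qed
    finally have "r (f t0) = 0"
      using G_indep[of r b "f t0"] onto t0 b by (auto simp: T_def)
    then show False using rf[of t0] t0 b u(3) by (simp add: T_def)
  qed
  have box': "supported c' b = (supported c' (exponent_meet b B) :: (nat \<Rightarrow> 'k) set)" for b
    using nth(1) by (auto simp: supported_def exponent_le_meet len)
  have "syzygy_stage B c' (\<lambda>b. {u \<in> supported c' b. scalar_apply \<Lambda> c' u = 0})"
    unfolding syzygy_stage_def
  proof (intro conjI allI impI)
    show "scalar_functions.subspace {u \<in> supported c' b. scalar_apply \<Lambda> c' u = 0}" for b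
      by (rule scalar_apply_kernel_subspace)
    show "{u \<in> supported c' b. scalar_apply \<Lambda> c' u = 0} \<subseteq> supported c' b" for b by blast
    show "c' ! t \<noteq> b" if "u \<in> {u \<in> supported c' b. scalar_apply \<Lambda> c' u = 0}" "u t \<noteq> 0" for b u t
      using minimal that by blast
    show "{u \<in> supported c' b. scalar_apply \<Lambda> c' u = 0} \<subseteq> {u \<in> supported c' b'. scalar_apply \<Lambda> c' u = 0}"
      if "b \<preceq> b'" for b b' using supported_mono[OF that] by blast
    show "{u \<in> supported c' b. scalar_apply \<Lambda> c' u = 0} = {u \<in> supported c' (exponent_meet b B). scalar_apply \<Lambda> c' u = 0}" for b
      using box'[of b] by simp
  qed
  moreover have "multigraded_map c c' \<Lambda>" using \<Lambda> by (simp add: multigraded_map_def len)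
  ultimately show ?thesis using \<Lambda>(4) img by blast
qed

text \<open>Iterate the previous step, starting from the ideal itself as a submodule of \<open>R\<close>. The vector \<open>B\<close>
  bounds the exponents of the minimal generators of the ideal.\<close>

theorem multigraded_minimal_resolution_exists:
  fixes U :: "('n::finite \<Rightarrow>\<^sub>0 nat) set"
  assumes up: "upward_closed U" and proper: "0 \<notin> U" and box: "\<And>b. b \<in> U \<longleftrightarrow> exponent_meet b B \<in> U"
  shows "\<exists>c (\<Lambda> :: nat \<Rightarrow> nat \<Rightarrow> nat \<Rightarrow> 'k::field). multigraded_resolution U c \<Lambda> \<and>
    (\<forall>i s t. \<Lambda> i s t \<noteq> 0 \<longrightarrow> c i ! s \<noteq> c (Suc i) ! t)"
proof -
  define V0 where "V0 = (\<lambda>b. {v \<in> supported [0 :: 'n \<Rightarrow>\<^sub>0 nat] b. v \<noteq> (0 :: nat \<Rightarrow> 'k) \<longrightarrow> b \<in> U})"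
  have zero_le: "0 \<preceq> b" for b :: "'n \<Rightarrow>\<^sub>0 nat" by (simp add: exponent_le_def)
  have up': "b' \<in> U" if "b \<in> U" "b \<preceq> b'" for b b'
  proof -
    have "b' = b + (b' - b)" using exponent_diff_add[OF that(2)] by (simp add: add.commute)
    then show ?thesis using up that(1) unfolding upward_closed_def by metis
  qed
  have supp0: "supported [0 :: 'n \<Rightarrow>\<^sub>0 nat] b = (supported [0] b' :: (nat \<Rightarrow> 'k) set)"
    for b b' :: "'n \<Rightarrow>\<^sub>0 nat"
    by (auto simp: supported_def zero_le nth_Cons')
  have stage0: "syzygy_stage B [0] V0"
    unfolding syzygy_stage_def
  proof (intro conjI allI impI)
    show "scalar_functions.subspace (V0 b)" for b
    proof (cases "b \<in> U")
      case True
      then have "V0 b = supported [0] b" by (auto simp: V0_def)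
      then show ?thesis by (simp only: supported_subspace)
    next
      case False
      then have "V0 b = {0}" by (auto simp: V0_def supported_def)
      then show ?thesis by (simp only: scalar_functions.subspace_single_0)
    qed
    show "V0 b \<subseteq> supported [0] b" for b by (auto simp: V0_def)
    show "[0] ! t \<noteq> b" if "u \<in> V0 b" "u t \<noteq> 0" for b u t
    proof -
      have "u \<noteq> 0" using that(2) by auto
      then have "b \<in> U" "t < length [0 :: 'n \<Rightarrow>\<^sub>0 nat]" using that by (auto simp: V0_def supported_def)
      then show ?thesis using proper by auto
    qed
    show "V0 b \<subseteq> V0 b'" if "b \<preceq> b'" for b b'
      using supported_mono[OF that, of "[0]"] up' that unfolding V0_def by blast
    show "V0 b = V0 (exponent_meet b B)" for b
      using box[of b] supp0[of b "exponent_meet b B"] by (simp add: V0_def)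
  qed
  define P where "P = (\<lambda>(n::nat) (x :: ('n \<Rightarrow>\<^sub>0 nat) list \<times> (('n \<Rightarrow>\<^sub>0 nat) \<Rightarrow> (nat \<Rightarrow> 'k) set) \<times> (nat \<Rightarrow> nat \<Rightarrow> 'k)).
     syzygy_stage B (fst x) (fst (snd x)) \<and> (n = 0 \<longrightarrow> fst x = [0] \<and> fst (snd x) = V0))"
  define Q where "Q = (\<lambda>(n::nat) (x :: ('n \<Rightarrow>\<^sub>0 nat) list \<times> (('n \<Rightarrow>\<^sub>0 nat) \<Rightarrow> (nat \<Rightarrow> 'k) set) \<times> (nat \<Rightarrow> nat \<Rightarrow> 'k))
     (y :: ('n \<Rightarrow>\<^sub>0 nat) list \<times> (('n \<Rightarrow>\<^sub>0 nat) \<Rightarrow> (nat \<Rightarrow> 'k) set) \<times> (nat \<Rightarrow> nat \<Rightarrow> 'k)).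
     multigraded_map (fst x) (fst y) (snd (snd y)) \<and>
     (\<forall>s t. snd (snd y) s t \<noteq> 0 \<longrightarrow> fst x ! s \<noteq> fst y ! t) \<and>
     (\<forall>b. scalar_apply (snd (snd y)) (fst y) ` supported (fst y) b = fst (snd x) b) \<and>
     fst (snd y) = (\<lambda>b. {u \<in> supported (fst y) b. scalar_apply (snd (snd y)) (fst y) u = 0}))"
  (* A state holds the degrees and the module of the stage and the scalars of the map into the
     preceding stage; there is none before the first stage, so its scalars are arbitrary. *)
  have "\<exists>x. P 0 x"
    by (intro exI[of _ "([0], V0, \<lambda>_ _. 0)"]) (simp add: P_def stage0)
  moreover have "\<exists>y. P (Suc n) y \<and> Q n x y" if "P n x" for n x
  proof -
    have "syzygy_stage B (fst x) (fst (snd x))" using that by (simp add: P_def)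
    then obtain c' \<Lambda> where *: "multigraded_map (fst x) c' \<Lambda>" "\<forall>s t. \<Lambda> s t \<noteq> 0 \<longrightarrow> fst x ! s \<noteq> c' ! t"
      "\<forall>b. scalar_apply \<Lambda> c' ` supported c' b = fst (snd x) b"
      "syzygy_stage B c' (\<lambda>b. {u \<in> supported c' b. scalar_apply \<Lambda> c' u = 0})"
      using syzygy_stage_step by blast
    show ?thesis
      by (intro exI[of _ "(c', (\<lambda>b. {u \<in> supported c' b. scalar_apply \<Lambda> c' u = 0}), \<Lambda>)"])
        (use * in \<open>simp add: P_def Q_def\<close>)
  qed
  ultimately have "\<exists>f. \<forall>n. P n (f n) \<and> Q n (f n) (f (Suc n))"
    by (rule dependent_nat_choice)
  then obtain f where f: "\<And>n. P n (f n)" "\<And>n. Q n (f n) (f (Suc n))" by blast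
  define c where "c = (\<lambda>i. fst (f i))"
  define \<Lambda> where "\<Lambda> = (\<lambda>i. snd (snd (f (Suc i))))"
  have f0: "fst (f 0) = [0]" "fst (snd (f 0)) = V0" using f(1)[of 0] by (simp_all add: P_def)
  have step: "multigraded_map (c i) (c (Suc i)) (\<Lambda> i)"
    "\<And>s t. \<Lambda> i s t \<noteq> 0 \<Longrightarrow> c i ! s \<noteq> c (Suc i) ! t"
    "\<And>b. scalar_apply (\<Lambda> i) (c (Suc i)) ` supported (c (Suc i)) b = fst (snd (f i)) b"
    "fst (snd (f (Suc i))) = (\<lambda>b. {u \<in> supported (c (Suc i)) b. scalar_apply (\<Lambda> i) (c (Suc i)) u = 0})" for i
    using f(2)[of i] by (simp_all add: Q_def c_def \<Lambda>_def)
  have "multigraded_resolution U c \<Lambda>"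
    unfolding multigraded_resolution_def
  proof (intro conjI allI)
    show "c 0 = [0]" using f0 by (simp add: c_def)
    show "multigraded_map (c i) (c (Suc i)) (\<Lambda> i)" for i by (rule step(1))
    show "scalar_apply (\<Lambda> 0) (c (Suc 0)) ` supported (c (Suc 0)) b = {v \<in> supported (c 0) b. v \<noteq> 0 \<longrightarrow> b \<in> U}" for b
      unfolding step(3) f0(2) by (simp add: V0_def c_def f0(1))
    show "scalar_apply (\<Lambda> (Suc i)) (c (Suc (Suc i))) ` supported (c (Suc (Suc i))) b
       = {v \<in> supported (c (Suc i)) b. scalar_apply (\<Lambda> i) (c (Suc i)) v = 0}" for i b
      unfolding step(3) step(4) by simp
  qed
  then show ?thesis using step(2) by blast
qed

section \<open>Regularity\<close>

text \<open>The new complex in degree \<open>b\<close> is the old complex in degree \<open>b + e\<close>, because \<open>a - e\<close> divides \<open>b\<close> if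
  and only if \<open>a\<close> divides \<open>b + e\<close>, also where the subtraction is truncated.\<close>

lemma multigraded_resolution_shift:
  fixes c :: "nat \<Rightarrow> ('n::finite \<Rightarrow>\<^sub>0 nat) list" and \<Lambda> :: "nat \<Rightarrow> nat \<Rightarrow> nat \<Rightarrow> 'k::field"
  assumes res: "multigraded_resolution U c \<Lambda>"
  shows "multigraded_resolution {a. a + e \<in> U} (\<lambda>i. map (\<lambda>a. a - e) (c i)) \<Lambda>"
proof -
  have c0: "c 0 = [0]" and map: "\<And>i. multigraded_map (c i) (c (Suc i)) (\<Lambda> i)"
    and ex0: "\<And>b. scalar_apply (\<Lambda> 0) (c (Suc 0)) ` supported (c (Suc 0)) b = {v \<in> supported (c 0) b. v \<noteq> 0 \<longrightarrow> b \<in> U}"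
    and ex: "\<And>i b. scalar_apply (\<Lambda> (Suc i)) (c (Suc (Suc i))) ` supported (c (Suc (Suc i))) b
       = {v \<in> supported (c (Suc i)) b. scalar_apply (\<Lambda> i) (c (Suc i)) v = 0}"
    using res by (simp_all add: multigraded_resolution_def)
  have le: "a - e \<preceq> b \<longleftrightarrow> a \<preceq> b + e" for a b :: "'n \<Rightarrow>\<^sub>0 nat"
    by (simp add: exponent_le_def lookup_add lookup_minus le_diff_conv)
  have sup: "supported (List.map (\<lambda>a. a - e) (c i)) b = (supported (c i) (b + e) :: (nat \<Rightarrow> 'k) set)" for i b
    by (auto simp: supported_def le)
  have app: "scalar_apply (\<Lambda> i) (List.map (\<lambda>a. a - e) (c j)) = scalar_apply (\<Lambda> i) (c j)" for i j
    by (simp add: scalar_apply_def fun_eq_iff)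
  have mono: "a - e \<preceq> a' - e" if "a \<preceq> a'" for a a' :: "'n \<Rightarrow>\<^sub>0 nat"
    using that by (simp add: exponent_le_def lookup_minus diff_le_mono)
  have "multigraded_map (List.map (\<lambda>a. a - e) (c i)) (List.map (\<lambda>a. a - e) (c (Suc i))) (\<Lambda> i)" for i
    using map[of i] mono by (simp add: multigraded_map_def)
  moreover have "(0 :: 'n \<Rightarrow>\<^sub>0 nat) - e = 0" by (rule poly_mapping_eqI) (simp add: lookup_minus)
  ultimately show ?thesis
    unfolding multigraded_resolution_def sup app ex0 ex by (simp add: c0)
qed

theorem regularity_quotient_colon_monomial:
  fixes U :: "('n::finite \<Rightarrow>\<^sub>0 nat) set"
  assumes up: "upward_closed U" and proper: "0 \<notin> U" and box: "\<And>b. b \<in> U \<longleftrightarrow> exponent_meet b B \<in> U"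
  shows "regularity_quotient (monomial_ideal {a. a + e \<in> U} :: ('n, 'k::field) mpolynomial set)
    \<le> regularity_quotient (monomial_ideal U :: ('n, 'k) mpolynomial set)"
proof -
  obtain c and \<Lambda> :: "nat \<Rightarrow> nat \<Rightarrow> nat \<Rightarrow> 'k" where res: "multigraded_resolution U c \<Lambda>"
    and min: "\<And>i s t. \<Lambda> i s t \<noteq> 0 \<Longrightarrow> c i ! s \<noteq> c (Suc i) ! t"
    using multigraded_minimal_resolution_exists[OF up proper box] by blast
  let ?I = "monomial_ideal U :: ('n, 'k) mpolynomial set"
  let ?I' = "monomial_ideal {a. a + e \<in> U} :: ('n, 'k) mpolynomial set"
  let ?ds = "\<lambda>i. map (\<lambda>a. int (total_degree a)) (c i)"
  have resI: "minimal_graded_free_resolution ?I ?ds (\<lambda>i. monomial_matrix (c i) (c (Suc i)) (\<Lambda> i))"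
    by (rule minimal_resolution_of_multigraded[OF res min])
  have resI': "graded_free_resolution ?I' (\<lambda>i. map (\<lambda>a. int (total_degree a)) (map (\<lambda>a. a - e) (c i)))
      (\<lambda>i. monomial_matrix (map (\<lambda>a. a - e) (c i)) (map (\<lambda>a. a - e) (c (Suc i))) (\<Lambda> i))"
    by (rule graded_free_resolution_of_multigraded[OF multigraded_resolution_shift[OF res]])
  show ?thesis
    unfolding regularity_quotient_def
  proof (rule SUP_least)
    fix x assume "x \<in> {(i, j). \<exists>ds \<phi>. minimal_graded_free_resolution ?I' ds \<phi> \<and> j \<in> set (ds i)}"
    then obtain i j ds \<phi> where x: "x = (i, j)" "minimal_graded_free_resolution ?I' ds \<phi>" "j \<in> set (ds i)" by auto
    then have "j \<in> set (map (\<lambda>a. int (total_degree a)) (map (\<lambda>a. a - e) (c i)))"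
      using minimal_shifts_subset[OF x(2) resI', of i] by blast
    then obtain a where a: "a \<in> set (c i)" "j = int (total_degree (a - e))" by auto
    have "a - e \<preceq> a" by (simp add: exponent_le_def lookup_minus)
    then have "j \<le> int (total_degree a)" using total_degree_mono a(2) by simp
    moreover have "(i, int (total_degree a)) \<in> {(i, j). \<exists>ds \<phi>. minimal_graded_free_resolution ?I ds \<phi> \<and> j \<in> set (ds i)}"
      using resI a(1) by auto
    ultimately show "(case x of (i, j) \<Rightarrow> ereal (real_of_int (j - int i)))
      \<le> (SUP (i, j)\<in>{(i, j). \<exists>ds \<phi>. minimal_graded_free_resolution ?I ds \<phi> \<and> j \<in> set (ds i)}. ereal (real_of_int (j - int i)))"
      by (intro SUP_upper2[of "(i, int (total_degree a))"]) (simp_all add: x(1))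
  qed
qed

section \<open>A vertex cover meeting every edge once\<close>

lemma set_covering_polyhedron_iff:
  "x \<in> set_covering_polyhedron E \<longleftrightarrow> (\<forall>i. 0 \<le> vec_nth x i) \<and> (\<forall>e\<in>E. 1 \<le> (\<Sum>i\<in>e. vec_nth x i))"
proof -
  have "(\<Sum>i\<in>UNIV. vec_nth x i * incidence_matrix i e) = (\<Sum>i\<in>e. vec_nth x i)" for e
  proof -
    have "(\<Sum>i\<in>UNIV. vec_nth x i * incidence_matrix i e) = (\<Sum>i\<in>UNIV. if i \<in> e then vec_nth x i else 0)"
      by (rule sum.cong) (simp_all add: incidence_matrix_def)
    also have "\<dots> = (\<Sum>i\<in>e. vec_nth x i)" by (simp add: sum.If_cases)
    finally show ?thesis .
  qed
  then show ?thesis by (simp add: set_covering_polyhedron_def)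
qed

text \<open>Extreme points of a face of the polyhedron are extreme points of the polyhedron. Besides the tight
  covering inequalities the face \<open>F\<close> requires the coordinates of vertices on no edge to vanish;
  otherwise it would be unbounded and compactness could not be used to find an extreme point.\<close>

lemma exact_cover_exists:
  fixes E :: "'n::finite set set"
  assumes clutter: "clutter E" and uniform: "uniform_clutter E"
    and integral: "integral_polyhedron (set_covering_polyhedron E)"
  shows "\<exists>C. \<forall>e\<in>E. card (C \<inter> e) = 1"
proof -
  obtain d where d: "\<And>e. e \<in> E \<Longrightarrow> card e = d" using uniform by (auto simp: uniform_clutter_def)
  obtain e0 where e0: "e0 \<in> E" using clutter by (auto simp: clutter_def)
  then have "e0 \<noteq> {}" using clutter by (auto simp: clutter_def)
  then have dpos: "d > 0" using d[OF e0] by (metis card_gt_0_iff finite)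
  define F where "F = {x :: real ^ 'n. (\<forall>i. 0 \<le> vec_nth x i) \<and> (\<forall>e\<in>E. (\<Sum>i\<in>e. vec_nth x i) = 1)
    \<and> (\<forall>i. i \<notin> \<Union>E \<longrightarrow> vec_nth x i = 0)}"
  have le1: "vec_nth x i \<le> 1" if "x \<in> F" for x i
  proof (cases "i \<in> \<Union>E")
    case True
    then obtain e where e: "e \<in> E" "i \<in> e" by blast
    have "vec_nth x i \<le> (\<Sum>i\<in>e. vec_nth x i)"
      using that e(2) by (intro member_le_sum) (auto simp: F_def)
    then show ?thesis using that e(1) by (simp add: F_def)
  next
    case False
    then show ?thesis using that by (simp add: F_def)
  qed
  have "closed F"
  proof -
    have "F = (\<Inter>i. {x. 0 \<le> vec_nth x i}) \<inter> (\<Inter>e\<in>E. {x. (\<Sum>i\<in>e. vec_nth x i) = 1})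
        \<inter> (\<Inter>i\<in>- \<Union>E. {x. vec_nth x i = 0})"
      by (auto simp: F_def)
    also have "closed \<dots>"
      by (intro closed_Int closed_INT ballI closed_Collect_le closed_Collect_eq continuous_intros)
    finally show ?thesis .
  qed
  moreover have "bounded F"
  proof (rule bounded_subset)
    show "F \<subseteq> cbox (\<chi> i. 0) (\<chi> i. 1)" using le1 by (auto simp: mem_box_cart F_def)
  qed (rule bounded_cbox)
  ultimately have "compact F" by (simp add: compact_eq_bounded_closed)
  moreover have "convex F"
  proof (rule convexI)
    fix x y :: "real ^ 'n" and u v :: real
    assume xy: "x \<in> F" "y \<in> F" and uv: "0 \<le> u" "0 \<le> v" "u + v = 1"
    have "(\<Sum>i\<in>e. u * vec_nth x i + v * vec_nth y i) = 1" if "e \<in> E" for e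
      using xy that uv(3) by (simp add: F_def sum.distrib flip: sum_distrib_left)
    then show "u *\<^sub>R x + v *\<^sub>R y \<in> F" using xy uv by (simp add: F_def)
  qed
  moreover have "(\<chi> i. if i \<in> \<Union>E then 1 / real d else 0) \<in> F"
  proof -
    have "(\<Sum>i\<in>e. if i \<in> \<Union>E then 1 / real d else 0) = 1" if "e \<in> E" for e
    proof -
      have "(\<Sum>i\<in>e. if i \<in> \<Union>E then 1 / real d else 0) = (\<Sum>i\<in>e. 1 / real d)"
        by (rule sum.cong) (use that in auto)
      then show ?thesis using d[OF that] dpos by simp
    qed
    then show ?thesis by (simp add: F_def)
  qed
  ultimately obtain v where v: "v extreme_point_of F"
    using extreme_point_exists_convex[of F] by blast
  then have vF: "v \<in> F" by (simp add: extreme_point_of_def)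
  have "v extreme_point_of set_covering_polyhedron E"
    unfolding extreme_point_of_def
  proof (intro conjI ballI notI)
    show "v \<in> set_covering_polyhedron E" using vF by (simp add: set_covering_polyhedron_iff F_def)
  next
    fix a b assume a: "a \<in> set_covering_polyhedron E" and b: "b \<in> set_covering_polyhedron E"
      and seg: "v \<in> open_segment a b"
    then obtain u where u: "0 < u" "u < 1" "v = (1 - u) *\<^sub>R a + u *\<^sub>R b" by (auto simp: in_segment)
    (* A point between two points that satisfy an inequality can make it tight only if both do. *)
    have mix: "y = z \<and> y' = z" if "(1 - u) * y + u * y' = z" "z \<le> y" "z \<le> y'" for y y' z :: real
    proof -
      have "(1 - u) * (y - z) + u * (y' - z) = 0" using that(1) by (simp add: algebra_simps)
      moreover have "0 \<le> (1 - u) * (y - z)" "0 \<le> u * (y' - z)" using u that by simp_all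
      ultimately have "(1 - u) * (y - z) = 0" "u * (y' - z) = 0" by linarith+
      then show ?thesis using u by simp
    qed
    have zero: "vec_nth a i = 0 \<and> vec_nth b i = 0" if "i \<notin> \<Union>E" for i
    proof (rule mix)
      show "(1 - u) * vec_nth a i + u * vec_nth b i = 0"
        using vF that u(3) by (simp add: F_def)
    qed (use a b in \<open>simp_all add: set_covering_polyhedron_iff\<close>)
    have one: "(\<Sum>i\<in>e. vec_nth a i) = 1 \<and> (\<Sum>i\<in>e. vec_nth b i) = 1" if "e \<in> E" for e
    proof (rule mix)
      have "(\<Sum>i\<in>e. vec_nth v i) = 1" using vF that by (simp add: F_def)
      then show "(1 - u) * (\<Sum>i\<in>e. vec_nth a i) + u * (\<Sum>i\<in>e. vec_nth b i) = 1"
        by (simp add: u(3) sum.distrib sum_distrib_left)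
    qed (use a b that in \<open>simp_all add: set_covering_polyhedron_iff\<close>)
    have "a \<in> F" "b \<in> F" using a b zero one by (simp_all add: F_def set_covering_polyhedron_iff)
    then show False using v seg by (simp add: extreme_point_of_def)
  qed
  then have int: "vec_nth v i \<in> \<int>" for i using integral by (simp add: integral_polyhedron_def)
  have v01: "vec_nth v i = 0 \<or> vec_nth v i = 1" for i
  proof -
    obtain z where z: "vec_nth v i = real_of_int z" using int by (auto elim: Ints_cases)
    have "0 \<le> z" "z \<le> 1" using vF le1[OF vF, of i] z by (auto simp: F_def) (metis of_int_0_le_iff)
    then have "z = 0 \<or> z = 1" by linarith
    then show ?thesis using z by auto
  qed
  define C where "C = {i. vec_nth v i = 1}"
  have "card (C \<inter> e) = 1" if "e \<in> E" for e
  proof -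
    have "real (card (C \<inter> e)) = (\<Sum>i\<in>C \<inter> e. vec_nth v i)" by (simp add: C_def)
    also have "\<dots> = (\<Sum>i\<in>e. vec_nth v i)"
      by (rule sum.mono_neutral_left) (use v01 in \<open>auto simp: C_def\<close>)
    also have "\<dots> = 1" using vF that by (simp add: F_def)
    finally show ?thesis by simp
  qed
  then show ?thesis by blast
qed

section \<open>Symbolic powers of the ideal of covers\<close>

definition partial_degree :: "'n set \<Rightarrow> ('n::finite \<Rightarrow>\<^sub>0 nat) \<Rightarrow> nat" where
  "partial_degree e a = (\<Sum>i\<in>e. lookup a i)"

lemma partial_degree_add: "partial_degree e (a + b) = partial_degree e a + partial_degree e b"
  by (simp add: partial_degree_def lookup_add sum.distrib)

lemma partial_degree_zero [simp]: "partial_degree e 0 = 0"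
  by (simp add: partial_degree_def)

definition indicator_exponent :: "'n set \<Rightarrow> 'n::finite \<Rightarrow>\<^sub>0 nat" where
  "indicator_exponent C = (\<Sum>i\<in>C. single i 1)"

lemma lookup_indicator_exponent: "lookup (indicator_exponent C) i = (if i \<in> C then 1 else 0)"
  by (simp add: indicator_exponent_def lookup_sum lookup_single when_def)

lemma partial_degree_indicator: "partial_degree e (indicator_exponent C) = card (C \<inter> e)"
  by (simp add: partial_degree_def lookup_indicator_exponent sum.If_cases Int_commute)

lemma prod_variable: "(\<Prod>i\<in>C. variable i :: ('n::finite, 'k::field) mpolynomial) = single (indicator_exponent C) 1"
proof (induction C rule: infinite_finite_induct)
  case (insert x F)
  then show ?case by (simp add: variable_def mult_single indicator_exponent_def)
qed (simp_all add: indicator_exponent_def)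

text \<open>The \<open>k\<close>-th power of the prime ideal generated by the variables in \<open>e\<close>, described by its monomials.\<close>

definition edge_ideal_power :: "'n::finite set \<Rightarrow> nat \<Rightarrow> ('n, 'k::field) mpolynomial set" where
  "edge_ideal_power e k = monomial_ideal {a. k \<le> partial_degree e a}"

lemma edge_ideal_power_is_ideal: "is_ideal (edge_ideal_power e k)"
  unfolding edge_ideal_power_def
  by (rule monomial_ideal_is_ideal) (simp add: upward_closed_def partial_degree_add trans_le_add1)

text \<open>If neither factor is in the ideal, both have terms free of the variables in \<open>e\<close>. The greatest such
  terms of \<open>p\<close> and \<open>q\<close> have a product that cannot cancel: two exponents with the same sum are free of
  these variables, too, and none of them exceeds the greatest one.\<close>

lemma edge_ideal_prime: "is_prime_ideal (edge_ideal_power e 1 :: ('n::finite, 'k::field) mpolynomial set)"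
  unfolding is_prime_ideal_def
proof (intro conjI allI impI)
  let ?P = "edge_ideal_power e 1 :: ('n, 'k) mpolynomial set"
  show "is_ideal ?P" by (rule edge_ideal_power_is_ideal)
  have "1 \<notin> ?P" by (simp add: edge_ideal_power_def monomial_ideal_def)
  then show "?P \<noteq> UNIV" by blast
  fix p q :: "('n, 'k) mpolynomial"
  assume pq: "p * q \<in> ?P"
  show "p \<in> ?P \<or> q \<in> ?P"
  proof (rule ccontr)
    assume "\<not> (p \<in> ?P \<or> q \<in> ?P)"
    then have ne: "{a \<in> keys p. partial_degree e a = 0} \<noteq> {}"
      "{a \<in> keys q. partial_degree e a = 0} \<noteq> {}"
      by (auto simp: edge_ideal_power_def monomial_ideal_def not_less_eq_eq)
    have fin: "finite {a \<in> keys p. partial_degree e a = 0}"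
      "finite {a \<in> keys q. partial_degree e a = 0}" by simp_all
    obtain a where a: "a \<in> keys p" "partial_degree e a = 0"
      "\<And>c. c \<in> keys p \<Longrightarrow> partial_degree e c = 0 \<Longrightarrow> c \<noteq> a \<Longrightarrow> (c, a) \<in> monomial_less"
      using monomial_greatest_exists[OF fin(1) ne(1)] by auto
    obtain b where b: "b \<in> keys q" "partial_degree e b = 0"
      "\<And>c. c \<in> keys q \<Longrightarrow> partial_degree e c = 0 \<Longrightarrow> c \<noteq> b \<Longrightarrow> (c, b) \<in> monomial_less"
      using monomial_greatest_exists[OF fin(2) ne(2)] by auto
    have "lookup (p * q) (a + b) = lookup p a * lookup q b"
    proof (rule lookup_mult_leading)
      fix c d assume c: "c \<in> keys p" and d: "d \<in> keys q" and cd: "c + d = a + b"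
      have "partial_degree e c + partial_degree e d = 0"
        using cd a(2) b(2) by (metis add_0 partial_degree_add)
      then have deg: "partial_degree e c = 0" "partial_degree e d = 0" by simp_all
      show "c = a \<and> d = b"
      proof (cases "c = a")
        case True
        then show ?thesis using cd by simp
      next
        case False
        then have "(c, a) \<in> monomial_less" using a(3) c deg by blast
        then have 1: "(c + d, a + d) \<in> monomial_less" by (rule add_monomial_less)
        have "d \<noteq> b" using False cd by auto
        then have "(d, b) \<in> monomial_less" using b(3) d deg by blast
        then have "(d + a, b + a) \<in> monomial_less" by (rule add_monomial_less)
        then have "(a + d, a + b) \<in> monomial_less" by (simp add: add.commute)
        then have "(c + d, a + b) \<in> monomial_less" using 1 trans_monomial_less by (meson transD)
        then show ?thesis using cd wf_irrefl[OF wf_monomial_less] by auto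
      qed
    qed
    then have "a + b \<in> keys (p * q)" using a(1) b(1) by (simp add: in_keys_iff)
    then have "1 \<le> partial_degree e (a + b)" using pq by (auto simp: edge_ideal_power_def monomial_ideal_def)
    then show False using a(2) b(2) by (simp add: partial_degree_add)
  qed
qed

lemma ideal_power_edge_ideal:
  "ideal_power (edge_ideal_power e 1 :: ('n::finite, 'k::field) mpolynomial set) k = edge_ideal_power e k"
proof (induction k)
  case 0
  show ?case by (simp add: edge_ideal_power_def monomial_ideal_def)
next
  case (Suc k)
  let ?P = "edge_ideal_power e 1 :: ('n, 'k) mpolynomial set"
  let ?G = "{a * b | a b. a \<in> ?P \<and> b \<in> edge_ideal_power e k}"
  have "ideal_span ?G = edge_ideal_power e (Suc k)"
  proof
    show "ideal_span ?G \<subseteq> edge_ideal_power e (Suc k)"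
    proof (rule ring_ideal.span_minimal[OF _ edge_ideal_power_is_ideal])
      show "?G \<subseteq> edge_ideal_power e (Suc k)"
      proof (clarify)
        fix p q :: "('n, 'k) mpolynomial" assume pq: "p \<in> ?P" "q \<in> edge_ideal_power e k"
        have "Suc k \<le> partial_degree e m" if "m \<in> keys (p * q)" for m
        proof -
          obtain c d where cd: "m = c + d" "c \<in> keys p" "d \<in> keys q"
            using keys_mult[of p q] \<open>m \<in> keys (p * q)\<close> by blast
          then have "1 \<le> partial_degree e c" "k \<le> partial_degree e d"
            using pq by (auto simp: edge_ideal_power_def monomial_ideal_def)
          then show ?thesis by (simp add: cd(1) partial_degree_add)
        qed
        then show "p * q \<in> edge_ideal_power e (Suc k)" by (auto simp: edge_ideal_power_def monomial_ideal_def)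
      qed
    qed
    show "edge_ideal_power e (Suc k) \<subseteq> ideal_span ?G"
      unfolding edge_ideal_power_def[of e "Suc k"]
    proof (rule monomial_ideal_subset_ideal[OF ring_ideal.subspace_span])
      fix a assume "a \<in> {a. Suc k \<le> partial_degree e a}"
      then have a: "Suc k \<le> partial_degree e a" by simp
      then obtain i where i: "i \<in> e" "lookup a i \<noteq> 0"
        unfolding partial_degree_def by (metis Suc_le_D nat.distinct(1) sum.neutral)
      let ?x = "single i (1::nat)"
      have eq: "a = ?x + (a - ?x)"
        by (rule poly_mapping_eqI) (use i in \<open>auto simp: lookup_add lookup_minus lookup_single when_def\<close>)
      have x1: "partial_degree e ?x = 1"
        using i(1) by (simp add: partial_degree_def lookup_single when_def)
      have "partial_degree e a = 1 + partial_degree e (a - ?x)"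
        using arg_cong[OF eq, of "partial_degree e"] x1 by (simp add: partial_degree_add)
      then have "single (a - ?x) 1 \<in> (edge_ideal_power e k :: ('n, 'k) mpolynomial set)"
        using a by (simp add: edge_ideal_power_def monomial_ideal_def)
      moreover have "single ?x 1 \<in> ?P"
        using x1 by (simp add: edge_ideal_power_def monomial_ideal_def)
      moreover have "single a 1 = single ?x 1 * (single (a - ?x) 1 :: ('n, 'k) mpolynomial)"
        using eq by (simp add: mult_single)
      ultimately have "single a 1 \<in> ?G" by blast
      then show "single a 1 \<in> ideal_span ?G" by (rule ring_ideal.span_base)
    qed
  qed
  then show ?case by (simp only: ideal_power.simps Suc.IH)
qed

text \<open>The exponent vectors of the monomials in the \<open>k\<close>-th symbolic power of the ideal of covers.\<close>

definition cover_exponents :: "'n::finite set set \<Rightarrow> nat \<Rightarrow> ('n \<Rightarrow>\<^sub>0 nat) set" where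
  "cover_exponents E k = {a. \<forall>e\<in>E. k \<le> partial_degree e a}"

lemma upward_closed_cover_exponents: "upward_closed (cover_exponents E k)"
  by (simp add: upward_closed_def cover_exponents_def partial_degree_add trans_le_add1)

lemma monomial_ideal_cover_exponents:
  "monomial_ideal (cover_exponents E k) = (\<Inter>e\<in>E. edge_ideal_power e k)"
  by (auto simp: monomial_ideal_def cover_exponents_def edge_ideal_power_def)

lemma ideal_of_covers_eq:
  "(ideal_of_covers E :: ('n::finite, 'k::field) mpolynomial set) = monomial_ideal (cover_exponents E 1)"
proof
  show "(ideal_of_covers E :: ('n, 'k) mpolynomial set) \<subseteq> monomial_ideal (cover_exponents E 1)"
    unfolding ideal_of_covers_def
  proof (rule ring_ideal.span_minimal[OF _ monomial_ideal_is_ideal[OF upward_closed_cover_exponents]])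
    have "indicator_exponent C \<in> cover_exponents E 1" if "minimal_vertex_cover E C" for C
    proof -
      have "card (C \<inter> e) \<noteq> 0" if "e \<in> E" for e
        using \<open>minimal_vertex_cover E C\<close> that by (simp add: minimal_vertex_cover_def vertex_cover_def)
      then show ?thesis by (simp add: cover_exponents_def partial_degree_indicator Suc_le_eq card_gt_0_iff)
    qed
    then show "{\<Prod>i\<in>C. variable i | C. minimal_vertex_cover E C} \<subseteq> (monomial_ideal (cover_exponents E 1) :: ('n, 'k) mpolynomial set)"
      by (auto simp: prod_variable monomial_ideal_def)
  qed
  show "monomial_ideal (cover_exponents E 1) \<subseteq> (ideal_of_covers E :: ('n, 'k) mpolynomial set)"
    unfolding ideal_of_covers_def
  proof (rule monomial_ideal_subset_ideal[OF ring_ideal.subspace_span])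
    fix a assume a: "a \<in> cover_exponents E 1"
    define S where "S = {i. lookup a i \<noteq> 0}"
    have "vertex_cover E S"
      unfolding vertex_cover_def
    proof
      fix e assume "e \<in> E"
      then have "partial_degree e a \<noteq> 0" using a by (auto simp: cover_exponents_def)
      then obtain i where "i \<in> e" "lookup a i \<noteq> 0"
        unfolding partial_degree_def by (metis sum.neutral)
      then show "S \<inter> e \<noteq> {}" by (auto simp: S_def)
    qed
    then obtain C where C: "C \<subseteq> S" "vertex_cover E C" "\<And>C'. C' \<subseteq> S \<Longrightarrow> vertex_cover E C' \<Longrightarrow> C' \<subseteq> C \<Longrightarrow> C = C'"
      using finite_has_minimal2[of "{C. C \<subseteq> S \<and> vertex_cover E C}" S] by auto
    have min: "minimal_vertex_cover E C" unfolding minimal_vertex_cover_def using C by blast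
    have eq: "a = (a - indicator_exponent C) + indicator_exponent C"
      by (rule poly_mapping_eqI) (use C(1) in \<open>auto simp: lookup_add lookup_minus lookup_indicator_exponent S_def\<close>)
    have "(\<Prod>i\<in>C. variable i) \<in> ideal_span {\<Prod>i\<in>C. variable i :: ('n, 'k) mpolynomial | C. minimal_vertex_cover E C}"
      using min by (intro ring_ideal.span_base) blast
    then have "single (a - indicator_exponent C) 1 * (\<Prod>i\<in>C. variable i) \<in>
        ideal_span {\<Prod>i\<in>C. variable i :: ('n, 'k) mpolynomial | C. minimal_vertex_cover E C}"
      by (rule ideal_mult_left[OF ring_ideal.subspace_span])
    then show "single a 1 \<in> ideal_span {\<Prod>i\<in>C. variable i :: ('n, 'k) mpolynomial | C. minimal_vertex_cover E C}"
      using eq by (simp add: prod_variable mult_single)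
  qed
qed

text \<open>The ideal of covers is the intersection of the primes of the edges, so a prime annihilator of an
  element \<open>f\<close> is the intersection of those of them that do not contain \<open>f\<close>, and hence equal to one of
  them. Each of them occurs: since no edge contains another, the product of the variables outside \<open>e\<close>
  lies in the primes of all edges except \<open>e\<close>.\<close>

lemma associated_primes_ideal_of_covers:
  fixes E :: "'n::finite set set"
  assumes "clutter E"
  shows "associated_primes (ideal_of_covers E :: ('n, 'k::field) mpolynomial set) = (\<lambda>e. edge_ideal_power e 1) ` E"
proof
  let ?J = "ideal_of_covers E :: ('n, 'k) mpolynomial set"
  let ?P = "\<lambda>e. edge_ideal_power e 1 :: ('n, 'k) mpolynomial set"
  have J: "?J = (\<Inter>e\<in>E. ?P e)" by (simp only: ideal_of_covers_eq monomial_ideal_cover_exponents)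
  have prime: "f \<in> ?P e \<or> g \<in> ?P e" if "f * g \<in> ?P e" for e f g
    using edge_ideal_prime[of e, where 'k = 'k] that by (auto simp: is_prime_ideal_def)
  show "associated_primes ?J \<subseteq> ?P ` E"
  proof
    fix P assume "P \<in> associated_primes ?J"
    then obtain f where P: "is_prime_ideal P" "P = {g. g * f \<in> ?J}" by (auto simp: associated_primes_def)
    have "(\<Inter>e\<in>{e \<in> E. f \<notin> ?P e}. ?P e) \<subseteq> P"
    proof
      fix g assume g: "g \<in> (\<Inter>e\<in>{e \<in> E. f \<notin> ?P e}. ?P e)"
      have "g * f \<in> ?P e" if "e \<in> E" for e
      proof (cases "f \<in> ?P e")
        case True
        then show ?thesis by (rule ideal_mult_left[OF edge_ideal_power_is_ideal])
      next
        case False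
        then have "g \<in> ?P e" using g that by blast
        then show ?thesis by (rule ideal_mult_right[OF edge_ideal_power_is_ideal])
      qed
      then show "g \<in> P" by (simp add: P(2) J)
    qed
    then obtain e where e: "e \<in> E" "f \<notin> ?P e" "?P e \<subseteq> P"
      using prime_ideal_contains_factor[OF P(1), of "{e \<in> E. f \<notin> ?P e}" ?P] edge_ideal_power_is_ideal by auto
    have "P \<subseteq> ?P e"
    proof
      fix g assume "g \<in> P"
      then have "g * f \<in> ?P e" using e(1) by (simp add: P(2) J)
      then show "g \<in> ?P e" using prime e(2) by blast
    qed
    then show "P \<in> ?P ` E" using e by blast
  qed
  show "?P ` E \<subseteq> associated_primes ?J"
  proof (clarify)
    fix e assume e: "e \<in> E"
    let ?f = "single (indicator_exponent (- e)) 1 :: ('n, 'k) mpolynomial"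
    have f: "?f \<in> ?P e' \<longleftrightarrow> e' \<noteq> e" if "e' \<in> E" for e'
    proof -
      have "- e \<inter> e' = {} \<longleftrightarrow> e' \<subseteq> e" by auto
      also have "\<dots> \<longleftrightarrow> e' = e" using assms e that unfolding clutter_def by blast
      finally show ?thesis
        by (simp add: edge_ideal_power_def monomial_ideal_def partial_degree_indicator Suc_le_eq card_gt_0_iff)
    qed
    have "?P e = {g. g * ?f \<in> ?J}"
    proof (rule Set.set_eqI, rule iffI)
      fix g assume g: "g \<in> ?P e"
      have "g * ?f \<in> ?P e'" if "e' \<in> E" for e'
        using f[OF that] g ideal_mult_left[OF edge_ideal_power_is_ideal] ideal_mult_right[OF edge_ideal_power_is_ideal]
        by (cases "e' = e") auto
      then show "g \<in> {g. g * ?f \<in> ?J}" by (simp add: J)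
    next
      fix g assume "g \<in> {g. g * ?f \<in> ?J}"
      then have "g * ?f \<in> ?P e" using e by (simp add: J)
      then show "g \<in> ?P e" using prime f[OF e] by blast
    qed
    then show "?P e \<in> associated_primes ?J"
      unfolding associated_primes_def using edge_ideal_prime by blast
  qed
qed

lemma symbolic_power_ideal_of_covers:
  assumes "clutter E"
  shows "symbolic_power (ideal_of_covers E) k = monomial_ideal (cover_exponents E k)"
  unfolding symbolic_power_def associated_primes_ideal_of_covers[OF assms] monomial_ideal_cover_exponents
  by (simp only: image_image ideal_power_edge_ideal)

section \<open>Dividing by an exact cover\<close>

lemma koszul_exact_colon_squarefree:
  fixes U :: "('n::finite \<Rightarrow>\<^sub>0 nat) set"
  assumes up: "upward_closed U"
    and ex: "koszul_exact (monomial_ideal U :: ('n, 'k::field) mpolynomial set) i"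
  shows "koszul_exact (monomial_ideal {a. a + indicator_exponent C \<in> U} :: ('n, 'k) mpolynomial set) i"
proof -
  have "finite C" by simp
  then show ?thesis
  proof (induction C rule: finite_induct)
    case empty
    then show ?case using ex by (simp add: indicator_exponent_def)
  next
    case (insert x F)
    have up': "upward_closed {a. a + indicator_exponent F \<in> U}"
      unfolding upward_closed_def
    proof (intro ballI allI CollectI)
      fix a b assume "a \<in> {a. a + indicator_exponent F \<in> U}"
      then have "a + indicator_exponent F + b \<in> U" using up by (simp add: upward_closed_def)
      then show "a + b + indicator_exponent F \<in> U" by (simp only: add.assoc add.commute[of b])
    qed
    have "a + single x 1 + indicator_exponent F = a + indicator_exponent (insert x F)" for a
      using insert.hyps by (simp add: indicator_exponent_def add.assoc)
    then show ?case using koszul_exact_colon_variable[OF up' insert.IH, of x] by simp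
  qed
qed

lemma cover_exponents_shift:
  assumes "\<And>e. e \<in> E \<Longrightarrow> card (C \<inter> e) = 1"
  shows "{a. a + indicator_exponent C \<in> cover_exponents E (k + 1)} = cover_exponents E k"
  using assms by (simp add: cover_exponents_def partial_degree_add partial_degree_indicator)

text \<open>Membership only depends on the exponents up to \<open>k\<close>: an exponent of at least \<open>k\<close> at a vertex of \<open>e\<close>
  satisfies the condition for \<open>e\<close> on its own.\<close>

lemma cover_exponents_box:
  fixes E :: "'n::finite set set"
  shows "b \<in> cover_exponents E k \<longleftrightarrow> exponent_meet b (\<Sum>i\<in>UNIV. single i k) \<in> cover_exponents E k"
proof -
  let ?B = "\<Sum>i\<in>UNIV. single i k :: 'n \<Rightarrow>\<^sub>0 nat"
  have B: "lookup ?B i = k" for i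
    by (simp add: lookup_sum lookup_single when_def)
  have "k \<le> partial_degree e b \<longleftrightarrow> k \<le> partial_degree e (exponent_meet b ?B)" for e
  proof
    assume le: "k \<le> partial_degree e b"
    show "k \<le> partial_degree e (exponent_meet b ?B)"
    proof (cases "\<exists>i\<in>e. k \<le> lookup b i")
      case True
      then obtain i where i: "i \<in> e" "k \<le> lookup b i" by blast
      then have "k = lookup (exponent_meet b ?B) i" by (simp add: lookup_exponent_meet B)
      also have "\<dots> \<le> partial_degree e (exponent_meet b ?B)"
        unfolding partial_degree_def using i(1) by (intro member_le_sum) auto
      finally show ?thesis .
    next
      case False
      then have "partial_degree e (exponent_meet b ?B) = partial_degree e b"
        unfolding partial_degree_def by (intro sum.cong) (auto simp: lookup_exponent_meet B)
      then show ?thesis using le by simp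
    qed
  next
    assume "k \<le> partial_degree e (exponent_meet b ?B)"
    also have "\<dots> \<le> partial_degree e b"
      unfolding partial_degree_def by (intro sum_mono) (simp add: lookup_exponent_meet)
    finally show "k \<le> partial_degree e b" .
  qed
  then show ?thesis by (simp add: cover_exponents_def)
qed

theorem corollary4p10:
  fixes E :: "'n::finite set set" and J :: "('n, 'k::field) mpolynomial set"
  assumes "clutter E"
    and "J = ideal_of_covers E"
    and "uniform_clutter E"
    and "integral_polyhedron (set_covering_polyhedron E)"
  shows "(\<forall>k\<ge>(1::nat). depth_quotient (symbolic_power J k) \<ge> depth_quotient (symbolic_power J (k + 1))) \<and>
         (\<forall>k\<ge>(1::nat). regularity_quotient (symbolic_power J k) \<le> regularity_quotient (symbolic_power J (k + 1)))"
proof -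
  let ?I = "\<lambda>k. monomial_ideal (cover_exponents E k) :: ('n, 'k) mpolynomial set"
  have power: "symbolic_power J k = ?I k" for k
    unfolding assms(2) by (rule symbolic_power_ideal_of_covers[OF assms(1)])
  obtain C where C: "\<And>e. e \<in> E \<Longrightarrow> card (C \<inter> e) = 1"
    using exact_cover_exists[OF assms(1,3,4)] by blast
  have colon: "?I k = monomial_ideal {a. a + indicator_exponent C \<in> cover_exponents E (k + 1)}" for k
    by (simp only: cover_exponents_shift[OF C])
  have proper: "0 \<notin> cover_exponents E k" if "k \<ge> 1" for k
    using assms(1) that by (auto simp: clutter_def cover_exponents_def)
  have "depth_quotient (?I (k + 1)) \<le> depth_quotient (?I k)" if k: "k \<ge> 1" for k
  proof (rule depth_quotient_mono)
    show "is_ideal (?I (k + 1))" "is_ideal (?I k)"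
      by (intro monomial_ideal_is_ideal upward_closed_cover_exponents)+
    show "?I k \<subseteq> graded_maximal_ideal"
      using proper[OF k] by (auto simp: graded_maximal_ideal_eq monomial_ideal_def)
    show "koszul_exact (?I k) i" if "koszul_exact (?I (k + 1)) i" for i
      unfolding colon[of k] by (rule koszul_exact_colon_squarefree[OF upward_closed_cover_exponents that])
  qed
  moreover have "regularity_quotient (?I k) \<le> regularity_quotient (?I (k + 1))" for k
    unfolding colon[of k]
    by (rule regularity_quotient_colon_monomial[OF upward_closed_cover_exponents proper cover_exponents_box]) simp
  ultimately show ?thesis by (simp add: power)
qed

end
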